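(* Let $f\in\mathcal C^1(\mathbb R)$ be a nonnegative function with $f(0)=0$, and let $0\le u_0\in L^\infty(I)$. Let $v$ be any weak solution of the problem $$\partial_t u-(|u_x|^{p-2}u_x)_x+u^{-\beta}\chi_{\{u>0\}}+f(u)=0\ \text{ in } I\times(0,\infty),\qquad u(\pm l,t)=0\ (t>0),\qquad u(\cdot,0)=u_0\ \text{ in } I .$$ Then there is a finite time $T_0=T_0(\beta,p,\|u_0\|_\infty)$ such that $v(t)=0$ for $t\ge T_0$.
   Context: Here $I=(-l,l)$ is a bounded open interval, $\beta\in(0,1)$, $p>2$. $\chi_{\{u>0\}}$ is the characteristic function of the set of $(x,t)$ with $u(x,t)>0$, with the convention $u^{-\beta}\chi_{\{u>0\}}=0$ where $u=0$. $T_0(\beta,p,\|u_0\|_\infty)$ means that $T_0$ depends only on the listed quantities. Weak solution: for $0\le u_0\in L^1(I)$, a function $u\ge0$ is a weak solution if $f(u),\,u^{-\beta}\chi_{\{u>0\}}\in L^1(I\times(0,\infty))$, $u\in L^p_{loc}(0,\infty;W^{1,p}_0(I))\cap L^\infty_{loc}(\overline I\times(0,\infty))\cap\mathcal C([0,\infty);L^1(I))$, $u(\cdot,0)=u_0$, and $$\int_0^\infty\int_I\left(-u\phi_t+|u_x|^{p-2}u_x\phi_x+u^{-\beta}\chi_{\{u>0\}}\phi+f(u)\phi\right)dx\,dt=0\quad\forall\phi\in\mathcal C_c^\infty(I\times(0,\infty)).$$ *)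

theory Defs
  imports "HOL-Analysis.Analysis" "HOL-Probability.Essential_Supremum"
begin

fun Ck_differentiable :: "nat \<Rightarrow> ('a::euclidean_space \<Rightarrow> real) \<Rightarrow> bool" where
  "Ck_differentiable 0 \<phi> \<longleftrightarrow> continuous_on UNIV \<phi>"
| "Ck_differentiable (Suc k) \<phi> \<longleftrightarrow>
     \<phi> differentiable_on UNIV \<and> (\<forall>h. Ck_differentiable k (\<lambda>z. frechet_derivative \<phi> (at z) h))"

definition Cc_infty :: "'a::euclidean_space set \<Rightarrow> ('a \<Rightarrow> real) set" where
  "Cc_infty U = {\<phi>. (\<forall>k. Ck_differentiable k \<phi>) \<and>
     compact (closure {z. \<phi> z \<noteq> 0}) \<and> closure {z. \<phi> z \<noteq> 0} \<subseteq> U}"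

text \<open>Elements of the function spaces below are represented by functions; all values outside the
  domain are irrelevant.\<close>

definition Lp :: "real \<Rightarrow> 'a measure \<Rightarrow> ('a \<Rightarrow> real) set" where
  "Lp p M = {w \<in> borel_measurable M. integrable M (\<lambda>z. \<bar>w z\<bar> powr p)}"

definition Linf :: "'a measure \<Rightarrow> ('a \<Rightarrow> real) set" where
  "Linf M = {w \<in> borel_measurable M. esssup M (\<lambda>z. ereal \<bar>w z\<bar>) < \<infinity>}"

definition Linf_norm :: "'a measure \<Rightarrow> ('a \<Rightarrow> real) \<Rightarrow> real" where
  "Linf_norm M w = real_of_ereal (esssup M (\<lambda>z. ereal \<bar>w z\<bar>))"

definition L1_loc :: "'a::euclidean_space set \<Rightarrow> ('a \<Rightarrow> real) set" where
  "L1_loc S = {w. \<forall>K. compact K \<and> K \<subseteq> S \<longrightarrow> integrable (lebesgue_on K) w}"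

definition Linf_loc :: "'a::euclidean_space set \<Rightarrow> ('a \<Rightarrow> real) set" where
  "Linf_loc S = {w. \<forall>K. compact K \<and> K \<subseteq> S \<longrightarrow> w \<in> Linf (lebesgue_on K)}"

definition has_weak_deriv :: "real set \<Rightarrow> (real \<Rightarrow> real) \<Rightarrow> (real \<Rightarrow> real) \<Rightarrow> bool" where
  "has_weak_deriv I w g \<longleftrightarrow> w \<in> L1_loc I \<and> g \<in> L1_loc I \<and>
     (\<forall>\<phi>\<in>Cc_infty I. integral\<^sup>L (lebesgue_on I) (\<lambda>x. w x * deriv \<phi> x) =
                     - integral\<^sup>L (lebesgue_on I) (\<lambda>x. g x * \<phi> x))"

text \<open>On an open set the weak derivative is unique up to null sets, so the choice does not
  matter.\<close>

definition weak_deriv :: "real set \<Rightarrow> (real \<Rightarrow> real) \<Rightarrow> real \<Rightarrow> real" where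
  "weak_deriv I w = (SOME g. has_weak_deriv I w g)"

definition W1p :: "real \<Rightarrow> real set \<Rightarrow> (real \<Rightarrow> real) set" where
  "W1p p I = {w \<in> Lp p (lebesgue_on I). \<exists>g\<in>Lp p (lebesgue_on I). has_weak_deriv I w g}"

definition W1p_norm :: "real \<Rightarrow> real set \<Rightarrow> (real \<Rightarrow> real) \<Rightarrow> real" where
  "W1p_norm p I w =
     (integral\<^sup>L (lebesgue_on I) (\<lambda>x. \<bar>w x\<bar> powr p) +
      integral\<^sup>L (lebesgue_on I) (\<lambda>x. \<bar>weak_deriv I w x\<bar> powr p)) powr (1 / p)"

definition W1p_0 :: "real \<Rightarrow> real set \<Rightarrow> (real \<Rightarrow> real) set" where
  "W1p_0 p I = {w \<in> W1p p I. \<exists>\<phi>. (\<forall>n. \<phi> n \<in> Cc_infty I) \<and>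
     (\<lambda>n. W1p_norm p I (\<lambda>x. w x - \<phi> n x)) \<longlonglongrightarrow> 0}"

text \<open>The Bochner space \<open>L\<^sup>p\<^sub>l\<^sub>o\<^sub>c(J; W\<^sub>0\<^sup>1\<^sup>,\<^sup>p(I))\<close>: strong measurability is almost everywhere
  approximation by simple functions with values in \<open>W\<^sub>0\<^sup>1\<^sup>,\<^sup>p(I)\<close>.\<close>

definition Lp_loc_W1p_0 :: "real \<Rightarrow> real set \<Rightarrow> real set \<Rightarrow> (real \<Rightarrow> real \<Rightarrow> real) set" where
  "Lp_loc_W1p_0 p J I = {u.
     (AE t in lebesgue_on J. u t \<in> W1p_0 p I) \<and>
     (\<exists>s. (\<forall>n. simple_function (lebesgue_on J) (s n)) \<and> (\<forall>n. \<forall>t\<in>J. s n t \<in> W1p_0 p I) \<and>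
          (AE t in lebesgue_on J. (\<lambda>n. W1p_norm p I (\<lambda>x. u t x - s n t x)) \<longlonglongrightarrow> 0)) \<and>
     (\<forall>K. compact K \<and> K \<subseteq> J \<longrightarrow> integrable (lebesgue_on K) (\<lambda>t. W1p_norm p I (u t) powr p))}"

definition continuous_L1 :: "real set \<Rightarrow> real set \<Rightarrow> (real \<Rightarrow> real \<Rightarrow> real) set" where
  "continuous_L1 J I = {u.
     (\<forall>t\<in>J. integrable (lebesgue_on I) (u t)) \<and>
     (\<forall>t\<in>J. ((\<lambda>s. integral\<^sup>L (lebesgue_on I) (\<lambda>x. \<bar>u s x - u t x\<bar>)) \<longlongrightarrow> 0) (at t within J))}"

definition sing_absorption :: "real \<Rightarrow> real \<Rightarrow> real" where
  "sing_absorption \<beta> r = (if r > 0 then r powr (- \<beta>) else 0)"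

text \<open>The value \<open>u(x, t)\<close> is written \<open>u t x\<close>, so that \<open>u t\<close> is the profile at time \<open>t\<close>; test
  functions take the pair \<open>(x, t)\<close>. The function \<open>ux\<close> is a jointly measurable representative of
  \<open>u\<^sub>x\<close>, which a member of the Bochner space always has.\<close>

definition weak_solution ::
  "real \<Rightarrow> real \<Rightarrow> real \<Rightarrow> (real \<Rightarrow> real) \<Rightarrow> (real \<Rightarrow> real) \<Rightarrow> (real \<Rightarrow> real \<Rightarrow> real) \<Rightarrow> bool" where
  "weak_solution l \<beta> p f u0 u \<longleftrightarrow>
     (let I = {-l<..<l}; Q = I \<times> {0<..} in
       (AE (x, t) in lebesgue_on Q. u t x \<ge> 0) \<and>
       integrable (lebesgue_on Q) (\<lambda>(x, t). f (u t x)) \<and>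
       integrable (lebesgue_on Q) (\<lambda>(x, t). sing_absorption \<beta> (u t x)) \<and>
       u \<in> Lp_loc_W1p_0 p {0<..} I \<and>
       (\<lambda>(x, t). u t x) \<in> Linf_loc (closure I \<times> {0<..}) \<and>
       u \<in> continuous_L1 {0..} I \<and>
       (AE x in lebesgue_on I. u 0 x = u0 x) \<and>
       (\<exists>ux. (\<lambda>(x, t). ux t x) \<in> borel_measurable (lebesgue_on Q) \<and>
          (AE t in lebesgue_on {0<..}. has_weak_deriv I (u t) (ux t)) \<and>
          (\<forall>\<phi>\<in>Cc_infty Q.
             integral\<^sup>L (lebesgue_on Q) (\<lambda>(x, t).
               - u t x * deriv (\<lambda>\<tau>. \<phi> (x, \<tau>)) t
               + \<bar>ux t x\<bar> powr (p - 2) * ux t x * deriv (\<lambda>\<xi>. \<phi> (\<xi>, t)) x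
               + sing_absorption \<beta> (u t x) * \<phi> (x, t)
               + f (u t x) * \<phi> (x, t)) = 0)))"

end

theory Submission
  imports Defs
begin

text \<open>
  Write \<open>M\<close> for the supremum norm of the initial datum. At a spatial maximum the diffusion pushes
  a solution down and \<open>f\<close> does too, so formally the maximum \<open>m(t)\<close> of the solution satisfies
  \<open>m' \<le> - m powr (- \<beta>)\<close>: it reaches zero in finite time, at a rate that sees neither \<open>f\<close> nor the
  length of the interval. Since the absorption \<open>r powr (- \<beta>)\<close> decreases in \<open>r\<close>, two solutions
  cannot be compared with each other. Comparison with functions of time alone suffices instead.
  The constant \<open>M\<close> is a barrier because absorption and \<open>f\<close> are nonnegative. Once
  \<open>v \<le> M\<close> is known, the absorption is at least \<open>c = M powr (- \<beta>)\<close> wherever \<open>v > 0\<close>, so that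
  \<open>M - c t\<close> is a barrier until it vanishes, which happens at \<open>T = M powr (1 + \<beta>)\<close>. After \<open>T\<close> the
  constant \<open>0\<close> is a barrier. All three are instances of \<open>comparison_with_linear_barrier\<close>.

  The comparison multiplies the equation by \<open>flat (v - y)\<close>, with \<open>y\<close> the barrier and
  \<open>flat r = exp (- 1 / r)\<close> for \<open>r > 0\<close>, and follows the integral of \<open>flat_int (v - y)\<close>, where
  \<open>flat_int\<close> is the convex primitive of \<open>flat\<close>. The function \<open>flat\<close> is bounded and Lipschitz, so
  the continuity of \<open>v\<close> in \<open>L\<^sup>1\<close> controls the initial value even if \<open>v\<close> is unbounded near
  \<open>t = 0\<close>. It is also smooth and vanishes on \<open>{..0}\<close>; hence it maps smooth functions with compact
  support to such functions, and \<open>flat (v - y)\<close> is reached from honest test functions with the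
  approximations that define \<open>W\<^sub>0\<^sup>1\<^sup>,\<^sup>p\<close>.

  A weak solution has no time derivative, so the chain rule is replaced by finite differences.
  Cut-offs in time give the equation between two times \<open>s < \<tau>\<close> (\<open>weak_form_between_times\<close>). It is
  tested with the profile at the later time \<open>\<tau>\<close>; convexity of \<open>flat_int\<close> turns the left-hand side
  into an increment. The diffusion term then pairs the flux at a time \<open>\<sigma>\<close> in \<open>(s, \<tau>)\<close> with the
  gradient at \<open>\<tau>\<close>. Its negative part is at most
  \<open>\<bar>w \<sigma> - w \<tau>\<bar>\<close> with \<open>w = \<bar>v\<^sub>x\<bar> powr (p - 1) * v\<^sub>x\<close>, because the two gradients must have opposite
  signs (\<open>flux_inequality\<close>, \<open>energy_inequality\<close>). As \<open>w\<close> is integrable away from \<open>t = 0\<close>, continuity of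
  translation in \<open>L\<^sup>1\<close> makes the average of this error over \<open>\<tau>\<close> small compared with \<open>\<tau> - s\<close>, and
  the integral of \<open>flat_int (v - y)\<close> is nonincreasing.
\<close>

section \<open>Smooth functions and a flat function\<close>

lemma Ck_const: "Ck_differentiable k (\<lambda>_. c)"
  by (induction k arbitrary: c) auto

lemma Ck_add:
  "Ck_differentiable k f \<Longrightarrow> Ck_differentiable k g \<Longrightarrow> Ck_differentiable k (\<lambda>z. f z + g z)"
proof (induction k arbitrary: f g)
  case 0
  then show ?case by (auto intro: continuous_intros)
next
  case (Suc k)
  have D: "frechet_derivative (\<lambda>z. f z + g z) (at z) h =
      frechet_derivative f (at z) h + frechet_derivative g (at z) h" for z h
  proof -
    have "f differentiable at z" "g differentiable at z"
      using Suc.prems by (auto simp: differentiable_on_def)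
    then have "((\<lambda>z. f z + g z) has_derivative
      (\<lambda>h. frechet_derivative f (at z) h + frechet_derivative g (at z) h)) (at z)"
      by (intro has_derivative_add) (auto simp: frechet_derivative_works)
    from frechet_derivative_at[OF this] show ?thesis by metis
  qed
  show ?case using Suc by (auto simp: D intro: differentiable_on_add)
qed

lemma Ck_Suc_imp_Ck: "Ck_differentiable (Suc k) f \<Longrightarrow> Ck_differentiable k f"
proof (induction k arbitrary: f)
  case 0
  then show ?case by (auto intro: differentiable_imp_continuous_on)
next
  case (Suc k)
  then show ?case
    by (metis Ck_differentiable.simps(2))
qed

lemma Ck_mult:
  "Ck_differentiable k f \<Longrightarrow> Ck_differentiable k g \<Longrightarrow> Ck_differentiable k (\<lambda>z. f z * g z)"
proof (induction k arbitrary: f g)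
  case 0
  then show ?case by (auto intro: continuous_intros)
next
  case (Suc k)
  have D: "frechet_derivative (\<lambda>z. f z * g z) (at z) h =
      f z * frechet_derivative g (at z) h + frechet_derivative f (at z) h * g z" for z h
  proof -
    have "f differentiable at z" "g differentiable at z"
      using Suc.prems by (auto simp: differentiable_on_def)
    then have "((\<lambda>z. f z * g z) has_derivative
      (\<lambda>h. f z * frechet_derivative g (at z) h + frechet_derivative f (at z) h * g z)) (at z)"
      by (intro has_derivative_mult) (auto simp: frechet_derivative_works)
    from frechet_derivative_at[OF this] show ?thesis by metis
  qed
  have "Ck_differentiable k f" "Ck_differentiable k g"
    using Suc.prems Ck_Suc_imp_Ck by blast+
  then show ?case using Suc by (auto simp: D intro!: differentiable_on_mult Ck_add)
qed

lemma Ck_compose_linear: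
  fixes L :: "'a::euclidean_space \<Rightarrow> 'b::euclidean_space"
  assumes "bounded_linear L"
  shows "Ck_differentiable k f \<Longrightarrow> Ck_differentiable k (\<lambda>z. f (L z))"
proof (induction k arbitrary: f)
  case 0
  then show ?case
    using continuous_on_compose2[of UNIV f UNIV L] linear_continuous_on[OF assms] by auto
next
  case (Suc k)
  have H: "((\<lambda>z. f (L z)) has_derivative (\<lambda>h. frechet_derivative f (at (L z)) (L h))) (at z)" for z
  proof -
    have "(f has_derivative frechet_derivative f (at (L z))) (at (L z))"
      using Suc.prems by (auto simp: differentiable_on_def frechet_derivative_works)
    from has_derivative_compose[OF bounded_linear_imp_has_derivative[OF assms] this]
    show ?thesis .
  qed
  then have D: "frechet_derivative (\<lambda>z. f (L z)) (at z) h = frechet_derivative f (at (L z)) (L h)" for z h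
    by (metis frechet_derivative_at)
  have "(\<lambda>z. f (L z)) differentiable_on UNIV"
    using H by (auto simp: differentiable_on_def differentiable_def)
  then show ?case using Suc by (auto simp: D)
qed

text \<open>The derivatives of \<open>exp (- 1 / x)\<close> all have the form \<open>P (1 / x) * exp (- 1 / x)\<close> with a
  polynomial \<open>P\<close>. Treating the whole family at once makes smoothness a single induction.\<close>
definition flat_poly :: "real poly \<Rightarrow> real \<Rightarrow> real" where
  "flat_poly P x = (if x > 0 then poly P (1 / x) * exp (- (1 / x)) else 0)"

definition flat_poly_deriv :: "real poly \<Rightarrow> real poly" where
  "flat_poly_deriv P = monom 1 2 * (P - pderiv P)"

lemma poly_exp_tendsto_0: "((\<lambda>y. poly P y * exp (- y)) \<longlongrightarrow> (0::real)) at_top"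
proof -
  have "((\<lambda>y. \<Sum>i\<le>degree P. coeff P i * (y ^ i / exp y)) \<longlongrightarrow> (\<Sum>i\<le>degree P. coeff P i * 0)) at_top"
    by (intro tendsto_sum tendsto_mult tendsto_const tendsto_power_div_exp_0)
  then show ?thesis
    by (simp add: poly_altdef exp_minus divide_inverse sum_distrib_right mult.assoc)
qed

text \<open>At the origin the difference quotient is \<open>y * P y * exp (- y)\<close> with \<open>y = 1 / h\<close>, which tends
  to zero because the exponential beats every polynomial.\<close>
lemma DERIV_flat_poly: "(flat_poly P has_real_derivative flat_poly (flat_poly_deriv P) x) (at x)"
proof -
  consider "x > 0" | "x < 0" | "x = 0" by linarith
  then show ?thesis
  proof cases
    case 1
    have "((\<lambda>x. poly P (1 / x) * exp (- (1 / x))) has_real_derivative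
        flat_poly (flat_poly_deriv P) x) (at x)"
      using 1 unfolding flat_poly_def flat_poly_deriv_def
      by (auto intro!: derivative_eq_intros simp: poly_monom field_simps power2_eq_square)
    then show ?thesis
    proof (rule has_field_derivative_transform_within_open[where S="{0<..}"])
    qed (use 1 in \<open>auto simp: flat_poly_def\<close>)
  next
    case 2
    have "((\<lambda>x. 0) has_real_derivative flat_poly (flat_poly_deriv P) x) (at x)"
      using 2 by (simp add: flat_poly_def)
    then show ?thesis
    proof (rule has_field_derivative_transform_within_open[where S="{..<0}"])
    qed (use 2 in \<open>auto simp: flat_poly_def\<close>)
  next
    case 3
    have "((\<lambda>h. poly ([:0,1:] * P) (inverse h) * exp (- inverse h)) \<longlongrightarrow> 0) (at_right 0)"
      by (rule filterlim_compose[OF poly_exp_tendsto_0 filterlim_inverse_at_top_right])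
    then have "((\<lambda>h. flat_poly P h / h) \<longlongrightarrow> 0) (at_right 0)"
    proof (rule Lim_transform_eventually)
      show "\<forall>\<^sub>F h in at_right 0. poly ([:0,1:] * P) (inverse h) * exp (- inverse h) = flat_poly P h / h"
        by (auto simp: eventually_at_filter flat_poly_def field_simps)
    qed
    moreover have "((\<lambda>h. flat_poly P h / h) \<longlongrightarrow> 0) (at_left 0)"
    proof (rule Lim_transform_eventually[OF tendsto_const])
      show "\<forall>\<^sub>F h in at_left 0. 0 = flat_poly P h / h"
        by (auto simp: eventually_at_filter flat_poly_def)
    qed
    ultimately have "((\<lambda>h. flat_poly P h / h) \<longlongrightarrow> 0) (at 0)"
      using filterlim_split_at by blast
    then show ?thesis using 3 by (simp add: has_field_derivative_iff flat_poly_def)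
  qed
qed

lemma Ck_flat_poly_compose:
  assumes "\<And>j. Ck_differentiable j \<phi>"
  shows "Ck_differentiable k (\<lambda>z. flat_poly P (\<phi> z))"
proof (induction k arbitrary: P)
  case 0
  have "continuous_on UNIV (flat_poly P)"
    using DERIV_flat_poly by (meson DERIV_isCont continuous_at_imp_continuous_on)
  then show ?case
    using assms[of 0] by (auto intro: continuous_on_compose2)
next
  case (Suc k)
  have d: "(\<phi> has_derivative frechet_derivative \<phi> (at z)) (at z)" for z
    using assms[of 1] by (auto simp: differentiable_on_def frechet_derivative_works)
  have H: "((\<lambda>z. flat_poly P (\<phi> z)) has_derivative
      (\<lambda>h. flat_poly (flat_poly_deriv P) (\<phi> z) * frechet_derivative \<phi> (at z) h)) (at z)" for z
    using has_derivative_compose[OF d[of z] DERIV_flat_poly[unfolded has_field_derivative_def]]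
    by (simp add: mult.commute)
  then have D: "frechet_derivative (\<lambda>z. flat_poly P (\<phi> z)) (at z) h =
      flat_poly (flat_poly_deriv P) (\<phi> z) * frechet_derivative \<phi> (at z) h" for z h
    using frechet_derivative_at[OF H] by metis
  have "(\<lambda>z. flat_poly P (\<phi> z)) differentiable_on UNIV"
    using H by (auto simp: differentiable_on_def differentiable_def)
  moreover have "Ck_differentiable k (\<lambda>z. frechet_derivative \<phi> (at z) h)" for h
    using assms[of "Suc k"] by simp
  ultimately show ?case using Suc by (auto simp: D intro!: Ck_mult)
qed

definition flat :: "real \<Rightarrow> real" where
  "flat x = (if x > 0 then exp (- (1 / x)) else 0)"

definition flat' :: "real \<Rightarrow> real" where
  "flat' x = (if x > 0 then exp (- (1 / x)) / x\<^sup>2 else 0)"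

lemma flat_eq: "flat = flat_poly 1"
  by (auto simp: flat_def flat_poly_def)

lemma flat'_eq: "flat' = flat_poly (monom 1 2)"
  by (auto simp: flat'_def flat_poly_def poly_monom field_simps)

lemma DERIV_flat: "(flat has_real_derivative flat' x) (at x)"
  using DERIV_flat_poly[of 1 x] by (simp add: flat_eq flat'_eq flat_poly_deriv_def)

lemma continuous_flat: "continuous_on A flat"
  using DERIV_flat by (meson DERIV_isCont continuous_at_imp_continuous_on)

lemma continuous_flat': "continuous_on A flat'"
  using DERIV_flat_poly unfolding flat'_eq
  by (meson DERIV_isCont continuous_at_imp_continuous_on)

lemma flat_nonneg: "0 \<le> flat x" and flat_le_1: "flat x \<le> 1"
  and flat_eq_0_iff: "flat x = 0 \<longleftrightarrow> x \<le> 0"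
  by (auto simp: flat_def)

lemma flat'_nonneg: "0 \<le> flat' x"
  by (auto simp: flat'_def)

text \<open>With \<open>y = 1 / x\<close> this is \<open>y\<^sup>2 \<le> exp y\<close>, that is, \<open>y \<le> exp (y / 2)\<close>, which follows from the
  quadratic Taylor polynomial.\<close>
lemma flat'_le_1: "flat' x \<le> 1"
proof (cases "x > 0")
  case True
  define y where "y = 1 / x"
  have y: "y > 0" using True by (simp add: y_def)
  have "1 + y/2 + y^2/8 \<le> exp (y / 2)"
    using exp_lower_Taylor_quadratic[of "y/2"] y by (simp add: power2_eq_square)
  moreover have "y \<le> 1 + y/2 + y^2/8"
    using zero_le_power2[of "y - 2"] by (simp add: power2_eq_square algebra_simps)
  ultimately have "y \<le> exp (y / 2)" by linarith
  then have "y ^ 2 \<le> exp (y / 2) ^ 2" using y by (intro power_mono) auto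
  also have "\<dots> = exp y" by (simp flip: exp_double)
  finally have "y ^ 2 * exp (- y) \<le> 1" by (simp add: exp_minus field_simps)
  then show ?thesis using True by (simp add: flat'_def y_def field_simps)
qed (simp add: flat'_def)

lemma flat_mono: "x \<le> y \<Longrightarrow> flat x \<le> flat y"
  by (auto simp: flat_def frac_le)

lemma flat_diff_le: "\<bar>flat x - flat y\<bar> \<le> \<bar>x - y\<bar>"
proof -
  have "norm (flat x - flat y) \<le> 1 * norm (x - y)"
    by (rule field_differentiable_bound[where S=UNIV and f'=flat'])
      (use DERIV_flat flat'_le_1 flat'_nonneg in auto)
  then show ?thesis by simp
qed

lemma flat_at_top: "(flat \<longlongrightarrow> 1) at_top"
proof -
  have "((\<lambda>x::real. exp (- inverse x)) \<longlongrightarrow> exp (- 0)) at_top"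
    by (intro tendsto_intros tendsto_inverse_0_at_top filterlim_ident)
  moreover have "\<forall>\<^sub>F x in at_top. exp (- inverse x) = flat x"
    by (rule eventually_mono[OF eventually_gt_at_top[of 0]]) (simp add: flat_def inverse_eq_divide)
  ultimately show ?thesis
    using Lim_transform_eventually by force
qed

definition flat_int :: "real \<Rightarrow> real" where
  "flat_int x = integral {0..x} flat"

lemma flat_int_nonpos: "x \<le> 0 \<Longrightarrow> flat_int x = 0"
  by (cases "x = 0") (auto simp: flat_int_def)

lemma DERIV_flat_int: "(flat_int has_real_derivative flat x) (at x)"
proof -
  have E: "flat_int x = integral {a..x} flat" if "a \<le> 0" "a \<le> x" for a x
  proof (cases "x \<ge> 0")
    case True
    have "integral {a..0} flat + integral {0..x} flat = integral {a..x} flat"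
      using that True
      by (intro Henstock_Kurzweil_Integration.integral_combine integrable_continuous_interval continuous_flat)
    moreover have "integral {a..0} flat = integral {a..0} (\<lambda>_. 0)"
      by (intro Henstock_Kurzweil_Integration.integral_cong) (auto simp: flat_def)
    ultimately show ?thesis by (simp add: flat_int_def)
  next
    case False
    then have "integral {a..x} flat = integral {a..x} (\<lambda>_. 0)"
      by (intro Henstock_Kurzweil_Integration.integral_cong) (auto simp: flat_def)
    then show ?thesis using False by (simp add: flat_int_nonpos)
  qed
  define a where "a = min 0 x - 1"
  have "((\<lambda>u. integral {a..u} flat) has_real_derivative flat x) (at x within {a..x+1})"
    by (rule integral_has_real_derivative) (auto simp: a_def intro: continuous_flat)
  then have "((\<lambda>u. integral {a..u} flat) has_real_derivative flat x) (at x)"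
    using at_within_interior[of x "{a..x+1}"] by (simp add: a_def)
  then show ?thesis
  proof (rule has_field_derivative_transform_within_open[where S="{a<..}"])
    show "integral {a..u} flat = flat_int u" if "u \<in> {a<..}" for u
      using E[of a u] that by (simp add: a_def)
  qed (auto simp: a_def)
qed

lemma flat_int_convex: "flat_int x - flat_int y \<le> flat x * (x - y)"
proof -
  have "convex_on UNIV flat_int"
    by (rule convex_on_realI[where f'=flat]) (auto intro: DERIV_flat_int flat_mono)
  from convex_on_imp_above_tangent[OF this _ _ _ , of x y "flat x"] DERIV_flat_int[of x]
  have "flat_int y - flat_int x \<ge> flat x * (y - x)" by auto
  then show ?thesis by (simp add: algebra_simps)
qed

lemma flat_int_diff_le: "\<bar>flat_int x - flat_int y\<bar> \<le> \<bar>x - y\<bar>"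
proof -
  have "norm (flat_int x - flat_int y) \<le> 1 * norm (x - y)"
    by (rule field_differentiable_bound[where S=UNIV and f'=flat])
      (use DERIV_flat_int flat_le_1 flat_nonneg in auto)
  then show ?thesis by simp
qed

lemma flat_int_nonneg: "0 \<le> flat_int x"
  using flat_int_convex[of 0 x] flat_int_nonpos[of 0] by (simp add: flat_eq_0_iff flat_def)

lemma flat_int_eq_0_iff: "flat_int x = 0 \<longleftrightarrow> x \<le> 0"
proof
  assume *: "flat_int x = 0"
  show "x \<le> 0"
  proof (rule ccontr)
    assume "\<not> x \<le> 0"
    then have "flat (x/2) * (x - x/2) > 0"
      by (intro mult_pos_pos) (auto simp: flat_def)
    moreover have "flat_int (x/2) - flat_int x \<le> flat (x/2) * (x/2 - x)"
      by (rule flat_int_convex)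
    ultimately have "flat_int (x/2) < 0" using * by (simp add: algebra_simps)
    then show False using flat_int_nonneg[of "x/2"] by simp
  qed
qed (rule flat_int_nonpos)

lemma continuous_flat_int: "continuous_on A flat_int"
  using DERIV_flat_int by (meson DERIV_isCont continuous_at_imp_continuous_on)

lemma flat_borel [measurable]: "flat \<in> borel_measurable borel"
  by (intro borel_measurable_continuous_onI continuous_flat)

lemma flat'_borel [measurable]: "flat' \<in> borel_measurable borel"
  by (intro borel_measurable_continuous_onI continuous_flat')

lemma flat_int_borel [measurable]: "flat_int \<in> borel_measurable borel"
  by (intro borel_measurable_continuous_onI continuous_flat_int)

section \<open>Borel representatives of Lebesgue measurable functions\<close>

lemma AE_lebesgue_on_iff:
  assumes "S \<in> sets borel"
  shows "(AE x in lebesgue_on S. P x) \<longleftrightarrow> (AE x in lborel. x \<in> S \<longrightarrow> P x)"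
  using assms by (simp add: AE_restrict_space_iff AE_completion_iff)

lemma borel_measurable_lebesgue_on_AE_cong:
  fixes f g :: "'a::euclidean_space \<Rightarrow> real"
  assumes S: "S \<in> sets borel" and g: "g \<in> borel_measurable (lebesgue_on S)"
    and ae: "AE x in lborel. x \<in> S \<longrightarrow> f x = g x"
  shows "f \<in> borel_measurable (lebesgue_on S)"
proof -
  let ?f = "\<lambda>x. if x \<in> S then f x else 0" and ?g = "\<lambda>x. if x \<in> S then g x else 0"
  have Sl: "S \<in> sets lebesgue" using S by auto
  have mg: "?g \<in> borel_measurable lebesgue" using borel_measurable_if[OF Sl] g by blast
  have "?f \<in> borel_measurable lebesgue"
  proof (rule measurableI)
    fix B :: "real set" assume B: "B \<in> sets borel"
    have "?g -` B \<inter> space lebesgue \<in> sets lebesgue" using mg B by (rule measurable_sets)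
    moreover have "AE x in lebesgue. x \<in> ?g -` B \<inter> space lebesgue \<longleftrightarrow> x \<in> ?f -` B \<inter> space lebesgue"
      using ae by (intro AE_completion) (auto elim!: eventually_mono)
    ultimately show "?f -` B \<inter> space lebesgue \<in> sets lebesgue"
      by (intro complete_measure.in_sets_AE[OF completion.complete_measure_axioms _ _ Int_lower2])
  qed auto
  then show ?thesis using borel_measurable_if[OF Sl] by blast
qed

text \<open>Product measures and Fubini's theorem are used for \<open>lborel\<close>, whereas weak solutions live on
  \<open>lebesgue_on S\<close>. Extending the representative by zero removes the domain from all later
  integrals.\<close>
lemma lebesgue_on_borel_representative:
  fixes f :: "'a::euclidean_space \<Rightarrow> real"
  assumes S: "S \<in> sets borel" and f: "f \<in> borel_measurable (lebesgue_on S)"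
  shows "\<exists>g. g \<in> borel_measurable borel \<and> (\<forall>x. x \<notin> S \<longrightarrow> g x = 0) \<and> (AE x in lborel. x \<in> S \<longrightarrow> f x = g x)"
proof -
  have "(\<lambda>x. if x \<in> S then f x else 0) \<in> borel_measurable lebesgue"
    using borel_measurable_if[of S f] S f by auto
  then obtain h where h: "h \<in> borel_measurable lborel"
      "AE x in lborel. (if x \<in> S then f x else 0) = h x"
    using completion_ex_borel_measurable_real by blast
  have [measurable]: "h \<in> borel_measurable borel" "S \<in> sets borel" using h(1) S by auto
  have "(\<lambda>x. if x \<in> S then h x else 0) \<in> borel_measurable borel" by measurable
  moreover have "AE x in lborel. x \<in> S \<longrightarrow> f x = (if x \<in> S then h x else 0)"
    using h(2) by eventually_elim auto
  ultimately show ?thesis by (intro exI[of _ "\<lambda>x. if x \<in> S then h x else 0"]) simp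
qed

lemma
  fixes f g :: "'a::euclidean_space \<Rightarrow> real"
  assumes S: "S \<in> sets borel" and g: "g \<in> borel_measurable borel"
    and ae: "AE x in lborel. x \<in> S \<longrightarrow> f x = g x"
  shows integrable_lebesgue_on_borel:
      "integrable (lebesgue_on S) f \<longleftrightarrow> integrable lborel (\<lambda>x. indicator S x * g x)" (is ?A)
    and integral_lebesgue_on_borel:
      "integral\<^sup>L (lebesgue_on S) f = (\<integral>x. indicator S x * g x \<partial>lborel)" (is ?B)
proof -
  have Sl: "S \<inter> space lebesgue \<in> sets lebesgue" using S by auto
  have g': "g \<in> borel_measurable (lebesgue_on S)"
    using g by (intro measurable_restrict_space1 measurable_completion) simp
  have f: "f \<in> borel_measurable (lebesgue_on S)"
    by (rule borel_measurable_lebesgue_on_AE_cong[OF S g' ae])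
  have aeS: "AE x in lebesgue_on S. f x = g x"
    using ae by (simp add: AE_lebesgue_on_iff[OF S])
  have m: "(\<lambda>x. indicator S x * g x) \<in> borel_measurable lborel"
  proof -
    have [measurable]: "g \<in> borel_measurable borel" "S \<in> sets borel" using g S by auto
    show ?thesis by simp
  qed
  have "integrable (lebesgue_on S) f \<longleftrightarrow> integrable (lebesgue_on S) g"
    by (rule integrable_cong_AE[OF f g' aeS])
  also have "\<dots> \<longleftrightarrow> integrable lborel (\<lambda>x. indicator S x * g x)"
    using integrable_completion[OF m] by (simp add: integrable_restrict_space[OF Sl])
  finally show ?A .
  have "integral\<^sup>L (lebesgue_on S) f = integral\<^sup>L (lebesgue_on S) g"
    by (rule integral_cong_AE[OF f g' aeS])
  also have "\<dots> = (\<integral>x. indicator S x * g x \<partial>lborel)"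
    using integral_completion[OF m] by (simp add: integral_restrict_space[OF Sl])
  finally show ?B .
qed

text \<open>The positive and the negative part of \<open>d\<close> are densities of finite measures that agree on all
  half-lines, hence coincide.\<close>
lemma AE_zero_if_integrals_greaterThan_zero:
  fixes d :: "real \<Rightarrow> real"
  assumes d: "integrable lborel d"
    and zero: "\<And>x. (\<integral>t. indicator {x<..} t * d t \<partial>lborel) = 0"
  shows "AE x in lborel. d x = 0"
proof -
  have [measurable]: "d \<in> borel_measurable borel" using d by auto
  let ?P = "\<lambda>x. ennreal (d x)" and ?N = "\<lambda>x. ennreal (- d x)"
  have em: "emeasure (density lborel (\<lambda>x. ennreal (f x))) {x<..} =
      ennreal (\<integral>t. indicator {x<..} t * max 0 (f t) \<partial>lborel)" if f: "integrable lborel f" for f :: "real \<Rightarrow> real" and x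
  proof -
    have [measurable]: "f \<in> borel_measurable borel" using f by auto
    have i: "integrable lborel (\<lambda>t. indicator {x<..} t * max 0 (f t))"
      using integrable_mult_indicator[OF _ integrable_max[OF integrable_zero f], of "{x<..}"]
      by simp
    have "emeasure (density lborel (\<lambda>x. ennreal (f x))) {x<..} =
      (\<integral>\<^sup>+t. ennreal (f t) * indicator {x<..} t \<partial>lborel)" by (simp add: emeasure_density)
    also have "\<dots> = (\<integral>\<^sup>+t. ennreal (indicator {x<..} t * max 0 (f t)) \<partial>lborel)"
      by (intro nn_integral_cong) (auto simp: indicator_def ennreal_max_0)
    also have "\<dots> = ennreal (\<integral>t. indicator {x<..} t * max 0 (f t) \<partial>lborel)"
      using i by (intro nn_integral_eq_integral) auto
    finally show ?thesis .
  qed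
  have nd: "integrable lborel (\<lambda>x. - d x)" using d by simp
  have "(\<integral>t. indicator {x<..} t * max 0 (d t) \<partial>lborel) =
      (\<integral>t. indicator {x<..} t * max 0 (- d t) \<partial>lborel)" for x
  proof -
    have i: "integrable lborel (\<lambda>t. indicator {x<..} t * max 0 (d t))"
      "integrable lborel (\<lambda>t. indicator {x<..} t * max 0 (- d t))"
      using integrable_mult_indicator[OF _ integrable_max[OF integrable_zero d], of "{x<..}"]
        integrable_mult_indicator[OF _ integrable_max[OF integrable_zero nd], of "{x<..}"]
      by simp_all
    have "(\<integral>t. indicator {x<..} t * max 0 (d t) \<partial>lborel) - (\<integral>t. indicator {x<..} t * max 0 (- d t) \<partial>lborel)
      = (\<integral>t. indicator {x<..} t * d t \<partial>lborel)"
      unfolding Bochner_Integration.integral_diff[OF i, symmetric]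
      by (intro Bochner_Integration.integral_cong) (auto simp: indicator_def)
    then show ?thesis using zero by simp
  qed
  then have "density lborel ?P = density lborel ?N"
    by (intro measure_eqI_lessThan) (simp_all add: em[OF d] em[OF nd])
  moreover have "integral\<^sup>N lborel ?P \<noteq> \<infinity>"
  proof -
    have "integral\<^sup>N lborel ?P \<le> (\<integral>\<^sup>+x. ennreal (norm (d x)) \<partial>lborel)"
      by (intro nn_integral_mono ennreal_leI) auto
    also have "\<dots> < \<infinity>" using d unfolding integrable_iff_bounded by blast
    finally show ?thesis by simp
  qed
  ultimately have "AE x in lborel. ?P x = ?N x"
    using finite_density_unique[of ?P lborel ?N] by auto
  moreover have "d x = 0" if "?P x = ?N x" for x
    using that by (cases "d x \<ge> 0") (simp_all add: ennreal_neg)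
  ultimately show ?thesis by auto
qed

section \<open>Test functions and cut-offs\<close>

lemma Cc_Ck: "\<phi> \<in> Cc_infty U \<Longrightarrow> Ck_differentiable k \<phi>"
  by (simp add: Cc_infty_def)

lemma Cc_inftyI:
  assumes "\<And>k. Ck_differentiable k \<phi>" "compact K" "K \<subseteq> U" "{z. \<phi> z \<noteq> 0} \<subseteq> K"
  shows "\<phi> \<in> Cc_infty U"
proof -
  have sub: "closure {z. \<phi> z \<noteq> 0} \<subseteq> K"
    using assms by (intro closure_minimal compact_imp_closed)
  then have "closure {z. \<phi> z \<noteq> 0} = K \<inter> closure {z. \<phi> z \<noteq> 0}" by blast
  then have "compact (closure {z. \<phi> z \<noteq> 0})"
    using compact_Int_closed[OF assms(2) closed_closure] by metis
  then show ?thesis using sub assms unfolding Cc_infty_def by blast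
qed

lemma Cc_infty_support:
  fixes \<phi> :: "real \<Rightarrow> real"
  assumes "\<phi> \<in> Cc_infty U"
  shows "\<exists>K. compact K \<and> K \<subseteq> U \<and> (\<forall>x. x \<notin> K \<longrightarrow> \<phi> x = 0) \<and> (\<forall>x. x \<notin> K \<longrightarrow> deriv \<phi> x = 0)"
proof -
  let ?K = "closure {z. \<phi> z \<noteq> 0}"
  have z: "\<phi> x = 0" if "x \<notin> ?K" for x
    using that closure_subset[of "{z. \<phi> z \<noteq> 0}"] by auto
  have "deriv \<phi> x = 0" if x: "x \<notin> ?K" for x
  proof (rule DERIV_imp_deriv, rule has_field_derivative_transform_within_open[where S="- ?K"])
    show "((\<lambda>x. 0) has_real_derivative 0) (at x)" by simp
    show "open (- ?K)" by (intro open_Compl closed_closure)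
    show "x \<in> - ?K" using x by simp
    show "0 = \<phi> y" if "y \<in> - ?K" for y
      using z[of y] that by (metis ComplD)
  qed
  then show ?thesis
    using assms z unfolding Cc_infty_def by blast
qed

lemma Cc_infty_DERIV:
  fixes \<phi> :: "real \<Rightarrow> real"
  assumes "\<phi> \<in> Cc_infty U"
  shows "(\<phi> has_real_derivative deriv \<phi> x) (at x)"
proof -
  have "\<phi> differentiable (at x)"
    using Cc_Ck[OF assms, of 1] by (auto simp: differentiable_on_def)
  then show ?thesis by (simp add: DERIV_deriv_iff_real_differentiable)
qed

lemma Cc_infty_continuous: "\<phi> \<in> Cc_infty U \<Longrightarrow> continuous_on A \<phi>"
  using Cc_Ck[of \<phi> U 0] continuous_on_subset by auto

lemma Cc_infty_continuous_deriv:
  fixes \<phi> :: "real \<Rightarrow> real"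
  assumes "\<phi> \<in> Cc_infty U"
  shows "continuous_on A (deriv \<phi>)"
proof -
  have "deriv \<phi> x = frechet_derivative \<phi> (at x) 1" for x
  proof -
    have "(\<phi> has_derivative (\<lambda>h. deriv \<phi> x * h)) (at x)"
      using Cc_infty_DERIV[OF assms, of x] by (simp add: has_field_derivative_def)
    from frechet_derivative_at[OF this] show ?thesis by (metis mult.right_neutral)
  qed
  then have "deriv \<phi> = (\<lambda>x. frechet_derivative \<phi> (at x) 1)" by blast
  then have "continuous_on UNIV (deriv \<phi>)"
    using Cc_Ck[OF assms, of "Suc 0"] by simp
  then show ?thesis using continuous_on_subset by blast
qed

lemma Cc_infty_borel:
  assumes "\<phi> \<in> Cc_infty U" shows "\<phi> \<in> borel_measurable borel"
  using Cc_infty_continuous[OF assms] by (rule borel_measurable_continuous_onI)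

lemma Cc_infty_deriv_borel:
  fixes \<phi> :: "real \<Rightarrow> real"
  assumes "\<phi> \<in> Cc_infty U" shows "deriv \<phi> \<in> borel_measurable borel"
  using Cc_infty_continuous_deriv[OF assms] by (rule borel_measurable_continuous_onI)

lemma Cc_infty_bound:
  fixes \<phi> :: "real \<Rightarrow> real"
  assumes "\<phi> \<in> Cc_infty U"
  obtains B where "B > 0" "\<And>x. \<bar>\<phi> x\<bar> \<le> B" "\<And>x. \<bar>deriv \<phi> x\<bar> \<le> B"
proof -
  obtain K where K: "compact K" "K \<subseteq> U" "\<And>x. x \<notin> K \<Longrightarrow> \<phi> x = 0" "\<And>x. x \<notin> K \<Longrightarrow> deriv \<phi> x = 0"
    using Cc_infty_support[OF assms] by auto
  have b: "bounded (\<phi> ` K)" "bounded (deriv \<phi> ` K)"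
    using compact_imp_bounded[OF compact_continuous_image[OF Cc_infty_continuous[OF assms] K(1)]]
      compact_imp_bounded[OF compact_continuous_image[OF Cc_infty_continuous_deriv[OF assms] K(1)]]
    by auto
  obtain B1 where B1: "\<And>x. x \<in> K \<Longrightarrow> \<bar>\<phi> x\<bar> \<le> B1"
    using b(1) unfolding bounded_iff real_norm_def by blast
  obtain B2 where B2: "\<And>x. x \<in> K \<Longrightarrow> \<bar>deriv \<phi> x\<bar> \<le> B2"
    using b(2) unfolding bounded_iff real_norm_def by blast
  show ?thesis
  proof
    show "\<bar>\<phi> x\<bar> \<le> max 1 (max B1 B2)" for x
      using B1[of x] K(3)[of x] by (cases "x \<in> K") (simp_all add: le_max_iff_disj)
    show "\<bar>deriv \<phi> x\<bar> \<le> max 1 (max B1 B2)" for x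
      using B2[of x] K(4)[of x] by (cases "x \<in> K") (simp_all add: le_max_iff_disj)
  qed auto
qed

lemma Ck_affine: "Ck_differentiable k (\<lambda>x::real. c * x + d)"
proof (cases k)
  case (Suc j)
  have "((\<lambda>x::real. c * x + d) has_derivative (\<lambda>h. c * h)) (at z)" for z
    by (auto intro!: derivative_eq_intros)
  then have "frechet_derivative (\<lambda>x::real. c * x + d) (at z) h = c * h" for z h
    by (metis frechet_derivative_at)
  then show ?thesis using Suc by (simp add: Ck_const)
qed (auto intro!: continuous_intros)

text \<open>The condition \<open>0 \<le> y\<close> makes the composition vanish wherever \<open>\<phi>\<close> does. This is what lets
  truncations of \<open>v\<close> at a level \<open>y\<close> be reached from compactly supported functions.\<close>
lemma flat_Cc_infty:
  assumes "\<phi> \<in> Cc_infty U" "0 \<le> y"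
  shows "(\<lambda>x. flat (\<phi> x - y)) \<in> Cc_infty U"
proof -
  have "Ck_differentiable k (\<lambda>z. \<phi> z + (- y))" for k
    using Cc_Ck[OF assms(1)] by (intro Ck_add Ck_const)
  then have "Ck_differentiable k (\<lambda>x. flat (\<phi> x - y))" for k
    using Ck_flat_poly_compose[of "\<lambda>z. \<phi> z + (- y)" k 1] by (simp add: flat_eq)
  moreover have "{z. flat (\<phi> z - y) \<noteq> 0} \<subseteq> closure {z. \<phi> z \<noteq> 0}"
    using assms(2) closure_subset[of "{z. \<phi> z \<noteq> 0}"] by (auto simp: flat_eq_0_iff)
  ultimately show ?thesis
    using assms(1) by (intro Cc_inftyI[where K="closure {z. \<phi> z \<noteq> 0}"]) (auto simp: Cc_infty_def)
qed

lemma deriv_flat_compose: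
  fixes \<phi> :: "real \<Rightarrow> real"
  assumes "\<phi> \<in> Cc_infty U"
  shows "deriv (\<lambda>x. flat (\<phi> x - y)) x = flat' (\<phi> x - y) * deriv \<phi> x"
proof (rule DERIV_imp_deriv)
  have "((\<lambda>x. \<phi> x - y) has_real_derivative deriv \<phi> x) (at x)"
    using Cc_infty_DERIV[OF assms] by (auto intro!: derivative_eq_intros)
  from DERIV_chain2[OF DERIV_flat this]
  show "((\<lambda>x. flat (\<phi> x - y)) has_real_derivative flat' (\<phi> x - y) * deriv \<phi> x) (at x)" .
qed

lemma Cc_infty_prod:
  fixes \<psi> \<theta> :: "real \<Rightarrow> real"
  assumes "\<psi> \<in> Cc_infty I" "\<theta> \<in> Cc_infty J"
  shows "(\<lambda>z. \<psi> (fst z) * \<theta> (snd z)) \<in> Cc_infty (I \<times> J)"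
proof -
  have "Ck_differentiable k (\<lambda>z::real\<times>real. \<psi> (fst z) * \<theta> (snd z))" for k
    by (rule Ck_mult[OF Ck_compose_linear[OF bounded_linear_fst Cc_Ck[OF assms(1)]]
          Ck_compose_linear[OF bounded_linear_snd Cc_Ck[OF assms(2)]]])
  moreover have "{z. \<psi> (fst z) * \<theta> (snd z) \<noteq> 0} \<subseteq> closure {x. \<psi> x \<noteq> 0} \<times> closure {t. \<theta> t \<noteq> 0}"
    using closure_subset[of "{x. \<psi> x \<noteq> 0}"] closure_subset[of "{t. \<theta> t \<noteq> 0}"] by auto
  ultimately show ?thesis
    using assms by (intro Cc_inftyI[where K="closure {x. \<psi> x \<noteq> 0} \<times> closure {t. \<theta> t \<noteq> 0}"])
      (auto simp: Cc_infty_def compact_Times)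
qed

text \<open>A smooth approximation of the indicator of \<open>{a<..<b}\<close> from below, supported in \<open>{a..b}\<close>.\<close>
definition window :: "real \<Rightarrow> real \<Rightarrow> nat \<Rightarrow> real \<Rightarrow> real" where
  "window a b n x = flat (real n * (x - a)) * flat (real n * (b - x))"

lemma window_Cc_infty:
  assumes "{a..b} \<subseteq> U"
  shows "window a b n \<in> Cc_infty U"
proof -
  have "Ck_differentiable k (\<lambda>x. flat_poly 1 (real n * x + (- real n * a)))"
    "Ck_differentiable k (\<lambda>x. flat_poly 1 ((- real n) * x + real n * b))" for k
    by (rule Ck_flat_poly_compose[OF Ck_affine])+
  moreover have E: "window a b n = (\<lambda>x. flat_poly 1 (real n * x + (- real n * a)) *
      flat_poly 1 ((- real n) * x + real n * b))"
    by (simp add: window_def[abs_def] flat_eq right_diff_distrib)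
  ultimately have "Ck_differentiable k (window a b n)" for k
    using Ck_mult[of k "\<lambda>x. flat_poly 1 (real n * x + (- real n * a))" "\<lambda>x. flat_poly 1 ((- real n) * x + real n * b)"]
    by (simp only: E)
  moreover have "{z. window a b n z \<noteq> 0} \<subseteq> {a..b}"
    by (auto simp: window_def flat_def zero_less_mult_iff split: if_splits)
  ultimately show ?thesis
    using assms by (intro Cc_inftyI[where K="{a..b}"]) auto
qed

lemma window_nonneg: "0 \<le> window a b n x" and window_le_1: "window a b n x \<le> 1"
  by (simp_all add: window_def flat_nonneg flat_le_1 mult_le_one)

lemma window_outside: "x \<notin> {a<..<b} \<Longrightarrow> window a b n x = 0"
  by (auto simp: window_def flat_def zero_less_mult_iff)

lemma flat_dilation_LIMSEQ: "x > 0 \<Longrightarrow> (\<lambda>n. flat (real n * x)) \<longlonglongrightarrow> 1"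
  by (rule filterlim_compose[OF flat_at_top], subst mult.commute)
    (rule filterlim_tendsto_pos_mult_at_top[OF tendsto_const _ filterlim_real_sequentially])

lemma window_LIMSEQ: "(\<lambda>n. window a b n x) \<longlonglongrightarrow> indicator {a<..<b} x"
proof (cases "x \<in> {a<..<b}")
  case True
  then have "(\<lambda>n. flat (real n * (x - a)) * flat (real n * (b - x))) \<longlonglongrightarrow> 1 * 1"
    by (intro tendsto_mult flat_dilation_LIMSEQ) auto
  then show ?thesis using True by (simp add: window_def)
qed (simp add: window_outside)

section \<open>Continuity of translation in the mean\<close>

lemma lborel_shift:
  fixes f :: "'a::euclidean_space \<Rightarrow> real" and w :: 'a
  assumes [measurable]: "f \<in> borel_measurable borel"
  shows lborel_integrable_shift: "integrable lborel (\<lambda>z. f (z + w)) \<longleftrightarrow> integrable lborel f"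
    and lborel_integral_shift: "(\<integral>z. f (z + w) \<partial>lborel) = (\<integral>z. f z \<partial>lborel)"
proof -
  have "integrable lborel f \<longleftrightarrow> integrable (distr lborel borel ((+) w)) f"
    by (simp add: lborel_distr_plus)
  also have "\<dots> \<longleftrightarrow> integrable lborel (\<lambda>z. f (z + w))"
    by (subst integrable_distr_eq) (auto simp: add.commute)
  finally show "integrable lborel (\<lambda>z. f (z + w)) \<longleftrightarrow> integrable lborel f" by simp
  have "(\<integral>z. f z \<partial>lborel) = (\<integral>z. f z \<partial>distr lborel borel ((+) w))"
    by (simp add: lborel_distr_plus)
  also have "\<dots> = (\<integral>z. f (z + w) \<partial>lborel)"
    by (subst integral_distr) (auto simp: add.commute)
  finally show "(\<integral>z. f (z + w) \<partial>lborel) = (\<integral>z. f z \<partial>lborel)" by simp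
qed

lemma compact_open_sandwich:
  fixes A :: "'a::euclidean_space set"
  assumes A: "A \<in> sets borel" "emeasure lborel A < \<infinity>" and e: "0 < (e::real)"
  obtains K U where "compact K" "K \<subseteq> A" "open U" "A \<subseteq> U" "emeasure lborel (U - K) < ennreal e"
proof -
  obtain T where T: "closed T" "T \<subseteq> A" "emeasure lebesgue (A - T) < ennreal (e / 3)"
  proof -
    have "A \<in> sets lebesgue" "e / 3 > 0" using A e by auto
    then show thesis using sets_lebesgue_inner_closed that by metis
  qed
  then have T3: "emeasure lborel (A - T) < ennreal (e / 3)"
    using A by (simp add: emeasure_completion)
  obtain U where U: "open U" "A \<subseteq> U" "emeasure lborel (U - A) < ennreal (e / 3)"
  proof -
    have "e / 3 > 0" using e by auto
    then show thesis using outer_regular_lborel[OF A(1)] that by metis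
  qed
  have fT: "emeasure lborel T < \<infinity>"
    using A T emeasure_mono[of T A lborel] by (auto simp: less_top[symmetric] top_unique)
  have "(\<lambda>n::nat. emeasure lborel (T - cball 0 (real n))) \<longlonglongrightarrow> emeasure lborel (\<Inter>n::nat. T - cball 0 (real n))"
  proof (rule Lim_emeasure_decseq)
    show "range (\<lambda>n::nat. T - cball 0 (real n)) \<subseteq> sets lborel" using T by auto
    show "decseq (\<lambda>n::nat. T - cball 0 (real n))" by (auto simp: decseq_def)
    show "emeasure lborel (T - cball 0 (real n)) \<noteq> \<infinity>" for n :: nat
      using fT T emeasure_mono[of "T - cball 0 (real n)" T lborel] by (auto simp: top_unique)
  qed
  moreover have "(\<Inter>n::nat. T - cball 0 (real n)) = {}"
  proof -
    have "\<exists>n::nat. norm x \<le> real n" for x :: 'a using real_arch_simple by blast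
    then show ?thesis by auto
  qed
  ultimately have "(\<lambda>n::nat. emeasure lborel (T - cball 0 (real n))) \<longlonglongrightarrow> 0" by (simp only: emeasure_empty)
  then have "\<forall>\<^sub>F n in sequentially. emeasure lborel (T - cball 0 (real n)) < ennreal (e / 3)"
    using e by (intro order_tendstoD) auto
  then obtain n :: nat where n: "emeasure lborel (T - cball 0 (real n)) < ennreal (e / 3)"
    by (meson eventually_happens trivial_limit_sequentially)
  show ?thesis
  proof
    show "compact (T \<inter> cball 0 (real n))" using T by (intro closed_Int_compact) auto
    show "T \<inter> cball 0 (real n) \<subseteq> A" using T by auto
    have "U - T \<inter> cball 0 (real n) \<subseteq> (U - A) \<union> ((A - T) \<union> (T - cball 0 (real n)))" by auto
    then have "emeasure lborel (U - T \<inter> cball 0 (real n)) \<le>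
        emeasure lborel ((U - A) \<union> ((A - T) \<union> (T - cball 0 (real n))))"
      using A T U by (intro emeasure_mono) auto
    also have "\<dots> \<le> emeasure lborel (U - A) + emeasure lborel ((A - T) \<union> (T - cball 0 (real n)))"
      using A T U by (intro emeasure_subadditive) auto
    also have "\<dots> \<le> emeasure lborel (U - A) + (emeasure lborel (A - T) + emeasure lborel (T - cball 0 (real n)))"
      using A T U by (intro add_left_mono emeasure_subadditive) auto
    also have "\<dots> < ennreal (e / 3) + (ennreal (e / 3) + ennreal (e / 3))"
      using U(3) T3 n by (intro add_strict_mono) auto
    also have "\<dots> = ennreal e"
      using e by (simp flip: ennreal_plus)
    finally show "emeasure lborel (U - T \<inter> cball 0 (real n)) < ennreal e" .
  qed (use U in auto)
qed

text \<open>By linearity and \<open>L\<^sup>1\<close> limits it suffices to treat the indicator of a set \<open>A\<close> of finite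
  measure. With a compact \<open>K\<close> and an open \<open>U\<close> such that \<open>K \<subseteq> A \<subseteq> U\<close>, a small translation moves
  \<open>K\<close> inside \<open>U\<close>, so a point can enter or leave \<open>A\<close> only through \<open>U - K\<close>.\<close>
theorem L1_continuity_of_translation:
  fixes f :: "'a::euclidean_space \<Rightarrow> real"
  assumes "integrable lborel f"
  shows "0 < e \<Longrightarrow> \<exists>\<delta>>0. \<forall>w. norm w < \<delta> \<longrightarrow> (\<integral>z. \<bar>f (z + w) - f z\<bar> \<partial>lborel) < e"
  using assms
proof (induction arbitrary: e rule: integrable_induct)
  case (base A c)
  have A: "A \<in> sets borel" using base by simp
  define e' where "e' = e / (2 * (\<bar>c\<bar> + 1))"
  have e': "e' > 0" using base by (simp add: e'_def)
  obtain K U where KU: "compact K" "K \<subseteq> A" "open U" "A \<subseteq> U" and D: "emeasure lborel (U - K) < ennreal e'"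
    using compact_open_sandwich[OF A base(2) e'] by blast
  obtain \<delta> where \<delta>: "\<delta> > 0" "(\<Union>x\<in>K. ball x \<delta>) \<subseteq> U"
  proof -
    have "\<exists>d>0. \<forall>x\<in>K. \<forall>y\<in>- U. d \<le> dist x y"
      using KU by (intro separate_compact_closed) auto
    then obtain d where d: "d > 0" "\<And>x y. x \<in> K \<Longrightarrow> y \<notin> U \<Longrightarrow> d \<le> dist x y" by auto
    show ?thesis
    proof
      show "(\<Union>x\<in>K. ball x d) \<subseteq> U" using d(2) by force
    qed (rule d)
  qed
  show ?case
  proof (intro exI[of _ \<delta>] conjI allI impI)
    fix w :: 'a assume w: "norm w < \<delta>"
    let ?D = "U - K"
    have [measurable]: "?D \<in> sets borel" "A \<in> sets borel" using KU A by (auto intro: borel_compact)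
    have iD: "integrable lborel (indicator ?D :: 'a \<Rightarrow> real)"
      using D by (auto simp: integrable_indicator_iff intro: order_less_trans)
    have iDw: "integrable lborel (\<lambda>z. indicator ?D (z + w) :: real)"
      using iD by (subst lborel_integrable_shift) auto
    have pt: "\<bar>indicator A (z + w) * c - indicator A z * c\<bar> \<le>
        \<bar>c\<bar> * (indicator ?D (z + w) + indicator ?D z)" for z
    proof -
      have "z \<in> ball (z + w) \<delta>" "z + w \<in> ball z \<delta>" using w by (simp_all add: dist_norm)
      then have "z + w \<in> K \<Longrightarrow> z \<in> U" "z \<in> K \<Longrightarrow> z + w \<in> U" using \<delta>(2) by blast+
      then show ?thesis using KU by (auto simp: indicator_def)
    qed
    have "(\<integral>z. \<bar>indicator A (z + w) * c - indicator A z * c\<bar> \<partial>lborel) \<le>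
        (\<integral>z. \<bar>c\<bar> * (indicator ?D (z + w) + indicator ?D z) \<partial>lborel)"
      using iD iDw pt by (intro integral_mono') auto
    also have "\<dots> = \<bar>c\<bar> * (2 * measure lborel ?D)"
      using iD iDw by (simp add: lborel_integral_shift)
    also have "\<dots> \<le> \<bar>c\<bar> * (2 * e')"
      using D e' by (intro mult_left_mono) (auto simp: measure_def enn2real_leI)
    also have "\<dots> < (\<bar>c\<bar> + 1) * (2 * e')" using e' by (intro mult_strict_right_mono) auto
    also have "\<dots> = e" by (simp add: e'_def field_simps)
    finally show "(\<integral>z. \<bar>indicator A (z + w) *\<^sub>R c - indicator A z *\<^sub>R c\<bar> \<partial>lborel) < e" by simp
  qed fact
next
  case (add f g)
  have [measurable]: "f \<in> borel_measurable borel" "g \<in> borel_measurable borel" using add.hyps by auto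
  obtain \<delta>1 \<delta>2 where \<delta>: "\<delta>1 > 0" "\<delta>2 > 0"
    "\<And>w. norm w < \<delta>1 \<Longrightarrow> (\<integral>z. \<bar>f (z + w) - f z\<bar> \<partial>lborel) < e / 2"
    "\<And>w. norm w < \<delta>2 \<Longrightarrow> (\<integral>z. \<bar>g (z + w) - g z\<bar> \<partial>lborel) < e / 2"
    using add.IH(1)[of "e / 2"] add.IH(2)[of "e / 2"] add.prems by (auto simp: half_gt_zero_iff)
  show ?case
  proof (intro exI[of _ "min \<delta>1 \<delta>2"] conjI allI impI)
    fix w :: 'a assume w: "norm w < min \<delta>1 \<delta>2"
    have i: "integrable lborel (\<lambda>z. f (z + w))" "integrable lborel (\<lambda>z. g (z + w))"
      using add.hyps by (simp_all add: lborel_integrable_shift)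
    have "(\<integral>z. \<bar>f (z + w) + g (z + w) - (f z + g z)\<bar> \<partial>lborel) \<le>
        (\<integral>z. \<bar>f (z + w) - f z\<bar> + \<bar>g (z + w) - g z\<bar> \<partial>lborel)"
      using add.hyps i by (intro integral_mono') auto
    also have "\<dots> = (\<integral>z. \<bar>f (z + w) - f z\<bar> \<partial>lborel) + (\<integral>z. \<bar>g (z + w) - g z\<bar> \<partial>lborel)"
      using add.hyps i by (intro Bochner_Integration.integral_add) auto
    also have "\<dots> < e / 2 + e / 2" using \<delta>(3)[of w] \<delta>(4)[of w] w by (intro add_strict_mono) auto
    finally show "(\<integral>z. \<bar>f (z + w) + g (z + w) - (f z + g z)\<bar> \<partial>lborel) < e" by simp
  qed (use \<delta> in auto)
next
  case (lim f s)
  have [measurable]: "f \<in> borel_measurable borel" "\<And>i. s i \<in> borel_measurable borel" using lim.hyps by auto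
  have "(\<lambda>i. \<integral>z. \<bar>s i z - f z\<bar> \<partial>lborel) \<longlonglongrightarrow> (\<integral>z. (0::real) \<partial>(lborel :: 'a measure))"
  proof (rule integral_dominated_convergence[where w="\<lambda>z. 3 * \<bar>f z\<bar>"])
    show "AE z in lborel. (\<lambda>i. \<bar>s i z - f z\<bar>) \<longlonglongrightarrow> 0"
      by (intro AE_I2 tendsto_rabs_zero LIM_zero lim.hyps(2)) simp
    show "AE z in lborel. norm \<bar>s i z - f z\<bar> \<le> 3 * \<bar>f z\<bar>" for i
    proof (rule AE_I2)
      fix z show "norm \<bar>s i z - f z\<bar> \<le> 3 * \<bar>f z\<bar>" using lim.hyps(3)[of z i] by auto
    qed
  qed (use lim.hyps in auto)
  then have "\<forall>\<^sub>F i in sequentially. (\<integral>z. \<bar>s i z - f z\<bar> \<partial>lborel) < e / 3"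
    using lim.prems by (intro order_tendstoD) auto
  then obtain i where i: "(\<integral>z. \<bar>s i z - f z\<bar> \<partial>lborel) < e / 3"
    by (meson eventually_happens trivial_limit_sequentially)
  obtain \<delta> where \<delta>: "\<delta> > 0" "\<And>w. norm w < \<delta> \<Longrightarrow> (\<integral>z. \<bar>s i (z + w) - s i z\<bar> \<partial>lborel) < e / 3"
    using lim.IH[of "e / 3" i] lim.prems by auto
  show ?case
  proof (intro exI[of _ \<delta>] conjI allI impI)
    fix w :: 'a assume w: "norm w < \<delta>"
    have int: "integrable lborel (\<lambda>z. \<bar>s i z - f z\<bar>)" "integrable lborel (\<lambda>z. \<bar>s i (z + w) - f (z + w)\<bar>)"
        "integrable lborel (\<lambda>z. \<bar>s i (z + w) - s i z\<bar>)" "integrable lborel (\<lambda>z. \<bar>f (z + w) - f z\<bar>)"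
      using lim.hyps(1)[of i] lim.hyps(4) by (auto simp: lborel_integrable_shift)
    have "(\<integral>z. \<bar>f (z + w) - f z\<bar> \<partial>lborel) \<le>
        (\<integral>z. \<bar>s i (z + w) - f (z + w)\<bar> + (\<bar>s i (z + w) - s i z\<bar> + \<bar>s i z - f z\<bar>) \<partial>lborel)"
      using int by (intro integral_mono) auto
    also have "\<dots> = (\<integral>z. \<bar>s i (z + w) - f (z + w)\<bar> \<partial>lborel) +
        ((\<integral>z. \<bar>s i (z + w) - s i z\<bar> \<partial>lborel) + (\<integral>z. \<bar>s i z - f z\<bar> \<partial>lborel))"
      using int by simp
    also have "\<dots> < e / 3 + (e / 3 + e / 3)"
      using i \<delta>(2)[OF w] lborel_integral_shift[of "\<lambda>z. \<bar>s i z - f z\<bar>" w]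
      by (intro add_strict_mono) auto
    finally show "(\<integral>z. \<bar>f (z + w) - f z\<bar> \<partial>lborel) < e" by simp
  qed fact
qed

section \<open>Weak derivatives\<close>

lemma integrable_bounded_mult:
  fixes f h :: "'a \<Rightarrow> real"
  assumes "integrable M f" "h \<in> borel_measurable M" "\<And>x. x \<in> space M \<Longrightarrow> \<bar>h x\<bar> \<le> B"
  shows "integrable M (\<lambda>x. f x * h x)"
proof (rule Bochner_Integration.integrable_bound)
  show "integrable M (\<lambda>x. B * f x)" using assms by simp
  show "(\<lambda>x. f x * h x) \<in> borel_measurable M" using assms by auto
  show "AE x in M. norm (f x * h x) \<le> norm (B * f x)"
  proof (rule AE_I2)
    fix x assume "x \<in> space M"
    then have "\<bar>h x\<bar> \<le> B" by (rule assms)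
    then have "\<bar>f x\<bar> * \<bar>h x\<bar> \<le> \<bar>f x\<bar> * \<bar>B\<bar>" by (intro mult_left_mono) auto
    then show "norm (f x * h x) \<le> norm (B * f x)" by (simp add: abs_mult mult.commute)
  qed
qed

lemma L1_loc_integrable_mult:
  fixes w h :: "real \<Rightarrow> real"
  assumes w: "w \<in> L1_loc I" and I: "I \<in> sets borel" and K: "compact K" "K \<subseteq> I"
    and h: "h \<in> borel_measurable borel" "\<And>x. \<bar>h x\<bar> \<le> B" "\<And>x. x \<notin> K \<Longrightarrow> h x = 0"
  shows "integrable (lebesgue_on I) (\<lambda>x. w x * h x)"
    and "integral\<^sup>L (lebesgue_on I) (\<lambda>x. w x * h x) = integral\<^sup>L (lebesgue_on K) (\<lambda>x. w x * h x)"
proof -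
  have Kb: "K \<in> sets borel" using K(1) by (rule borel_compact)
  have "integrable (lebesgue_on K) w" using w K unfolding L1_loc_def by blast
  then have "integrable (lebesgue_on K) (\<lambda>x. w x * h x)"
    by (rule integrable_bounded_mult)
      (use h in \<open>auto intro!: measurable_restrict_space1 measurable_completion\<close>)
  then have 1: "integrable lebesgue (\<lambda>x. indicator K x *\<^sub>R (w x * h x))"
    using Kb by (subst (asm) integrable_restrict_space) auto
  have e: "indicator K x *\<^sub>R (w x * h x) = indicator I x *\<^sub>R (w x * h x)" for x
    using K h(3)[of x] by (auto simp: indicator_def)
  show "integrable (lebesgue_on I) (\<lambda>x. w x * h x)"
    using 1 I unfolding e by (subst integrable_restrict_space) auto
  show "integral\<^sup>L (lebesgue_on I) (\<lambda>x. w x * h x) = integral\<^sup>L (lebesgue_on K) (\<lambda>x. w x * h x)"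
  proof -
    have "I \<inter> space lebesgue \<in> sets lebesgue" "K \<inter> space lebesgue \<in> sets lebesgue"
      using I Kb by auto
    then show ?thesis by (simp only: integral_restrict_space e)
  qed
qed

text \<open>The fundamental lemma of the calculus of variations: the windows converge boundedly to
  indicators of intervals, so all integrals of \<open>d\<close> over subintervals vanish.\<close>
lemma AE_zero_on_interval_if_window_integrals_zero:
  fixes d :: "real \<Rightarrow> real"
  assumes d: "integrable (lebesgue_on {c..e}) d"
    and zero: "\<And>c' e' n. c \<le> c' \<Longrightarrow> e' \<le> e \<Longrightarrow>
      integral\<^sup>L (lebesgue_on {c..e}) (\<lambda>x. d x * window c' e' n x) = 0"
  shows "AE x in lborel. x \<in> {c..e} \<longrightarrow> d x = 0"
proof -
  have "{c..e} \<in> sets borel" "d \<in> borel_measurable (lebesgue_on {c..e})" using d by auto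
  from lebesgue_on_borel_representative[OF this]
  obtain g where g1: "g \<in> borel_measurable borel" and g2: "\<forall>x. x \<notin> {c..e} \<longrightarrow> g x = 0"
      and g3: "AE x in lborel. x \<in> {c..e} \<longrightarrow> d x = g x"
    by (elim exE conjE)
  note g = g1 g2[rule_format] g3
  note [measurable] = g(1)
  have wb: "window c' e' n \<in> borel_measurable borel" for c' e' n
    using Cc_infty_borel[OF window_Cc_infty[OF subset_UNIV]] .
  note [measurable] = wb
  have ig: "indicator {c..e} x * g x = g x" for x using g(2)[of x] by (auto simp: indicator_def)
  have ig2: "indicator {c..e} x * (g x * h) = g x * h" for x h using g(2)[of x] by (auto simp: indicator_def)
  have gint: "integrable lborel g"
    using d integrable_lebesgue_on_borel[OF _ g(1) g(3)] by (simp add: ig)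
  have z: "(\<integral>x. g x * window c' e' n x \<partial>lborel) = 0" if "c \<le> c'" "e' \<le> e" for c' e' n
  proof -
    have "AE x in lborel. x \<in> {c..e} \<longrightarrow> d x * window c' e' n x = g x * window c' e' n x"
      using g(3) by (rule eventually_mono) auto
    from integral_lebesgue_on_borel[OF _ _ this] zero[OF that]
    show ?thesis by (simp add: ig2)
  qed
  have z2: "(\<integral>x. g x * indicator {c'<..<e'} x \<partial>lborel) = 0" if "c \<le> c'" "e' \<le> e" for c' e'
  proof -
    have "(\<lambda>n. \<integral>x. g x * window c' e' n x \<partial>lborel) \<longlonglongrightarrow> (\<integral>x. g x * indicator {c'<..<e'} x \<partial>lborel)"
    proof (rule integral_dominated_convergence[where w="\<lambda>x. \<bar>g x\<bar>"])
      show "AE x in lborel. (\<lambda>n. g x * window c' e' n x) \<longlonglongrightarrow> g x * indicator {c'<..<e'} x"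
        by (intro AE_I2 tendsto_mult tendsto_const window_LIMSEQ)
      show "AE x in lborel. norm (g x * window c' e' n x) \<le> \<bar>g x\<bar>" for n
        by (intro AE_I2) (simp add: abs_mult window_nonneg window_le_1 mult_left_le)
    qed (use gint in auto)
    then show ?thesis using z[OF that] by (simp add: LIMSEQ_const_iff)
  qed
  have "AE x in lborel. g x = 0"
  proof (rule AE_zero_if_integrals_greaterThan_zero[OF gint])
    fix x
    have "(\<integral>t. indicator {x<..} t * g t \<partial>lborel) = (\<integral>t. g t * indicator {max x c<..<e} t \<partial>lborel)"
    proof (rule integral_cong_AE)
      show "AE t in lborel. indicator {x<..} t * g t = g t * indicator {max x c<..<e} t"
        using AE_lborel_singleton[of c] AE_lborel_singleton[of e]
      proof eventually_elim
        fix t assume "t \<noteq> c" "t \<noteq> e"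
        then show "indicator {x<..} t * g t = g t * indicator {max x c<..<e} t"
          using g(2)[of t] by (auto simp: indicator_def)
      qed
    qed auto
    also have "\<dots> = 0" by (rule z2) auto
    finally show "(\<integral>t. indicator {x<..} t * g t \<partial>lborel) = 0" .
  qed
  with g(3) show ?thesis by eventually_elim auto
qed

lemma AE_greaterThanLessThan_if_AE_subintervals:
  fixes P :: "real \<Rightarrow> bool"
  assumes "\<And>c e. a < c \<Longrightarrow> e < b \<Longrightarrow> AE x in lborel. x \<in> {c..e} \<longrightarrow> P x"
  shows "AE x in lborel. x \<in> {a<..<b} \<longrightarrow> P x"
proof -
  define q :: "nat \<Rightarrow> real" where "q n = inverse (real (Suc n))" for n
  have q: "0 < q n" for n by (simp add: q_def)
  have "\<forall>n. AE x in lborel. x \<in> {a + q n..b - q n} \<longrightarrow> P x"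
    using assms q by (intro allI) simp
  then have "AE x in lborel. \<forall>n. x \<in> {a + q n..b - q n} \<longrightarrow> P x"
    by (rule AE_all_countable[THEN iffD2])
  then show ?thesis
  proof (rule eventually_mono)
    fix x assume *: "\<forall>n. x \<in> {a + q n..b - q n} \<longrightarrow> P x"
    show "x \<in> {a<..<b} \<longrightarrow> P x"
    proof
      assume "x \<in> {a<..<b}"
      then obtain n where "inverse (real (Suc n)) < min (x - a) (b - x)"
        using reals_Archimedean[of "min (x - a) (b - x)"] by auto
      then have "x \<in> {a + q n..b - q n}" by (auto simp: q_def)
      then show "P x" using * by blast
    qed
  qed
qed

lemma weak_deriv_unique:
  assumes "has_weak_deriv {a<..<b} w g1" "has_weak_deriv {a<..<b} w g2"
  shows "AE x in lborel. x \<in> {a<..<b} \<longrightarrow> g1 x = g2 x"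
proof -
  have L: "g1 \<in> L1_loc {a<..<b}" "g2 \<in> L1_loc {a<..<b}"
    using assms by (auto simp: has_weak_deriv_def)
  have "AE x in lborel. x \<in> {c..e} \<longrightarrow> g1 x - g2 x = 0" if ce: "a < c" "e < b" for c e
  proof (rule AE_zero_on_interval_if_window_integrals_zero)
    have sub: "{c..e} \<subseteq> {a<..<b}" using ce by auto
    show "integrable (lebesgue_on {c..e}) (\<lambda>x. g1 x - g2 x)"
      using L sub by (intro Bochner_Integration.integrable_diff) (auto simp: L1_loc_def)
    fix c' e' n assume s: "c \<le> c'" "e' \<le> e"
    have cc: "window c' e' n \<in> Cc_infty {a<..<b}"
      using ce s by (intro window_Cc_infty) auto
    have wi: "\<And>x. \<bar>window c' e' n x\<bar> \<le> 1" "\<And>x. x \<notin> {c..e} \<Longrightarrow> window c' e' n x = 0"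
      using s by (auto simp: window_nonneg window_le_1 intro!: window_outside)
    have sub': "{a<..<b} \<in> sets borel" "compact {c..e}" by auto
    note I1 = L1_loc_integrable_mult[OF L(1) sub'(1) sub'(2) sub Cc_infty_borel[OF cc] wi]
    note I2 = L1_loc_integrable_mult[OF L(2) sub'(1) sub'(2) sub Cc_infty_borel[OF cc] wi]
    have eq: "integral\<^sup>L (lebesgue_on {a<..<b}) (\<lambda>x. g1 x * window c' e' n x) =
        integral\<^sup>L (lebesgue_on {a<..<b}) (\<lambda>x. g2 x * window c' e' n x)"
      using assms cc unfolding has_weak_deriv_def by fastforce
    have i: "integrable (lebesgue_on {c..e}) (\<lambda>x. g1 x * window c' e' n x)"
       "integrable (lebesgue_on {c..e}) (\<lambda>x. g2 x * window c' e' n x)"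
      using L sub Cc_infty_borel[OF cc] wi
      by (auto intro!: integrable_bounded_mult[where B=1] measurable_restrict_space1 measurable_completion simp: L1_loc_def)
    show "integral\<^sup>L (lebesgue_on {c..e}) (\<lambda>x. (g1 x - g2 x) * window c' e' n x) = 0"
      using eq I1(2) I2(2) i by (simp add: left_diff_distrib)
  qed
  from AE_greaterThanLessThan_if_AE_subintervals[OF this] show ?thesis by simp
qed

lemma weak_deriv_AE:
  assumes "has_weak_deriv {a<..<b} w g"
  shows "AE x in lborel. x \<in> {a<..<b} \<longrightarrow> weak_deriv {a<..<b} w x = g x"
  using weak_deriv_unique[OF someI[of "has_weak_deriv {a<..<b} w"] assms] assms
  unfolding weak_deriv_def by auto

lemma Cc_infty_L1_loc:
  assumes "\<phi> \<in> Cc_infty U"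
  shows "\<phi> \<in> L1_loc I" "(deriv \<phi> :: real \<Rightarrow> real) \<in> L1_loc I"
proof -
  have "integrable (lebesgue_on K) \<phi>" "integrable (lebesgue_on K) (deriv \<phi>)" if K: "compact K" for K
  proof -
    have "integrable lborel (\<lambda>x. indicator K x *\<^sub>R \<phi> x)" "integrable lborel (\<lambda>x. indicator K x *\<^sub>R deriv \<phi> x)"
      by (intro borel_integrable_compact K Cc_infty_continuous[OF assms] Cc_infty_continuous_deriv[OF assms])+
    then show "integrable (lebesgue_on K) \<phi>" "integrable (lebesgue_on K) (deriv \<phi>)"
      using K borel_compact[OF K] Cc_infty_borel[OF assms] Cc_infty_deriv_borel[OF assms]
      by (simp_all add: integrable_lebesgue_on_borel[where g=\<phi>] integrable_lebesgue_on_borel[where g="deriv \<phi>"])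
  qed
  then show "\<phi> \<in> L1_loc I" "(deriv \<phi> :: real \<Rightarrow> real) \<in> L1_loc I"
    by (auto simp: L1_loc_def)
qed

lemma integral_by_parts_Cc:
  assumes "\<phi> \<in> Cc_infty {a<..<b::real}" "\<psi> \<in> Cc_infty {a<..<b}"
  shows "integral\<^sup>L (lebesgue_on {a<..<b}) (\<lambda>x. \<phi> x * deriv \<psi> x) =
    - integral\<^sup>L (lebesgue_on {a<..<b}) (\<lambda>x. deriv \<phi> x * \<psi> x)"
proof (cases "a < b")
  case True
  obtain K where K: "compact K" "K \<subseteq> {a<..<b}" "\<And>x. x \<notin> K \<Longrightarrow> \<phi> x = 0" "\<And>x. x \<notin> K \<Longrightarrow> deriv \<phi> x = 0"
    using Cc_infty_support[OF assms(1)] by auto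
  obtain B where B: "\<And>x. \<bar>\<psi> x\<bar> \<le> B" "\<And>x. \<bar>deriv \<psi> x\<bar> \<le> B"
    using Cc_infty_bound[OF assms(2)] by metis
  let ?F = "\<lambda>x. \<phi> x * deriv \<psi> x + deriv \<phi> x * \<psi> x"
  have c: "continuous_on A ?F" for A
    by (intro continuous_intros Cc_infty_continuous[OF assms(1)] Cc_infty_continuous[OF assms(2)]
        Cc_infty_continuous_deriv[OF assms(1)] Cc_infty_continuous_deriv[OF assms(2)])
  have b: "?F \<in> borel_measurable borel" using c by (rule borel_measurable_continuous_onI)
  have "(\<integral>x. indicator {a..b} x *\<^sub>R ?F x \<partial>lborel) = \<phi> b * \<psi> b - \<phi> a * \<psi> a"
  proof (rule integral_FTC_atLeastAtMost)
    fix x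
    have "((\<lambda>x. \<phi> x * \<psi> x) has_real_derivative ?F x) (at x)"
      using Cc_infty_DERIV[OF assms(1), of x] Cc_infty_DERIV[OF assms(2), of x]
      by (auto intro!: derivative_eq_intros)
    then show "((\<lambda>x. \<phi> x * \<psi> x) has_vector_derivative ?F x) (at x within {a..b})"
      by (simp add: has_real_derivative_iff_has_vector_derivative has_vector_derivative_at_within)
  qed (use True c in auto)
  also have "\<dots> = 0"
  proof -
    have "a \<notin> K" "b \<notin> K" using K(2) by auto
    then show ?thesis using K(3) by simp
  qed
  finally have zero: "(\<integral>x. indicator {a..b} x *\<^sub>R ?F x \<partial>lborel) = 0" .
  have "(\<integral>x. indicator {a<..<b} x * ?F x \<partial>lborel) = 0"
  proof -
    have "indicator {a<..<b} x * ?F x = indicator {a..b} x *\<^sub>R ?F x" for x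
    proof (cases "x \<in> K")
      case True
      then show ?thesis using K(2) by (auto simp: indicator_def)
    next
      case False
      then show ?thesis using K(3,4) by simp
    qed
    then show ?thesis using zero by presburger
  qed
  then have "integral\<^sup>L (lebesgue_on {a<..<b}) ?F = 0"
    using integral_lebesgue_on_borel[of "{a<..<b}" ?F ?F] b by simp
  moreover have "integrable (lebesgue_on {a<..<b}) (\<lambda>x. \<phi> x * deriv \<psi> x)"
  proof -
    obtain K' where K': "compact K'" "K' \<subseteq> {a<..<b}" "\<And>x. x \<notin> K' \<Longrightarrow> \<psi> x = 0" "\<And>x. x \<notin> K' \<Longrightarrow> deriv \<psi> x = 0"
      using Cc_infty_support[OF assms(2)] by auto
    show ?thesis
      by (rule L1_loc_integrable_mult[OF Cc_infty_L1_loc(1)[OF assms(1)] _ K'(1,2) Cc_infty_deriv_borel[OF assms(2)] B(2) K'(4)]) auto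
  qed
  moreover have "integrable (lebesgue_on {a<..<b}) (\<lambda>x. deriv \<phi> x * \<psi> x)"
  proof -
    obtain K' where K': "compact K'" "K' \<subseteq> {a<..<b}" "\<And>x. x \<notin> K' \<Longrightarrow> \<psi> x = 0" "\<And>x. x \<notin> K' \<Longrightarrow> deriv \<psi> x = 0"
      using Cc_infty_support[OF assms(2)] by auto
    show ?thesis
      by (rule L1_loc_integrable_mult[OF Cc_infty_L1_loc(2)[OF assms(1)] _ K'(1,2) Cc_infty_borel[OF assms(2)] B(1) K'(3)]) auto
  qed
  ultimately show ?thesis by simp
qed simp

text \<open>Together with uniqueness this identifies the derivative that occurs in the Sobolev norm of
  \<open>w - \<phi>\<close> for an approximating test function \<open>\<phi>\<close>.\<close>
lemma has_weak_deriv_diff_Cc: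
  assumes w: "has_weak_deriv {a<..<b} w g" and \<phi>: "\<phi> \<in> Cc_infty {a<..<b}"
  shows "has_weak_deriv {a<..<b} (\<lambda>x. w x - \<phi> x) (\<lambda>x. g x - deriv \<phi> x)"
  unfolding has_weak_deriv_def
proof (intro conjI ballI)
  have L: "w \<in> L1_loc {a<..<b}" "g \<in> L1_loc {a<..<b}" using w by (auto simp: has_weak_deriv_def)
  note L\<phi> = Cc_infty_L1_loc[OF \<phi>, of "{a<..<b}"]
  show "(\<lambda>x. w x - \<phi> x) \<in> L1_loc {a<..<b}" "(\<lambda>x. g x - deriv \<phi> x) \<in> L1_loc {a<..<b}"
    using L L\<phi> by (simp_all add: L1_loc_def)
  fix \<psi> assume \<psi>: "\<psi> \<in> Cc_infty {a<..<b}"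
  obtain K where K: "compact K" "K \<subseteq> {a<..<b}" "\<And>x. x \<notin> K \<Longrightarrow> \<psi> x = 0" "\<And>x. x \<notin> K \<Longrightarrow> deriv \<psi> x = 0"
    using Cc_infty_support[OF \<psi>] by auto
  obtain B where B: "\<And>x. \<bar>\<psi> x\<bar> \<le> B" "\<And>x. \<bar>deriv \<psi> x\<bar> \<le> B"
    using Cc_infty_bound[OF \<psi>] by metis
  have sb: "{a<..<b} \<in> sets borel" by simp
  note d = L1_loc_integrable_mult(1)[OF _ sb K(1,2) Cc_infty_deriv_borel[OF \<psi>] B(2) K(4)]
  note f = L1_loc_integrable_mult(1)[OF _ sb K(1,2) Cc_infty_borel[OF \<psi>] B(1) K(3)]
  have "integral\<^sup>L (lebesgue_on {a<..<b}) (\<lambda>x. w x * deriv \<psi> x) =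
      - integral\<^sup>L (lebesgue_on {a<..<b}) (\<lambda>x. g x * \<psi> x)"
    using w \<psi> by (auto simp: has_weak_deriv_def)
  then show "integral\<^sup>L (lebesgue_on {a<..<b}) (\<lambda>x. (w x - \<phi> x) * deriv \<psi> x) =
      - integral\<^sup>L (lebesgue_on {a<..<b}) (\<lambda>x. (g x - deriv \<phi> x) * \<psi> x)"
    using d[OF L(1)] d[OF L\<phi>(1)] f[OF L(2)] f[OF L\<phi>(2)] integral_by_parts_Cc[OF \<phi> \<psi>]
    by (simp add: left_diff_distrib)
qed

section \<open>Functions of the Sobolev space in terms of Borel representatives\<close>

lemma AE_lborel_swap:
  fixes P :: "real \<times> real \<Rightarrow> bool"
  assumes "AE z in lborel. P z"
  shows "AE t in lborel. AE x in lborel. P (x, t)"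
proof -
  obtain N where N: "{z \<in> space lborel. \<not> P z} \<subseteq> N" "emeasure lborel N = 0" "N \<in> sets (lborel :: (real \<times> real) measure)"
    using AE_E[OF assms] by blast
  have NP: "N \<in> sets (lborel \<Otimes>\<^sub>M lborel)" using N(3) by (simp only: lborel_prod)
  have "AE z in lborel \<Otimes>\<^sub>M lborel. z \<notin> N"
    unfolding lborel_prod using N by (intro AE_not_in) (auto simp: null_sets_def)
  then have "AE x in lborel. AE t in lborel. (x, t) \<notin> N"
    by (rule lborel_pair.AE_pair)
  moreover have "{z \<in> space (lborel \<Otimes>\<^sub>M lborel). (fst z, snd z) \<notin> N} \<in> sets (lborel \<Otimes>\<^sub>M lborel)"
  proof -
    have "{z \<in> space (lborel \<Otimes>\<^sub>M lborel). (fst z, snd z) \<notin> N} = space (lborel \<Otimes>\<^sub>M lborel) - N" by auto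
    then show ?thesis using sets.Diff[OF sets.top NP] by (simp only:)
  qed
  ultimately have "AE t in lborel. AE x in lborel. (x, t) \<notin> N"
    using lborel_pair.AE_commute[of "\<lambda>x t. (x, t) \<notin> N"] by simp
  moreover have "P (x, t)" if "(x, t) \<notin> N" for x t using N(1) that by auto
  ultimately show ?thesis by (auto elim!: eventually_mono)
qed

lemma abs_diff_powr_le:
  assumes "0 \<le> p"
  shows "\<bar>a - b\<bar> powr p \<le> 2 powr p * (\<bar>a\<bar> powr p + \<bar>b::real\<bar> powr p)"
proof -
  have "\<bar>a - b\<bar> powr p \<le> (2 * max \<bar>a\<bar> \<bar>b\<bar>) powr p"
    using assms by (intro powr_mono2) auto
  also have "\<dots> = 2 powr p * max \<bar>a\<bar> \<bar>b\<bar> powr p" by (simp add: powr_mult)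
  also have "max \<bar>a\<bar> \<bar>b\<bar> powr p \<le> \<bar>a\<bar> powr p + \<bar>b\<bar> powr p" by (simp add: max_def)
  finally show ?thesis by simp
qed

lemma integrable_diff_powr:
  fixes f g :: "'a \<Rightarrow> real"
  assumes "0 \<le> p" "integrable M (\<lambda>x. \<bar>f x\<bar> powr p)" "integrable M (\<lambda>x. \<bar>g x\<bar> powr p)"
    "f \<in> borel_measurable M" "g \<in> borel_measurable M"
  shows "integrable M (\<lambda>x. \<bar>f x - g x\<bar> powr p)"
proof (rule Bochner_Integration.integrable_bound)
  show "integrable M (\<lambda>x. 2 powr p * (\<bar>f x\<bar> powr p + \<bar>g x\<bar> powr p))" using assms by auto
  show "AE x in M. norm (\<bar>f x - g x\<bar> powr p) \<le> norm (2 powr p * (\<bar>f x\<bar> powr p + \<bar>g x\<bar> powr p))"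
    using abs_diff_powr_le[OF assms(1)] by (intro AE_I2) (simp add: abs_of_nonneg)
qed (use assms in auto)

lemma integrable_bounded_on_compact:
  fixes h :: "'a::euclidean_space \<Rightarrow> real"
  assumes "h \<in> borel_measurable borel" "compact K" "\<And>x. \<bar>h x\<bar> \<le> B" "\<And>x. x \<notin> K \<Longrightarrow> h x = 0"
  shows "integrable lborel h"
proof (rule Bochner_Integration.integrable_bound)
  have "emeasure lborel K < \<infinity>" using assms(2) by (intro emeasure_bounded_finite compact_imp_bounded)
  then show "integrable lborel (\<lambda>x. B * indicator K x :: real)"
    using borel_compact[OF assms(2)] by (auto simp: integrable_indicator_iff)
  show "AE x in lborel. norm (h x) \<le> norm (B * indicator K x :: real)"
  proof (rule AE_I2)
    fix x show "norm (h x) \<le> norm (B * indicator K x :: real)"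
      using assms(3)[of x] assms(4)[of x] by (cases "x \<in> K") auto
  qed
qed (use assms in auto)

lemma Cc_infty_integrable_powr:
  fixes \<phi> :: "real \<Rightarrow> real"
  assumes "\<phi> \<in> Cc_infty U" "0 < p"
  shows "integrable lborel (\<lambda>x. \<bar>\<phi> x\<bar> powr p)" "integrable lborel (\<lambda>x. \<bar>deriv \<phi> x\<bar> powr p)"
proof -
  obtain K where K: "compact K" "K \<subseteq> U" "\<And>x. x \<notin> K \<Longrightarrow> \<phi> x = 0" "\<And>x. x \<notin> K \<Longrightarrow> deriv \<phi> x = 0"
    using Cc_infty_support[OF assms(1)] by auto
  obtain B where B: "\<And>x. \<bar>\<phi> x\<bar> \<le> B" "\<And>x. \<bar>deriv \<phi> x\<bar> \<le> B"
    using Cc_infty_bound[OF assms(1)] by metis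
  note [measurable] = Cc_infty_borel[OF assms(1)] Cc_infty_deriv_borel[OF assms(1)]
  show "integrable lborel (\<lambda>x. \<bar>\<phi> x\<bar> powr p)"
    using assms(2) B K by (intro integrable_bounded_on_compact[where K=K and B="B powr p"])
      (auto intro!: powr_mono2)
  show "integrable lborel (\<lambda>x. \<bar>deriv \<phi> x\<bar> powr p)"
    using assms(2) B K by (intro integrable_bounded_on_compact[where K=K and B="B powr p"])
      (auto intro!: powr_mono2)
qed

text \<open>The norm of \<open>W1p\<close> is written with a chosen weak derivative. Uniqueness replaces the choice by
  any Borel representative, here \<open>g'\<close>, and turns convergence in that norm into convergence of two
  integrals over the line.\<close>
lemma W1p_0_borel_representative:
  fixes a b :: real
  assumes p: "0 < p" and w: "w \<in> W1p_0 p {a<..<b}" and g: "has_weak_deriv {a<..<b} w g"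
    and [measurable]: "w' \<in> borel_measurable borel" "g' \<in> borel_measurable borel"
    and out: "\<And>x. x \<notin> {a<..<b} \<Longrightarrow> w' x = 0" "\<And>x. x \<notin> {a<..<b} \<Longrightarrow> g' x = 0"
    and ae: "AE x in lborel. x \<in> {a<..<b} \<longrightarrow> w x = w' x" "AE x in lborel. x \<in> {a<..<b} \<longrightarrow> g x = g' x"
  shows "integrable lborel (\<lambda>x. \<bar>w' x\<bar> powr p)" "integrable lborel (\<lambda>x. \<bar>g' x\<bar> powr p)"
    "(\<integral>x. \<bar>g' x\<bar> powr p \<partial>lborel) \<le> W1p_norm p {a<..<b} w powr p"
    "\<exists>\<phi>. (\<forall>n. \<phi> n \<in> Cc_infty {a<..<b}) \<and> (\<lambda>n. \<integral>x. \<bar>w' x - \<phi> n x\<bar> powr p \<partial>lborel) \<longlonglongrightarrow> 0 \<and>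
      (\<lambda>n. \<integral>x. \<bar>g' x - deriv (\<phi> n) x\<bar> powr p \<partial>lborel) \<longlonglongrightarrow> 0"
proof -
  let ?I = "{a<..<b}"
  have Ib: "?I \<in> sets borel" by simp
  have conv: "integrable (lebesgue_on ?I) (\<lambda>x. \<bar>k x\<bar> powr p) \<longleftrightarrow> integrable lborel (\<lambda>x. \<bar>h x\<bar> powr p)"
    "integral\<^sup>L (lebesgue_on ?I) (\<lambda>x. \<bar>k x\<bar> powr p) = (\<integral>x. \<bar>h x\<bar> powr p \<partial>lborel)"
    if k: "AE x in lborel. x \<in> ?I \<longrightarrow> k x = h x" and h: "h \<in> borel_measurable borel" "\<And>x. x \<notin> ?I \<Longrightarrow> h x = 0"
    for k h :: "real \<Rightarrow> real"
  proof -
    have "AE x in lborel. x \<in> ?I \<longrightarrow> \<bar>k x\<bar> powr p = \<bar>h x\<bar> powr p"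
      using k by (rule eventually_mono) auto
    moreover have "(\<lambda>x. \<bar>h x\<bar> powr p) \<in> borel_measurable borel" using h(1) by measurable
    moreover have e: "indicator ?I x * \<bar>h x\<bar> powr p = \<bar>h x\<bar> powr p" for x
      by (cases "x \<in> ?I") (simp_all add: h(2))
    ultimately show "integrable (lebesgue_on ?I) (\<lambda>x. \<bar>k x\<bar> powr p) \<longleftrightarrow> integrable lborel (\<lambda>x. \<bar>h x\<bar> powr p)"
      "integral\<^sup>L (lebesgue_on ?I) (\<lambda>x. \<bar>k x\<bar> powr p) = (\<integral>x. \<bar>h x\<bar> powr p \<partial>lborel)"
      using integrable_lebesgue_on_borel[OF Ib, of "\<lambda>x. \<bar>h x\<bar> powr p" "\<lambda>x. \<bar>k x\<bar> powr p"]
        integral_lebesgue_on_borel[OF Ib, of "\<lambda>x. \<bar>h x\<bar> powr p" "\<lambda>x. \<bar>k x\<bar> powr p"]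
      unfolding e by blast+
  qed
  have "w \<in> Lp p (lebesgue_on ?I)" using w by (simp add: W1p_0_def W1p_def)
  then show iw: "integrable lborel (\<lambda>x. \<bar>w' x\<bar> powr p)"
    using conv(1)[OF ae(1) _ out(1)] by (simp add: Lp_def)
  obtain g1 where g1: "g1 \<in> Lp p (lebesgue_on ?I)" "has_weak_deriv ?I w g1"
    using w by (auto simp: W1p_0_def W1p_def)
  have "AE x in lborel. x \<in> ?I \<longrightarrow> g1 x = g' x"
    using weak_deriv_unique[OF g1(2) g] ae(2) by eventually_elim auto
  from conv(1)[OF this _ out(2)] g1(1)
  show ig: "integrable lborel (\<lambda>x. \<bar>g' x\<bar> powr p)" by (simp add: Lp_def)
  have norm: "W1p_norm p ?I k powr p = (\<integral>x. \<bar>k' x\<bar> powr p \<partial>lborel) + (\<integral>x. \<bar>h' x\<bar> powr p \<partial>lborel)"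
    if k: "has_weak_deriv ?I k h" "AE x in lborel. x \<in> ?I \<longrightarrow> k x = k' x" "AE x in lborel. x \<in> ?I \<longrightarrow> h x = h' x"
      "k' \<in> borel_measurable borel" "h' \<in> borel_measurable borel"
      "\<And>x. x \<notin> ?I \<Longrightarrow> k' x = 0" "\<And>x. x \<notin> ?I \<Longrightarrow> h' x = 0"
    for k h k' h'
  proof -
    have "AE x in lborel. x \<in> ?I \<longrightarrow> weak_deriv ?I k x = h' x"
      using weak_deriv_AE[OF k(1)] k(3) by eventually_elim auto
    then have c: "(\<integral>x. \<bar>weak_deriv ?I k x\<bar> powr p \<partial>lebesgue_on ?I) = (\<integral>x. \<bar>h' x\<bar> powr p \<partial>lborel)"
      "(\<integral>x. \<bar>k x\<bar> powr p \<partial>lebesgue_on ?I) = (\<integral>x. \<bar>k' x\<bar> powr p \<partial>lborel)"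
      using k by (intro conv(2); simp)+
    have "0 \<le> (\<integral>x. \<bar>k' x\<bar> powr p \<partial>lborel)" "0 \<le> (\<integral>x. \<bar>h' x\<bar> powr p \<partial>lborel)"
      by (rule Bochner_Integration.integral_nonneg; simp)+
    then show ?thesis using p by (simp add: W1p_norm_def c powr_powr)
  qed
  have "0 \<le> (\<integral>x. \<bar>w' x\<bar> powr p \<partial>lborel)" by (rule Bochner_Integration.integral_nonneg) simp
  then show "(\<integral>x. \<bar>g' x\<bar> powr p \<partial>lborel) \<le> W1p_norm p ?I w powr p"
    by (subst norm[OF g ae _ _ out]) simp_all
  obtain \<phi> where \<phi>: "\<And>n. \<phi> n \<in> Cc_infty ?I" "(\<lambda>n. W1p_norm p ?I (\<lambda>x. w x - \<phi> n x)) \<longlonglongrightarrow> 0"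
    using w by (auto simp: W1p_0_def)
  have z: "\<phi> n x = 0" "deriv (\<phi> n) x = 0" if "x \<notin> ?I" for n x
    using Cc_infty_support[OF \<phi>(1)[of n]] that by blast+
  let ?A = "\<lambda>n. \<integral>x. \<bar>w' x - \<phi> n x\<bar> powr p \<partial>lborel" and ?B = "\<lambda>n. \<integral>x. \<bar>g' x - deriv (\<phi> n) x\<bar> powr p \<partial>lborel"
  have "W1p_norm p ?I (\<lambda>x. w x - \<phi> n x) powr p = ?A n + ?B n" for n
  proof (rule norm)
    note [measurable] = Cc_infty_borel[OF \<phi>(1)[of n]] Cc_infty_deriv_borel[OF \<phi>(1)[of n]]
    show "has_weak_deriv ?I (\<lambda>x. w x - \<phi> n x) (\<lambda>x. g x - deriv (\<phi> n) x)"
      by (rule has_weak_deriv_diff_Cc[OF g \<phi>(1)])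
    show "AE x in lborel. x \<in> ?I \<longrightarrow> w x - \<phi> n x = w' x - \<phi> n x"
      using ae(1) by (rule eventually_mono) auto
    show "AE x in lborel. x \<in> ?I \<longrightarrow> g x - deriv (\<phi> n) x = g' x - deriv (\<phi> n) x"
      using ae(2) by (rule eventually_mono) auto
    show "(\<lambda>x. w' x - \<phi> n x) \<in> borel_measurable borel" "(\<lambda>x. g' x - deriv (\<phi> n) x) \<in> borel_measurable borel"
      by simp_all
    show "w' x - \<phi> n x = 0" "g' x - deriv (\<phi> n) x = 0" if "x \<notin> ?I" for x
      using out(1)[OF that] out(2)[OF that] z[OF that] by simp_all
  qed
  moreover have "(\<lambda>n. W1p_norm p ?I (\<lambda>x. w x - \<phi> n x) powr p) \<longlonglongrightarrow> 0 powr p"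
    by (rule tendsto_powr') (use \<phi>(2) p in \<open>auto simp: W1p_norm_def\<close>)
  ultimately have lim: "(\<lambda>n. ?A n + ?B n) \<longlonglongrightarrow> 0" by simp
  have nn: "0 \<le> ?A n" "0 \<le> ?B n" for n by (rule Bochner_Integration.integral_nonneg; simp)+
  have "?A \<longlonglongrightarrow> 0" by (rule tendsto_sandwich[OF _ _ tendsto_const lim]) (use nn in auto)
  moreover have "?B \<longlonglongrightarrow> 0" by (rule tendsto_sandwich[OF _ _ tendsto_const lim]) (use nn in auto)
  ultimately show "\<exists>\<phi>. (\<forall>n. \<phi> n \<in> Cc_infty ?I) \<and> (\<lambda>n. \<integral>x. \<bar>w' x - \<phi> n x\<bar> powr p \<partial>lborel) \<longlonglongrightarrow> 0 \<and>
      (\<lambda>n. \<integral>x. \<bar>g' x - deriv (\<phi> n) x\<bar> powr p \<partial>lborel) \<longlonglongrightarrow> 0"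
    using \<phi>(1) by blast
qed

section \<open>From weak solutions to Borel data on the plane\<close>

text \<open>The properties of a weak solution that the comparison argument uses. The functions \<open>V\<close>, \<open>U\<close>
  and \<open>G\<close> represent the solution, its space derivative and the lower order terms. They take the
  pair \<open>(x, t)\<close> and vanish outside the space-time cylinder, so integrals extend over the plane;
  \<open>v\<close> itself is kept because only it is defined at every time. \<open>G\<close> is left abstract because the
  barrier argument sees it only through lower bounds. Test functions are products, which are enough to
  reach the equation between two times.\<close>
locale energy_solution =
  fixes l p :: real and v :: "real \<Rightarrow> real \<Rightarrow> real" and V U G :: "real \<times> real \<Rightarrow> real"
  assumes l_pos: "0 < l" and p_gt: "2 < p"
    and V_borel [measurable]: "V \<in> borel_measurable borel"
    and U_borel [measurable]: "U \<in> borel_measurable borel"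
    and G_borel [measurable]: "G \<in> borel_measurable borel"
    and outside: "\<And>z. z \<notin> {-l<..<l} \<times> {0<..} \<Longrightarrow> V z = 0"
      "\<And>z. z \<notin> {-l<..<l} \<times> {0<..} \<Longrightarrow> U z = 0"
      "\<And>z. z \<notin> {-l<..<l} \<times> {0<..} \<Longrightarrow> G z = 0"
    and slice: "AE t in lborel. 0 < t \<longrightarrow> (AE x in lborel. x \<in> {-l<..<l} \<longrightarrow> v t x = V (x, t))"
    and v_integrable: "\<And>t. 0 \<le> t \<Longrightarrow> integrable (lebesgue_on {-l<..<l}) (v t)"
    and v_continuous: "\<And>t. 0 \<le> t \<Longrightarrow>
      ((\<lambda>s. \<integral>x. \<bar>v s x - v t x\<bar> \<partial>lebesgue_on {-l<..<l}) \<longlongrightarrow> 0) (at t within {0..})"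
    and V_integrable: "\<And>a b. 0 < a \<Longrightarrow> integrable lborel (\<lambda>z. indicator {a..b} (snd z) * V z)"
    and U_integrable: "\<And>a b. 0 < a \<Longrightarrow> integrable lborel (\<lambda>z. indicator {a..b} (snd z) * \<bar>U z\<bar> powr p)"
    and G_integrable: "integrable lborel G"
    and approx: "AE t in lborel. 0 < t \<longrightarrow>
      integrable lborel (\<lambda>x. \<bar>V (x, t)\<bar> powr p) \<and> integrable lborel (\<lambda>x. \<bar>U (x, t)\<bar> powr p) \<and>
      (\<exists>\<phi>. (\<forall>n. \<phi> n \<in> Cc_infty {-l<..<l}) \<and>
        (\<lambda>n. \<integral>x. \<bar>V (x, t) - \<phi> n x\<bar> powr p \<partial>lborel) \<longlonglongrightarrow> 0 \<and>
        (\<lambda>n. \<integral>x. \<bar>U (x, t) - deriv (\<phi> n) x\<bar> powr p \<partial>lborel) \<longlonglongrightarrow> 0)"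
    and weak: "\<And>\<psi> \<theta>. \<psi> \<in> Cc_infty {-l<..<l} \<Longrightarrow> \<theta> \<in> Cc_infty {0<..} \<Longrightarrow>
      (\<integral>z. - V z * (\<psi> (fst z) * deriv \<theta> (snd z))
        + \<bar>U z\<bar> powr (p - 2) * U z * (deriv \<psi> (fst z) * \<theta> (snd z))
        + G z * (\<psi> (fst z) * \<theta> (snd z)) \<partial>lborel) = 0"

lemma fst_borel [measurable]: "(fst :: real \<times> real \<Rightarrow> real) \<in> borel_measurable borel"
  and snd_borel [measurable]: "(snd :: real \<times> real \<Rightarrow> real) \<in> borel_measurable borel"
  by (intro borel_measurable_continuous_onI continuous_intros)+

lemma sing_absorption_borel [measurable]: "sing_absorption \<beta> \<in> borel_measurable borel"
  unfolding sing_absorption_def[abs_def] by measurable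

lemma Linf_loc_borel_measurable:
  assumes l: "0 < l" and w: "w \<in> Linf_loc (closure {-l<..<l} \<times> {0<..})"
  shows "w \<in> borel_measurable (lebesgue_on ({-l<..<l} \<times> {0<..} :: (real \<times> real) set))"
proof -
  let ?Q = "{-l<..<l} \<times> {0<..} :: (real \<times> real) set"
  define K where "K n = {-l..l} \<times> {inverse (real (Suc n))..real n}" for n
  have Qb: "?Q \<in> sets borel" by (intro borel_open open_Times) auto
  have "(\<lambda>z. if z \<in> ?Q then w z else 0) \<in> borel_measurable lebesgue"
  proof (rule borel_measurable_LIMSEQ_real)
    fix n
    have K: "compact (K n)" "K n \<subseteq> closure {-l<..<l} \<times> {0<..}"
    proof -
      have "0 < inverse (real (Suc n))" by simp
      then have "{inverse (real (Suc n))..real n} \<subseteq> {0<..}"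
        by (auto simp del: of_nat_Suc inverse_positive_iff_positive intro: order_less_le_trans)
      then show "K n \<subseteq> closure {-l<..<l} \<times> {0<..}" unfolding K_def using l by (intro Sigma_mono) auto
    qed (auto simp: K_def intro!: compact_Times)
    have Kb: "K n \<in> sets borel" using K(1) by (rule borel_compact)
    have "w \<in> borel_measurable (lebesgue_on (K n))"
      using w K unfolding Linf_loc_def Linf_def by blast
    then have "(\<lambda>z. if z \<in> K n then w z else 0) \<in> borel_measurable lebesgue"
      using Kb by (subst borel_measurable_if) auto
    then have "(\<lambda>z. indicator ?Q z * (if z \<in> K n then w z else 0)) \<in> borel_measurable lebesgue"
      using Qb by (intro borel_measurable_times borel_measurable_indicator) auto
    then show "(\<lambda>z. if z \<in> K n \<and> z \<in> ?Q then w z else 0) \<in> borel_measurable lebesgue"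
      by (rule measurable_cong[THEN iffD1, rotated]) (auto simp: indicator_def)
  next
    fix z :: "real \<times> real"
    show "(\<lambda>n. if z \<in> K n \<and> z \<in> ?Q then w z else 0) \<longlonglongrightarrow> (if z \<in> ?Q then w z else 0)"
    proof (cases "z \<in> ?Q")
      case True
      have "\<forall>\<^sub>F n in sequentially. inverse (real (Suc n)) < snd z"
        using True LIMSEQ_inverse_real_of_nat by (intro order_tendstoD(2)[of _ 0]) auto
      moreover have "\<forall>\<^sub>F n in sequentially. snd z \<le> real n"
        using filterlim_real_sequentially by (simp add: filterlim_at_top)
      ultimately have "\<forall>\<^sub>F n in sequentially. (if z \<in> K n \<and> z \<in> ?Q then w z else 0) = (if z \<in> ?Q then w z else 0)"
      proof eventually_elim
        case (elim n)
        then have "z \<in> K n" using True by (auto simp: K_def simp del: of_nat_Suc)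
        then show ?case by simp
      qed
      then show ?thesis by (rule tendsto_eventually)
    qed simp
  qed
  then show ?thesis using Qb by (subst (asm) borel_measurable_if) auto
qed

lemma Linf_loc_AE_bounded:
  assumes "w \<in> Linf_loc S" "compact K" "K \<subseteq> S"
  shows "\<exists>C. AE z in lborel. z \<in> K \<longrightarrow> \<bar>w z\<bar> \<le> C"
proof -
  have "esssup (lebesgue_on K) (\<lambda>z. ereal \<bar>w z\<bar>) < \<infinity>"
    using assms unfolding Linf_loc_def Linf_def by blast
  then obtain C where C: "esssup (lebesgue_on K) (\<lambda>z. ereal \<bar>w z\<bar>) \<le> ereal C"
    by (cases "esssup (lebesgue_on K) (\<lambda>z. ereal \<bar>w z\<bar>)") auto
  have "AE z in lebesgue_on K. \<bar>w z\<bar> \<le> C"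
    using esssup_AE[of "\<lambda>z. ereal \<bar>w z\<bar>" "lebesgue_on K"]
  proof eventually_elim
    case (elim z)
    then have "ereal \<bar>w z\<bar> \<le> ereal C" using C by (rule order_trans)
    then show ?case by simp
  qed
  then have "AE z in lborel. z \<in> K \<longrightarrow> \<bar>w z\<bar> \<le> C"
    by (simp only: AE_lebesgue_on_iff[OF borel_compact[OF assms(2)]])
  then show ?thesis by (rule exI)
qed

text \<open>Integrability of \<open>\<bar>U\<bar> powr p\<close> on a time slab comes from Tonelli's theorem: for almost every
  time its space integral is bounded by the \<open>p\<close>-th power of the Sobolev norm, which is locally
  integrable in time.\<close>
lemma weak_solution_imp_energy_solution:
  assumes l: "0 < l" and p: "2 < p" and f: "continuous_on UNIV f" "f 0 = 0"
    and sol: "weak_solution l \<beta> p f u0 v"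
  obtains V U where "energy_solution l p v V U (\<lambda>z. sing_absorption \<beta> (V z) + f (V z))"
    "AE z in lborel. 0 \<le> V z"
proof -
  let ?I = "{-l<..<l}" and ?J = "{0<..} :: real set"
  let ?Q = "?I \<times> ?J"
  have Qb: "?Q \<in> sets borel" by (intro borel_open open_Times) auto
  have Ib: "?I \<in> sets borel" "?J \<in> sets borel" by auto
  have fb [measurable]: "f \<in> borel_measurable borel" using f(1) by (rule borel_measurable_continuous_onI)
  let ?v = "\<lambda>z. v (snd z) (fst z)"
  have s1: "AE z in lebesgue_on ?Q. ?v z \<ge> 0"
    and s2: "integrable (lebesgue_on ?Q) (\<lambda>z. f (?v z))"
    and s3: "integrable (lebesgue_on ?Q) (\<lambda>z. sing_absorption \<beta> (?v z))"
    and s4: "v \<in> Lp_loc_W1p_0 p ?J ?I"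
    and s5: "?v \<in> Linf_loc (closure ?I \<times> ?J)"
    and s6: "v \<in> continuous_L1 {0..} ?I"
    using sol unfolding weak_solution_def Let_def by (simp_all add: case_prod_unfold)
  let ?weak = "\<lambda>ux \<phi>. integral\<^sup>L (lebesgue_on ?Q) (\<lambda>z.
               - v (snd z) (fst z) * deriv (\<lambda>\<tau>. \<phi> (fst z, \<tau>)) (snd z)
               + \<bar>ux (snd z) (fst z)\<bar> powr (p - 2) * ux (snd z) (fst z) * deriv (\<lambda>\<xi>. \<phi> (\<xi>, snd z)) (fst z)
               + sing_absorption \<beta> (v (snd z) (fst z)) * \<phi> (fst z, snd z)
               + f (v (snd z) (fst z)) * \<phi> (fst z, snd z)) = 0"
  have "\<exists>ux. (\<lambda>z. ux (snd z) (fst z)) \<in> borel_measurable (lebesgue_on ?Q) \<and>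
      (AE t in lebesgue_on ?J. has_weak_deriv ?I (v t) (ux t)) \<and>
      (\<forall>\<phi>\<in>Cc_infty ?Q. ?weak ux \<phi>)"
    using sol unfolding weak_solution_def Let_def case_prod_unfold by (elim conjE)
  then obtain ux where ux1: "(\<lambda>z. ux (snd z) (fst z)) \<in> borel_measurable (lebesgue_on ?Q)"
    and ux2: "AE t in lebesgue_on ?J. has_weak_deriv ?I (v t) (ux t)"
    and ux3: "\<forall>\<phi>\<in>Cc_infty ?Q. ?weak ux \<phi>"
    by (elim exE conjE)
  obtain V where V [measurable]: "V \<in> borel_measurable borel" and V0: "\<forall>z. z \<notin> ?Q \<longrightarrow> V z = 0"
    and Vae: "AE z in lborel. z \<in> ?Q \<longrightarrow> ?v z = V z"
    using lebesgue_on_borel_representative[OF Qb Linf_loc_borel_measurable[OF l s5]] by (elim exE conjE)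
  obtain U where U [measurable]: "U \<in> borel_measurable borel" and U0: "\<forall>z. z \<notin> ?Q \<longrightarrow> U z = 0"
    and Uae: "AE z in lborel. z \<in> ?Q \<longrightarrow> ux (snd z) (fst z) = U z"
    using lebesgue_on_borel_representative[OF Qb ux1] by (elim exE conjE)
  note V0 = V0[rule_format] and U0 = U0[rule_format]
  define G where "G z = sing_absorption \<beta> (V z) + f (V z)" for z
  have G [measurable]: "G \<in> borel_measurable borel" unfolding G_def[abs_def] by measurable
  have G0: "G z = 0" if "z \<notin> ?Q" for z using V0[OF that] f(2) by (simp add: G_def sing_absorption_def)
  have indQ: "indicator ?Q z * h = h" if "z \<notin> ?Q \<Longrightarrow> h = 0" for z and h :: real
    using that by (cases "z \<in> ?Q") auto
  have V_nonneg: "AE z in lborel. 0 \<le> V z"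
  proof -
    have "AE z in lborel. z \<in> ?Q \<longrightarrow> ?v z \<ge> 0" using s1 by (simp only: AE_lebesgue_on_iff[OF Qb])
    with Vae show ?thesis
    proof eventually_elim
      case (elim z)
      then show ?case using V0[of z] by (cases "z \<in> ?Q") simp_all
    qed
  qed
  have slices: "AE t in lborel. 0 < t \<longrightarrow> (AE x in lborel. x \<in> ?I \<longrightarrow> v t x = V (x, t)) \<and>
      (AE x in lborel. x \<in> ?I \<longrightarrow> ux t x = U (x, t)) \<and> v t \<in> W1p_0 p ?I \<and> has_weak_deriv ?I (v t) (ux t)"
  proof -
    have "AE t in lborel. t \<in> ?J \<longrightarrow> v t \<in> W1p_0 p ?I"
      using s4 unfolding Lp_loc_W1p_0_def mem_Collect_eq AE_lebesgue_on_iff[OF Ib(2)] by (rule conjunct1)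
    moreover have "AE t in lborel. t \<in> ?J \<longrightarrow> has_weak_deriv ?I (v t) (ux t)"
      using ux2 by (simp only: AE_lebesgue_on_iff[OF Ib(2)])
    ultimately show ?thesis using AE_lborel_swap[OF Vae] AE_lborel_swap[OF Uae]
    proof eventually_elim
      case (elim t)
      show ?case
      proof (intro impI conjI)
        assume t: "0 < t"
        show "AE x in lborel. x \<in> ?I \<longrightarrow> v t x = V (x, t)"
          using elim(3) by (rule eventually_mono) (use t in auto)
        show "AE x in lborel. x \<in> ?I \<longrightarrow> ux t x = U (x, t)"
          using elim(4) by (rule eventually_mono) (use t in auto)
      qed (use elim in auto)
    qed
  qed
  have sect: "(\<lambda>x. h (x, t)) \<in> borel_measurable borel" if "h \<in> borel_measurable borel" for h :: "real \<times> real \<Rightarrow> real" and t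
    using that by measurable
  let ?approx = "\<lambda>t. \<exists>\<phi>. (\<forall>n. \<phi> n \<in> Cc_infty ?I) \<and>
        (\<lambda>n. \<integral>x. \<bar>V (x, t) - \<phi> n x\<bar> powr p \<partial>lborel) \<longlonglongrightarrow> 0 \<and>
        (\<lambda>n. \<integral>x. \<bar>U (x, t) - deriv (\<phi> n) x\<bar> powr p \<partial>lborel) \<longlonglongrightarrow> 0"
  have rep: "AE t in lborel. 0 < t \<longrightarrow>
      (\<integral>x. \<bar>U (x, t)\<bar> powr p \<partial>lborel) \<le> W1p_norm p ?I (v t) powr p \<and>
      integrable lborel (\<lambda>x. \<bar>V (x, t)\<bar> powr p) \<and> integrable lborel (\<lambda>x. \<bar>U (x, t)\<bar> powr p) \<and>
      ?approx t"
    using slices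
  proof eventually_elim
    case (elim t)
    show ?case
    proof
      assume "0 < t"
      with elim have e: "v t \<in> W1p_0 p ?I" "has_weak_deriv ?I (v t) (ux t)"
        "AE x in lborel. x \<in> ?I \<longrightarrow> v t x = V (x, t)" "AE x in lborel. x \<in> ?I \<longrightarrow> ux t x = U (x, t)" by auto
      have p0: "0 < p" using p by simp
      have o: "V (x, t) = 0" "U (x, t) = 0" if "x \<notin> ?I" for x
        using V0[of "(x, t)"] U0[of "(x, t)"] that by auto
      note * = W1p_0_borel_representative[OF p0 e(1,2) sect[OF V, of t] sect[OF U, of t] o e(3,4)]
      show "(\<integral>x. \<bar>U (x, t)\<bar> powr p \<partial>lborel) \<le> W1p_norm p ?I (v t) powr p \<and>
        integrable lborel (\<lambda>x. \<bar>V (x, t)\<bar> powr p) \<and> integrable lborel (\<lambda>x. \<bar>U (x, t)\<bar> powr p) \<and>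
        ?approx t"
        using * by blast
    qed
  qed
  have "energy_solution l p v V U G"
  proof
    show "0 < l" "2 < p" "V \<in> borel_measurable borel" "U \<in> borel_measurable borel" "G \<in> borel_measurable borel"
      using l p V U G by auto
    show "V z = 0" "U z = 0" "G z = 0" if "z \<notin> ?Q" for z
      using V0[OF that] U0[OF that] G0[OF that] by auto
    show "AE t in lborel. 0 < t \<longrightarrow> (AE x in lborel. x \<in> ?I \<longrightarrow> v t x = V (x, t))"
      using slices by (rule eventually_mono) blast
    show "integrable (lebesgue_on ?I) (v t)" if "0 \<le> t" for t
      using s6 that by (auto simp: continuous_L1_def)
    show "((\<lambda>s. \<integral>x. \<bar>v s x - v t x\<bar> \<partial>lebesgue_on ?I) \<longlongrightarrow> 0) (at t within {0..})" if "0 \<le> t" for t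
      using s6 that by (auto simp: continuous_L1_def)
    show "integrable lborel G"
    proof -
      have i: "integrable (lebesgue_on ?Q) (\<lambda>z. sing_absorption \<beta> (?v z) + f (?v z))"
        by (rule Bochner_Integration.integrable_add[OF s3 s2])
      have ae: "AE z in lborel. z \<in> ?Q \<longrightarrow> sing_absorption \<beta> (?v z) + f (?v z) = G z"
        using Vae by (rule eventually_mono) (auto simp: G_def)
      have e: "indicator ?Q z * G z = G z" for z by (rule indQ) (rule G0)
      show ?thesis using integrable_lebesgue_on_borel[OF Qb G ae] i unfolding e by (rule iffD1)
    qed
    show "integrable lborel (\<lambda>z. indicator {a..b} (snd z) * V z)" if a: "0 < a" for a b
    proof -
      let ?K = "{-l..l} \<times> {a..b}"
      have K: "compact ?K" "?K \<subseteq> closure ?I \<times> ?J" using a l by (auto intro!: compact_Times)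
      obtain C where C: "AE z in lborel. z \<in> ?K \<longrightarrow> \<bar>?v z\<bar> \<le> C"
        using Linf_loc_AE_bounded[OF s5 K] by (elim exE)
      have "emeasure lborel ?K < \<infinity>" using K(1) by (intro emeasure_bounded_finite compact_imp_bounded)
      then have iK: "integrable lborel (\<lambda>z. C * indicator ?K z :: real)"
        using borel_compact[OF K(1)] by (auto simp: integrable_indicator_iff)
      show ?thesis
      proof (rule Bochner_Integration.integrable_bound[OF iK])
        show "AE z in lborel. norm (indicator {a..b} (snd z) * V z) \<le> norm (C * indicator ?K z :: real)"
          using C Vae
        proof eventually_elim
          case (elim z)
          show ?case
          proof (cases "z \<in> ?Q \<and> snd z \<in> {a..b}")
            case True
            then have "z \<in> ?K" by (cases z) auto
            then show ?thesis using elim True by (simp add: abs_mult)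
          next
            case False
            then show ?thesis using V0[of z] by (cases "snd z \<in> {a..b}") simp_all
          qed
        qed
        have "(\<lambda>z. indicator {a..b} (snd z) * V z) \<in> borel_measurable borel" by measurable
        then show "(\<lambda>z. indicator {a..b} (snd z) * V z) \<in> borel_measurable lborel" by simp
      qed
    qed
    show "integrable lborel (\<lambda>z. indicator {a..b} (snd z) * \<bar>U z\<bar> powr p)" if a: "0 < a" for a b
    proof -
      let ?h = "\<lambda>z::real\<times>real. indicator {a..b} (snd z) * \<bar>U z\<bar> powr p :: real"
      have hm: "?h \<in> borel_measurable borel" by measurable
      have "{a..b} \<subseteq> ?J" using a by auto
      then have im: "integrable (lebesgue_on {a..b}) (\<lambda>t. W1p_norm p ?I (v t) powr p)"
        using s4 unfolding Lp_loc_W1p_0_def by blast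
      have "(\<integral>\<^sup>+z. ennreal (?h z) \<partial>lborel) = (\<integral>\<^sup>+t. \<integral>\<^sup>+x. ennreal (?h (x, t)) \<partial>lborel \<partial>lborel)"
        using lborel_pair.nn_integral_snd[of "\<lambda>z. ennreal (?h z)"] hm by (simp add: lborel_prod)
      also have "\<dots> \<le> (\<integral>\<^sup>+t. ennreal (indicator {a..b} t * W1p_norm p ?I (v t) powr p) \<partial>lborel)"
      proof (rule nn_integral_mono_AE)
        show "AE t in lborel. (\<integral>\<^sup>+x. ennreal (?h (x, t)) \<partial>lborel) \<le> ennreal (indicator {a..b} t * W1p_norm p ?I (v t) powr p)"
          using rep
        proof eventually_elim
          case (elim t)
          show ?case
          proof (cases "t \<in> {a..b}")
            case True
            with a elim have e: "(\<integral>x. \<bar>U (x, t)\<bar> powr p \<partial>lborel) \<le> W1p_norm p ?I (v t) powr p"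
               "integrable lborel (\<lambda>x. \<bar>U (x, t)\<bar> powr p)" by auto
            have "(\<integral>\<^sup>+x. ennreal (?h (x, t)) \<partial>lborel) = ennreal (\<integral>x. \<bar>U (x, t)\<bar> powr p \<partial>lborel)"
              using True e(2) by (simp add: nn_integral_eq_integral)
            also have "\<dots> \<le> ennreal (indicator {a..b} t * W1p_norm p ?I (v t) powr p)"
              using True e(1) by (intro ennreal_leI) simp
            finally show ?thesis .
          qed simp
        qed
      qed
      also have "\<dots> = (\<integral>\<^sup>+t. ennreal (W1p_norm p ?I (v t) powr p) \<partial>lebesgue_on {a..b})"
      proof -
        have "ennreal (indicator {a..b} t * c) = ennreal c * indicator {a..b} t" for t c
          by (auto simp: indicator_def)
        then show ?thesis by (simp add: nn_integral_restrict_space nn_integral_completion)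
      qed
      also have "\<dots> < \<infinity>" using im by (simp add: integrable_iff_bounded)
      finally show ?thesis using hm by (intro integrableI_nonneg) auto
    qed
    show "AE t in lborel. 0 < t \<longrightarrow>
      integrable lborel (\<lambda>x. \<bar>V (x, t)\<bar> powr p) \<and> integrable lborel (\<lambda>x. \<bar>U (x, t)\<bar> powr p) \<and>
      (\<exists>\<phi>. (\<forall>n. \<phi> n \<in> Cc_infty ?I) \<and>
        (\<lambda>n. \<integral>x. \<bar>V (x, t) - \<phi> n x\<bar> powr p \<partial>lborel) \<longlonglongrightarrow> 0 \<and>
        (\<lambda>n. \<integral>x. \<bar>U (x, t) - deriv (\<phi> n) x\<bar> powr p \<partial>lborel) \<longlonglongrightarrow> 0)"
      using rep by (rule eventually_mono) blast
    fix \<psi> \<theta> assume \<psi>: "\<psi> \<in> Cc_infty ?I" and \<theta>: "\<theta> \<in> Cc_infty ?J"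
    let ?g = "\<lambda>z. - V z * (\<psi> (fst z) * deriv \<theta> (snd z))
        + \<bar>U z\<bar> powr (p - 2) * U z * (deriv \<psi> (fst z) * \<theta> (snd z))
        + G z * (\<psi> (fst z) * \<theta> (snd z))"
    note [measurable] = Cc_infty_borel[OF \<psi>] Cc_infty_borel[OF \<theta>]
      Cc_infty_deriv_borel[OF \<psi>] Cc_infty_deriv_borel[OF \<theta>]
    have gm: "?g \<in> borel_measurable borel" by measurable
    have d1: "deriv (\<lambda>\<tau>. \<psi> x * \<theta> \<tau>) t = \<psi> x * deriv \<theta> t" for x t
      using Cc_infty_DERIV[OF \<theta>, of t] by (intro DERIV_imp_deriv DERIV_cmult)
    have d2: "deriv (\<lambda>\<xi>. \<psi> \<xi> * \<theta> t) x = deriv \<psi> x * \<theta> t" for x t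
      using Cc_infty_DERIV[OF \<psi>, of x] by (intro DERIV_imp_deriv DERIV_cmult_right)
    have "AE z in lborel. z \<in> ?Q \<longrightarrow>
        - v (snd z) (fst z) * deriv (\<lambda>\<tau>. \<psi> (fst z) * \<theta> \<tau>) (snd z)
               + \<bar>ux (snd z) (fst z)\<bar> powr (p - 2) * ux (snd z) (fst z) * deriv (\<lambda>\<xi>. \<psi> \<xi> * \<theta> (snd z)) (fst z)
               + sing_absorption \<beta> (v (snd z) (fst z)) * (\<psi> (fst z) * \<theta> (snd z))
               + f (v (snd z) (fst z)) * (\<psi> (fst z) * \<theta> (snd z)) = ?g z"
      using Vae Uae
    proof eventually_elim
      case (elim z)
      then show ?case unfolding d1 d2 G_def by (auto simp: distrib_right)
    qed
    from integral_lebesgue_on_borel[OF Qb gm this] bspec[OF ux3 Cc_infty_prod[OF \<psi> \<theta>]]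
    have "(\<integral>z. indicator ?Q z * ?g z \<partial>lborel) = 0" by (simp only: fst_conv snd_conv)
    moreover have "indicator ?Q z * ?g z = ?g z" for z
    proof (rule indQ)
      assume "z \<notin> ?Q"
      from V0[OF this] U0[OF this] G0[OF this] show "?g z = 0" by simp
    qed
    ultimately show "(\<integral>z. ?g z \<partial>lborel) = 0" by (simp only:)
  qed
  from that[OF this[unfolded G_def[abs_def]] V_nonneg] show thesis .
qed

section \<open>The equation between two times\<close>

lemma flat'_integral: "integrable lborel flat'" "(\<integral>r. flat' r \<partial>lborel) = 1"
proof -
  have "flat' r = flat' r * indicator {0..} r" for r by (auto simp: flat'_def indicator_def)
  then have "(\<integral>\<^sup>+r. ennreal (flat' r) \<partial>lborel) = (\<integral>\<^sup>+r. ennreal (flat' r) * indicator {0..} r \<partial>lborel)"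
    by (intro nn_integral_cong) (auto simp: indicator_def flat'_def)
  also have "\<dots> = ennreal (1 - flat 0)"
    by (rule nn_integral_FTC_atLeast[OF flat'_borel DERIV_flat flat'_nonneg flat_at_top])
  finally have e: "(\<integral>\<^sup>+r. ennreal (flat' r) \<partial>lborel) = ennreal 1" by (simp add: flat_def)
  show i: "integrable lborel flat'"
    using e by (intro integrableI_nonneg) (auto simp: flat'_nonneg)
  show "(\<integral>r. flat' r \<partial>lborel) = 1"
    using e by (subst integral_eq_nn_integral) (auto simp: flat'_nonneg)
qed

lemma window_deriv:
  "deriv (window a b n) t = real n * flat' (real n * (t - a)) * flat (real n * (b - t))
    - real n * flat (real n * (t - a)) * flat' (real n * (b - t))"
proof (rule DERIV_imp_deriv)
  have 1: "((\<lambda>t. flat (real n * (t - a))) has_real_derivative flat' (real n * (t - a)) * real n) (at t)"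
    by (rule DERIV_chain2[OF DERIV_flat]) (auto intro!: derivative_eq_intros)
  have 2: "((\<lambda>t. flat (real n * (b - t))) has_real_derivative flat' (real n * (b - t)) * (- real n)) (at t)"
    by (rule DERIV_chain2[OF DERIV_flat]) (auto intro!: derivative_eq_intros)
  show "(window a b n has_real_derivative real n * flat' (real n * (t - a)) * flat (real n * (b - t))
    - real n * flat (real n * (t - a)) * flat' (real n * (b - t))) (at t)"
    unfolding window_def[abs_def] using DERIV_mult[OF 1 2] by (simp add: algebra_simps)
qed

text \<open>The weights are the probability density \<open>flat'\<close> rescaled towards \<open>a\<close> from the right. The
  extra factor tends to one and cuts off the slowly decaying tail at \<open>b\<close>. Substituting
  \<open>t = a + r / n\<close> leaves a limit dominated by a multiple of \<open>flat'\<close>.\<close>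
lemma concentrating_at_left_endpoint:
  fixes A :: "real \<Rightarrow> real"
  assumes ab: "a < b" and A: "continuous_on {a..b} A" and Ab [measurable]: "A \<in> borel_measurable borel"
    and Aout: "\<And>t. t \<notin> {a..b} \<Longrightarrow> A t = 0"
  shows "(\<lambda>n. \<integral>t. A t * (real n * flat' (real n * (t - a)) * flat (real n * (b - t))) \<partial>lborel) \<longlonglongrightarrow> A a"
proof -
  have "bounded (A ` {a..b})" using A by (intro compact_imp_bounded compact_continuous_image) auto
  then obtain C where C: "\<And>t. t \<in> {a..b} \<Longrightarrow> \<bar>A t\<bar> \<le> C"
    unfolding bounded_iff real_norm_def by blast
  have C0: "0 \<le> C" using C[of a] ab by simp
  have C': "\<bar>A t\<bar> \<le> C" for t using C[of t] Aout[of t] C0 by (cases "t \<in> {a..b}") auto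
  let ?h = "\<lambda>n t. A t * (real n * flat' (real n * (t - a)) * flat (real n * (b - t)))"
  let ?g = "\<lambda>n r. A (a + r / real n) * (flat' r * flat (real n * (b - a) - r))"
  have sub: "integral\<^sup>L lborel (?h n) = (\<integral>r. ?g n r \<partial>lborel)"
    if n: "n > 0" for n
  proof -
    have "integral\<^sup>L lborel (?h n) =
      \<bar>1 / real n\<bar> *\<^sub>R (\<integral>r. ?h n (a + 1 / real n * r) \<partial>lborel)"
      using n by (intro lborel_integral_real_affine) auto
    also have "\<dots> = (\<integral>r. \<bar>1 / real n\<bar> *\<^sub>R ?h n (a + 1 / real n * r) \<partial>lborel)"
      by (rule integral_scaleR_right[symmetric])
    also have "\<dots> = (\<integral>r. ?g n r \<partial>lborel)"
    proof (rule Bochner_Integration.integral_cong[OF refl])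
      fix r
      have "real n * (b - (a + 1 / real n * r)) = real n * (b - a) - r" using n by (simp add: field_simps)
      moreover have "real n * (a + 1 / real n * r - a) = r" using n by simp
      ultimately show "\<bar>1 / real n\<bar> *\<^sub>R ?h n (a + 1 / real n * r) = ?g n r" using n by simp
    qed
    finally show ?thesis .
  qed
  have lim: "(\<lambda>n. \<integral>r. ?g n r \<partial>lborel) \<longlonglongrightarrow> (\<integral>r. A a * flat' r \<partial>lborel)"
  proof (rule integral_dominated_convergence[where w="\<lambda>r. C * flat' r"])
    show "integrable lborel (\<lambda>r. C * flat' r)" using flat'_integral by auto
    show "AE r in lborel. norm (?g n r) \<le> C * flat' r" for n
    proof (rule AE_I2)
      fix r
      have "flat' r * flat (real n * (b - a) - r) \<le> flat' r"
        by (rule mult_left_le[OF flat_le_1 flat'_nonneg])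
      then show "norm (?g n r) \<le> C * flat' r"
        using C' C0 by (simp add: abs_mult flat'_nonneg flat_nonneg mult_mono)
    qed
    show "AE r in lborel. (\<lambda>n. ?g n r) \<longlonglongrightarrow> A a * flat' r"
    proof (rule AE_I2)
      fix r :: real
      show "(\<lambda>n. ?g n r) \<longlonglongrightarrow> A a * flat' r"
      proof (cases "r > 0")
        case True
        have "(\<lambda>n. a + r / real n) \<longlonglongrightarrow> a + 0"
          by (intro tendsto_intros tendsto_divide_0[OF tendsto_const] filterlim_at_top_imp_at_infinity filterlim_real_sequentially)
        then have s: "(\<lambda>n. a + r / real n) \<longlonglongrightarrow> a" by simp
        then have "\<forall>\<^sub>F n in sequentially. a + r / real n < b" using ab by (rule order_tendstoD)
        then have ev: "\<forall>\<^sub>F n in sequentially. a + r / real n \<in> {a..b}"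
          using True by (auto elim!: eventually_mono)
        have "(\<lambda>n. A (a + r / real n)) \<longlonglongrightarrow> A a"
          using continuous_on_tendsto_compose[OF A s _ ev] ab by simp
        moreover have "filterlim (\<lambda>n. real n * (b - a) - r) at_top sequentially"
        proof -
          have "filterlim (\<lambda>n. (b - a) * real n) at_top sequentially"
            using ab by (intro filterlim_tendsto_pos_mult_at_top[OF tendsto_const _ filterlim_real_sequentially]) simp
          then have "filterlim (\<lambda>n. - r + (b - a) * real n) at_top sequentially"
            by (rule filterlim_tendsto_add_at_top[OF tendsto_const])
          then show ?thesis by (simp add: mult.commute)
        qed
        then have "(\<lambda>n. flat (real n * (b - a) - r)) \<longlonglongrightarrow> 1"
          by (rule filterlim_compose[OF flat_at_top])
        ultimately have "(\<lambda>n. ?g n r) \<longlonglongrightarrow> A a * (flat' r * 1)" by (intro tendsto_intros)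
        then show ?thesis by simp
      qed (simp add: flat'_def)
    qed
  qed measurable
  have "\<forall>\<^sub>F n in sequentially. (\<integral>r. ?g n r \<partial>lborel) =
      integral\<^sup>L lborel (?h n)"
    using eventually_gt_at_top[of 0] by (rule eventually_mono) (simp add: sub)
  from Lim_transform_eventually[OF lim this] show ?thesis by (simp add: flat'_integral)
qed

text \<open>The derivative of the window tends to the difference of the point masses at its endpoints;
  the right endpoint reduces to the left one by reflection.\<close>
lemma window_deriv_integral_LIMSEQ:
  fixes A :: "real \<Rightarrow> real"
  assumes ab: "a < b" and A: "continuous_on {a..b} A" and Ab [measurable]: "A \<in> borel_measurable borel"
    and Aout: "\<And>t. t \<notin> {a..b} \<Longrightarrow> A t = 0"
  shows "(\<lambda>n. \<integral>t. A t * deriv (window a b n) t \<partial>lborel) \<longlonglongrightarrow> A a - A b"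
proof -
  let ?f = "\<lambda>n t. A t * (real n * flat' (real n * (t - a)) * flat (real n * (b - t)))"
  let ?g = "\<lambda>n t. A t * (real n * flat' (real n * (b - t)) * flat (real n * (t - a)))"
  have "bounded (A ` {a..b})" using A by (intro compact_imp_bounded compact_continuous_image) auto
  then obtain C where C: "\<And>t. t \<in> {a..b} \<Longrightarrow> \<bar>A t\<bar> \<le> C"
    unfolding bounded_iff real_norm_def by blast
  have C0: "0 \<le> C" using C[of a] ab by simp
  have C': "\<bar>A t\<bar> \<le> C" for t using C[of t] Aout[of t] C0 by (cases "t \<in> {a..b}") auto
  have bnd: "integrable lborel (\<lambda>t. A t * h t)" if [measurable]: "h \<in> borel_measurable borel" and h: "\<And>t. \<bar>h t\<bar> \<le> B" for h and B :: real
  proof (rule integrable_bounded_on_compact[where K="{a..b}" and B="C * B"])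
    show "\<bar>A t * h t\<bar> \<le> C * B" for t
      unfolding abs_mult using C' h C0 by (intro mult_mono) auto
  qed (auto simp: Aout)
  have fg: "flat' x * flat y \<le> 1" for x y
    using mult_mono[OF flat'_le_1 flat_le_1] by (simp add: flat_nonneg)
  have b: "\<bar>real n * flat' x * flat y\<bar> \<le> real n" for n x y
    using mult_left_mono[OF fg, of "real n" x y] by (simp add: flat'_nonneg flat_nonneg mult.assoc)
  have int: "integrable lborel (?f n)" "integrable lborel (?g n)" for n
    by (rule bnd[where B="real n"], measurable, rule b)+
  have "(\<lambda>n. \<integral>t. ?f n t \<partial>lborel) \<longlonglongrightarrow> A a"
    by (rule concentrating_at_left_endpoint[OF assms])
  moreover have "(\<lambda>n. \<integral>t. ?g n t \<partial>lborel) \<longlonglongrightarrow> A b"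
  proof -
    have "continuous_on {a..b} (\<lambda>t. A (a + b - t))"
      by (rule continuous_on_compose2[OF A]) (auto intro!: continuous_intros)
    moreover have "A (a + b - t) = 0" if "t \<notin> {a..b}" for t
      by (rule Aout) (use that in auto)
    moreover have "(\<lambda>t. A (a + b - t)) \<in> borel_measurable borel" by measurable
    ultimately have "(\<lambda>n. \<integral>t. A (a + b - t) * (real n * flat' (real n * (t - a)) * flat (real n * (b - t))) \<partial>lborel) \<longlonglongrightarrow> A b"
      using concentrating_at_left_endpoint[OF ab, of "\<lambda>t. A (a + b - t)"] by simp
    moreover have "(\<integral>t. ?g n t \<partial>lborel) =
        (\<integral>t. A (a + b - t) * (real n * flat' (real n * (t - a)) * flat (real n * (b - t))) \<partial>lborel)" for n
      using lborel_integral_real_affine[of "-1" "?g n" "a + b"] by (simp add: algebra_simps)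
    ultimately show ?thesis by simp
  qed
  ultimately have "(\<lambda>n. (\<integral>t. ?f n t \<partial>lborel) - (\<integral>t. ?g n t \<partial>lborel)) \<longlonglongrightarrow> A a - A b"
    by (rule tendsto_diff)
  moreover have "(\<integral>t. A t * deriv (window a b n) t \<partial>lborel) = (\<integral>t. ?f n t \<partial>lborel) - (\<integral>t. ?g n t \<partial>lborel)" for n
    unfolding Bochner_Integration.integral_diff[OF int, symmetric] window_deriv
    by (intro Bochner_Integration.integral_cong) (auto simp: algebra_simps)
  ultimately show ?thesis by simp
qed

context energy_solution
begin

abbreviation flux :: "real \<times> real \<Rightarrow> real" where
  "flux z \<equiv> \<bar>U z\<bar> powr (p - 2) * U z"

lemma abs_flux: "\<bar>flux z\<bar> \<le> 1 + \<bar>U z\<bar> powr p"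
proof -
  have "\<bar>flux z\<bar> = \<bar>U z\<bar> powr (p - 1)"
    using p_gt powr_add[of "\<bar>U z\<bar>" "p - 2" 1] by (cases "U z = 0") (auto simp: abs_mult)
  also have "\<dots> \<le> 1 + \<bar>U z\<bar> powr p"
  proof (cases "\<bar>U z\<bar> \<le> 1")
    case True
    then have "\<bar>U z\<bar> powr (p - 1) \<le> 1 powr (p - 1)" using p_gt by (intro powr_mono2) auto
    then show ?thesis by (simp add: add_increasing2)
  next
    case False
    then have "\<bar>U z\<bar> powr (p - 1) \<le> \<bar>U z\<bar> powr p" by (intro powr_mono) auto
    then show ?thesis by simp
  qed
  finally show ?thesis .
qed

lemma slab_integrable_const:
  "integrable lborel (\<lambda>z. indicator ({-l<..<l} \<times> {a<..<b::real}) z :: real)"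
proof -
  have "bounded ({-l..l} \<times> {a..b})" by (intro compact_imp_bounded compact_Times compact_Icc)
  then have "bounded ({-l<..<l} \<times> {a<..<b})" by (rule bounded_subset) auto
  then have "emeasure lborel ({-l<..<l} \<times> {a<..<b}) < \<infinity>" by (rule emeasure_bounded_finite)
  moreover have "{-l<..<l} \<times> {a<..<b} \<in> sets borel" by (intro borel_open open_Times) auto
  ultimately show ?thesis by (simp add: integrable_indicator_iff)
qed

lemma flux_integrable:
  assumes a: "0 < a"
  shows "integrable lborel (\<lambda>z. indicator {a<..<b} (snd z) * flux z)"
proof (rule Bochner_Integration.integrable_bound)
  show "integrable lborel (\<lambda>z. indicator ({-l<..<l} \<times> {a<..<b}) z + indicator {a..b} (snd z) * \<bar>U z\<bar> powr p)"
    by (intro Bochner_Integration.integrable_add slab_integrable_const U_integrable[OF a])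
  show "AE z in lborel. norm (indicator {a<..<b} (snd z) * flux z) \<le>
      norm (indicator ({-l<..<l} \<times> {a<..<b}) z + indicator {a..b} (snd z) * \<bar>U z\<bar> powr p)"
  proof (rule AE_I2)
    fix z :: "real \<times> real"
    show "norm (indicator {a<..<b} (snd z) * flux z) \<le>
      norm (indicator ({-l<..<l} \<times> {a<..<b}) z + indicator {a..b} (snd z) * \<bar>U z\<bar> powr p)"
      using abs_flux[of z] outside(2)[of z] by (cases z) (auto simp: indicator_def abs_mult)
  qed
qed measurable

lemma finite_measure_interval: "finite_measure (lebesgue_on {-l<..<l})"
  using l_pos by (intro finite_measureI) (simp add: emeasure_restrict_space)

lemma integrable_const_interval [simp]: "integrable (lebesgue_on {-l<..<l}) (\<lambda>x. c :: real)"
  by (rule finite_measure.integrable_const[OF finite_measure_interval])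

text \<open>Continuity in \<open>L\<^sup>1\<close> in the form in which it is used: for the pairing with a test function, for
  the excess over a moving barrier, and for the negative part.\<close>
lemma integral_continuous_in_time:
  assumes int: "\<And>s. 0 \<le> s \<Longrightarrow> integrable (lebesgue_on {-l<..<l}) (H s)"
    and lip: "\<And>s t x. \<bar>H s x - H t x\<bar> \<le> B * \<bar>v s x - v t x\<bar> + \<bar>y s - y t :: real\<bar>"
    and y: "continuous_on {0..} y"
  shows "continuous_on {0..} (\<lambda>t. \<integral>x. H t x \<partial>lebesgue_on {-l<..<l})"
  unfolding continuous_on_def
proof
  fix t :: real assume "t \<in> {0..}"
  then have t: "0 \<le> t" by simp
  let ?L = "lebesgue_on {-l<..<l}"
  let ?A = "\<lambda>t. \<integral>x. H t x \<partial>?L"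
  let ?b = "\<lambda>s. B * (\<integral>x. \<bar>v s x - v t x\<bar> \<partial>?L) + \<bar>y s - y t\<bar> * measure ?L (space ?L)"
  have "((\<lambda>s. ?A s - ?A t) \<longlongrightarrow> 0) (at t within {0..})"
  proof (rule Lim_null_comparison)
    have "(y \<longlongrightarrow> y t) (at t within {0..})" using y t by (simp add: continuous_on_def)
    then have "((\<lambda>s. \<bar>y s - y t\<bar>) \<longlongrightarrow> 0) (at t within {0..})" by (intro tendsto_rabs_zero LIM_zero)
    then have "(?b \<longlongrightarrow> B * 0 + 0 * measure ?L (space ?L)) (at t within {0..})"
      using v_continuous[OF t] by (intro tendsto_intros)
    then show "(?b \<longlongrightarrow> 0) (at t within {0..})" by simp
    show "\<forall>\<^sub>F s in at t within {0..}. norm (?A s - ?A t) \<le> ?b s"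
      unfolding eventually_at_topological
    proof (intro exI[of _ UNIV] conjI ballI impI)
      fix s :: real assume "s \<in> {0..}"
      then have s: "0 \<le> s" by simp
      have iv: "integrable ?L (\<lambda>x. \<bar>v s x - v t x\<bar>)" using v_integrable[OF s] v_integrable[OF t] by auto
      have "norm (?A s - ?A t) = norm (\<integral>x. H s x - H t x \<partial>?L)" using int[OF s] int[OF t] by simp
      also have "\<dots> \<le> (\<integral>x. B * \<bar>v s x - v t x\<bar> + \<bar>y s - y t\<bar> \<partial>?L)"
        using int[OF s] int[OF t] iv lip by (intro Bochner_Integration.integral_norm_bound_integral) auto
      also have "\<dots> = ?b s" using iv by simp
      finally show "norm (?A s - ?A t) \<le> ?b s" .
    qed auto
  qed
  then show "(?A \<longlongrightarrow> ?A t) (at t within {0..})" by (simp add: LIM_zero_iff)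
qed

lemma pairing_continuous:
  assumes \<psi>: "\<psi> \<in> Cc_infty {-l<..<l}"
  shows "continuous_on {0..} (\<lambda>t. \<integral>x. v t x * \<psi> x \<partial>lebesgue_on {-l<..<l})"
proof -
  obtain B where B: "\<And>x. \<bar>\<psi> x\<bar> \<le> B" using Cc_infty_bound[OF \<psi>] by metis
  show ?thesis
  proof (rule integral_continuous_in_time[where B=B and y="\<lambda>_. 0"])
    show "integrable (lebesgue_on {-l<..<l}) (\<lambda>x. v s x * \<psi> x)" if "0 \<le> s" for s
      using Cc_infty_borel[OF \<psi>] B that
      by (intro integrable_bounded_mult[where B=B] v_integrable measurable_restrict_space1 measurable_completion) auto
    show "\<bar>v s x * \<psi> x - v t x * \<psi> x\<bar> \<le> B * \<bar>v s x - v t x\<bar> + \<bar>0 - 0 :: real\<bar>" for s t x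
    proof -
      have "\<bar>v s x * \<psi> x - v t x * \<psi> x\<bar> = \<bar>v s x - v t x\<bar> * \<bar>\<psi> x\<bar>"
        unfolding left_diff_distrib[symmetric] abs_mult ..
      also have "\<dots> \<le> \<bar>v s x - v t x\<bar> * B" by (intro mult_left_mono B) simp
      finally show ?thesis by (simp add: mult.commute)
    qed
  qed simp
qed

text \<open>Testing with \<open>\<psi> x * window a b n t\<close>: the time derivative of the window concentrates at \<open>a\<close>
  and \<open>b\<close>, where the pairing of \<open>v\<close> with \<open>\<psi>\<close> is continuous, and the window itself tends to the
  indicator of the time interval.\<close>
lemma weak_form_between_times:
  assumes \<psi>: "\<psi> \<in> Cc_infty {-l<..<l}" and a: "0 < a" and ab: "a < b"
  shows "(\<integral>x. v b x * \<psi> x \<partial>lebesgue_on {-l<..<l}) - (\<integral>x. v a x * \<psi> x \<partial>lebesgue_on {-l<..<l})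
    + (\<integral>z. indicator {a<..<b} (snd z) * (flux z * deriv \<psi> (fst z) + G z * \<psi> (fst z)) \<partial>lborel) = 0"
proof -
  let ?I = "{-l<..<l}"
  obtain B where B: "B > 0" "\<And>x. \<bar>\<psi> x\<bar> \<le> B" "\<And>x. \<bar>deriv \<psi> x\<bar> \<le> B" using Cc_infty_bound[OF \<psi>] by metis
  note [measurable] = Cc_infty_borel[OF \<psi>] Cc_infty_deriv_borel[OF \<psi>]
  define A where "A t = (\<integral>x. v t x * \<psi> x \<partial>lebesgue_on ?I)" for t
  define A' where "A' t = indicator {a..b} t * A t" for t
  let ?w = "window a b"
  have w: "?w n \<in> Cc_infty {0<..}" for n using a by (intro window_Cc_infty) auto
  note [measurable] = Cc_infty_borel[OF w] Cc_infty_deriv_borel[OF w]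
  have Ac: "continuous_on {a..b} A"
    unfolding A_def by (rule continuous_on_subset[OF pairing_continuous[OF \<psi>]]) (use a in auto)
  have A'b: "A' \<in> borel_measurable borel"
    using borel_measurable_continuous_on_indicator[OF _ Ac] unfolding A'_def[abs_def] by simp
  note [measurable] = A'b
  have A'lim: "(\<lambda>n. \<integral>t. A' t * deriv (?w n) t \<partial>lborel) \<longlonglongrightarrow> A a - A b"
  proof -
    have "continuous_on {a..b} A'" using Ac by (rule continuous_on_cong[THEN iffD1, rotated 2]) (auto simp: A'_def)
    from window_deriv_integral_LIMSEQ[OF ab this A'b] show ?thesis using ab by (simp add: A'_def)
  qed
  have wd0: "deriv (?w n) t = 0" if "t \<notin> {a..b}" for n t
    using that by (auto simp: window_deriv flat_def flat'_def zero_less_mult_iff)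
  let ?S = "\<lambda>z. indicator {a..b} (snd z) * V z * \<psi> (fst z)"
  have S: "integrable lborel ?S"
    by (rule integrable_bounded_mult[OF V_integrable[OF a], where B=B]) (use B in auto)
  have Aslice: "AE t in lborel. (\<integral>x. ?S (x, t) \<partial>lborel) = A' t"
    using slice
  proof eventually_elim
    case (elim t)
    show ?case
    proof (cases "t \<in> {a..b}")
      case True
      then have "AE x in lborel. x \<in> ?I \<longrightarrow> v t x = V (x, t)" using elim a by auto
      then have ae: "AE x in lborel. x \<in> ?I \<longrightarrow> v t x * \<psi> x = V (x, t) * \<psi> x"
        by (rule eventually_mono) auto
      have "A t = (\<integral>x. indicator ?I x * (V (x, t) * \<psi> x) \<partial>lborel)"
        unfolding A_def by (rule integral_lebesgue_on_borel[OF _ _ ae]) measurable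
      also have "\<dots> = (\<integral>x. ?S (x, t) \<partial>lborel)"
      proof (rule Bochner_Integration.integral_cong[OF refl])
        fix x show "indicator ?I x * (V (x, t) * \<psi> x) = ?S (x, t)"
          using outside(1)[of "(x, t)"] True by (cases "x \<in> ?I") auto
      qed
      finally show ?thesis using True by (simp add: A'_def)
    qed (simp add: A'_def)
  qed
  \<comment> \<open>Fubini, with the slices of \<open>V\<close> identified with \<open>v\<close> at almost every time\<close>
  have lhs: "(\<integral>z. V z * (\<psi> (fst z) * deriv (?w n) (snd z)) \<partial>lborel) = (\<integral>t. A' t * deriv (?w n) t \<partial>lborel)" for n
  proof -
    obtain C where C: "\<And>t. \<bar>deriv (?w n) t\<bar> \<le> C" using Cc_infty_bound[OF w[of n]] by metis
    have i: "integrable lborel (\<lambda>z. ?S z * deriv (?w n) (snd z))"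
      by (rule integrable_bounded_mult[OF S, where B=C]) (use C in auto)
    have "(\<integral>z. V z * (\<psi> (fst z) * deriv (?w n) (snd z)) \<partial>lborel) = (\<integral>z. ?S z * deriv (?w n) (snd z) \<partial>lborel)"
    proof (rule Bochner_Integration.integral_cong[OF refl])
      fix z show "V z * (\<psi> (fst z) * deriv (?w n) (snd z)) = ?S z * deriv (?w n) (snd z)"
        using wd0[of "snd z" n] by (cases "snd z \<in> {a..b}") simp_all
    qed
    also have "\<dots> = (\<integral>t. \<integral>x. ?S (x, t) * deriv (?w n) t \<partial>lborel \<partial>lborel)"
      using lborel_pair.integral_snd[of "\<lambda>x t. ?S (x, t) * deriv (?w n) t"] i
      by (simp add: lborel_prod case_prod_unfold)
    also have "\<dots> = (\<integral>t. A' t * deriv (?w n) t \<partial>lborel)"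
    proof (rule integral_cong_AE)
      show "AE t in lborel. (\<integral>x. ?S (x, t) * deriv (?w n) t \<partial>lborel) = A' t * deriv (?w n) t"
        using Aslice by (rule eventually_mono) simp
      show "(\<lambda>t. \<integral>x. ?S (x, t) * deriv (?w n) t \<partial>lborel) \<in> borel_measurable lborel" by measurable
    qed measurable
    finally show ?thesis .
  qed
  let ?H = "\<lambda>z. flux z * deriv \<psi> (fst z) + G z * \<psi> (fst z)"
  let ?HI = "\<lambda>z. indicator {a<..<b} (snd z) * ?H z"
  have HI: "integrable lborel ?HI"
  proof -
    have "integrable lborel (\<lambda>z. indicator {a<..<b} (snd z) * flux z * deriv \<psi> (fst z))"
      by (rule integrable_bounded_mult[OF flux_integrable[OF a], where B=B]) (use B in auto)
    moreover have "integrable lborel (\<lambda>z. G z * (indicator {a<..<b} (snd z) * \<psi> (fst z)))"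
      by (rule integrable_bounded_mult[OF G_integrable, where B=B]) (use B in \<open>auto simp: abs_mult indicator_def\<close>)
    ultimately have "integrable lborel (\<lambda>z. indicator {a<..<b} (snd z) * flux z * deriv \<psi> (fst z) + G z * (indicator {a<..<b} (snd z) * \<psi> (fst z)))"
      by (rule Bochner_Integration.integrable_add)
    then show ?thesis by (simp add: distrib_left mult_ac)
  qed
  have rhs: "(\<lambda>n. \<integral>z. ?HI z * ?w n (snd z) \<partial>lborel) \<longlonglongrightarrow> (\<integral>z. ?HI z \<partial>lborel)"
  proof (rule integral_dominated_convergence[where w="\<lambda>z. \<bar>?HI z\<bar>"])
    show "AE z in lborel. (\<lambda>n. ?HI z * ?w n (snd z)) \<longlonglongrightarrow> ?HI z"
    proof (rule AE_I2)
      fix z :: "real \<times> real"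
      have "(\<lambda>n. ?HI z * ?w n (snd z)) \<longlonglongrightarrow> ?HI z * indicator {a<..<b} (snd z)"
        by (intro tendsto_mult tendsto_const window_LIMSEQ)
      then show "(\<lambda>n. ?HI z * ?w n (snd z)) \<longlonglongrightarrow> ?HI z" by (cases "snd z \<in> {a<..<b}") simp_all
    qed
    show "AE z in lborel. norm (?HI z * ?w n (snd z)) \<le> \<bar>?HI z\<bar>" for n
      by (intro AE_I2) (simp add: abs_mult window_nonneg window_le_1 mult_left_le)
    show "integrable lborel (\<lambda>z. \<bar>?HI z\<bar>)" using HI by (rule integrable_abs)
  qed measurable
  have eq: "(\<integral>t. A' t * deriv (?w n) t \<partial>lborel) = (\<integral>z. ?HI z * ?w n (snd z) \<partial>lborel)" for n
  proof -
    obtain C where C: "\<And>t. \<bar>deriv (?w n) t\<bar> \<le> C" using Cc_infty_bound[OF w[of n]] by metis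
    have "integrable lborel (\<lambda>z. ?S z * deriv (?w n) (snd z))"
      by (rule integrable_bounded_mult[OF S, where B=C]) (use C in auto)
    moreover have "?S z * deriv (?w n) (snd z) = V z * (\<psi> (fst z) * deriv (?w n) (snd z))" for z
      using wd0[of "snd z" n] by (cases "snd z \<in> {a..b}") simp_all
    ultimately have i1: "integrable lborel (\<lambda>z. V z * (\<psi> (fst z) * deriv (?w n) (snd z)))" by (simp only:)
    have i2: "integrable lborel (\<lambda>z. ?HI z * ?w n (snd z))"
      by (rule integrable_bounded_mult[OF HI, where B=1]) (auto simp: window_nonneg window_le_1)
    have "(\<integral>z. ?HI z * ?w n (snd z) \<partial>lborel) - (\<integral>z. V z * (\<psi> (fst z) * deriv (?w n) (snd z)) \<partial>lborel) =
      (\<integral>z. ?HI z * ?w n (snd z) - V z * (\<psi> (fst z) * deriv (?w n) (snd z)) \<partial>lborel)"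
      by (rule Bochner_Integration.integral_diff[OF i2 i1, symmetric])
    also have "\<dots> = (\<integral>z. - V z * (\<psi> (fst z) * deriv (?w n) (snd z))
        + flux z * (deriv \<psi> (fst z) * ?w n (snd z)) + G z * (\<psi> (fst z) * ?w n (snd z)) \<partial>lborel)"
    proof (rule Bochner_Integration.integral_cong[OF refl])
      fix z :: "real \<times> real"
      show "?HI z * ?w n (snd z) - V z * (\<psi> (fst z) * deriv (?w n) (snd z)) =
        - V z * (\<psi> (fst z) * deriv (?w n) (snd z))
        + flux z * (deriv \<psi> (fst z) * ?w n (snd z)) + G z * (\<psi> (fst z) * ?w n (snd z))"
        using window_outside[of "snd z" a b n] by (cases "snd z \<in> {a<..<b}") (simp_all add: algebra_simps)
    qed
    also have "\<dots> = 0" by (rule weak[OF \<psi> w])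
    finally show ?thesis using lhs[of n] by simp
  qed
  have "A a - A b = (\<integral>z. ?HI z \<partial>lborel)"
    using LIMSEQ_unique[OF A'lim] rhs by (simp only: eq)
  then show ?thesis unfolding A_def by simp
qed

end

section \<open>The energy inequality\<close>

lemma powr_pred_mult_abs: "1 < q \<Longrightarrow> \<bar>a::real\<bar> powr (q - 1) * \<bar>a\<bar> = \<bar>a\<bar> powr q"
  using powr_add[of "\<bar>a\<bar>" "q - 1" 1] by (cases "a = 0") auto

text \<open>Here \<open>a\<close> and \<open>b\<close> are the gradients at two times and \<open>b'\<close> approximates \<open>b\<close>. The product
  \<open>\<bar>a\<bar> powr (p - 2) * a * b\<close> is negative only for opposite signs, and then \<open>\<bar>a\<bar> powr p + \<bar>b\<bar> powr p\<close>,
  which dominates it, equals the distance of the signed powers of \<open>a\<close> and \<open>b\<close>. The error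
  \<open>b' - b\<close> is absorbed by comparing \<open>\<bar>b' - b\<bar>\<close> with \<open>\<delta> * \<bar>a\<bar>\<close>. The factor \<open>\<kappa>\<close> is the derivative of
  the truncation.\<close>
lemma flux_inequality:
  fixes a b b' \<kappa> \<delta> p :: real
  assumes p: "2 < p" and \<kappa>: "0 \<le> \<kappa>" "\<kappa> \<le> 1" and \<delta>: "0 < \<delta>"
  shows "- ((\<bar>a\<bar> powr (p - 2) * a) * (\<kappa> * b')) \<le>
    \<bar>\<bar>a\<bar> powr (p - 1) * a - \<bar>b\<bar> powr (p - 1) * b\<bar> + \<delta> * \<bar>a\<bar> powr p + \<delta> powr (1 - p) * \<bar>b' - b\<bar> powr p"
proof -
  let ?X = "\<bar>a\<bar> powr (p - 2) * a"
  let ?A = "\<bar>a\<bar> powr (p - 1) * a" and ?B = "\<bar>b\<bar> powr (p - 1) * b"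
  have X: "\<bar>?X\<bar> = \<bar>a\<bar> powr (p - 1)"
    using powr_pred_mult_abs[of "p - 1" a] p by (simp add: abs_mult)
  have AB: "\<bar>?A\<bar> = \<bar>a\<bar> powr p" "\<bar>?B\<bar> = \<bar>b\<bar> powr p"
    using powr_pred_mult_abs[of p] p by (auto simp: abs_mult)
  have 1: "- (?X * b) \<le> \<bar>?A - ?B\<bar>"
  proof (cases "0 \<le> a * b")
    case True
    have "0 \<le> \<bar>a\<bar> powr (p - 2) * (a * b)" by (rule mult_nonneg_nonneg[OF powr_ge_zero True])
    then show ?thesis by (simp add: mult.assoc)
  next
    case False
    then have opp: "(a > 0 \<and> b < 0) \<or> (a < 0 \<and> b > 0)" by (auto simp: not_le mult_less_0_iff)
    then have "\<bar>?A - ?B\<bar> = \<bar>?A\<bar> + \<bar>?B\<bar>"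
    proof
      assume "a > 0 \<and> b < 0"
      then have "?A > 0" "?B < 0" by (auto simp: mult_pos_neg)
      then show ?thesis by linarith
    next
      assume "a < 0 \<and> b > 0"
      then have "?A < 0" "?B > 0" by (auto simp: mult_pos_neg)
      then show ?thesis by linarith
    qed
    moreover have "- (?X * b) \<le> \<bar>a\<bar> powr (p - 1) * \<bar>b\<bar>"
      using X by (metis abs_ge_minus_self abs_mult)
    moreover have "\<bar>a\<bar> powr (p - 1) * \<bar>b\<bar> \<le> \<bar>a\<bar> powr p + \<bar>b\<bar> powr p"
    proof (cases "\<bar>a\<bar> \<le> \<bar>b\<bar>")
      case True
      then have "\<bar>a\<bar> powr (p - 1) * \<bar>b\<bar> \<le> \<bar>b\<bar> powr (p - 1) * \<bar>b\<bar>"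
        using p by (intro mult_right_mono powr_mono2) auto
      then show ?thesis using powr_pred_mult_abs[of p b] p by (simp add: add_increasing)
    next
      case False
      then have "\<bar>a\<bar> powr (p - 1) * \<bar>b\<bar> \<le> \<bar>a\<bar> powr (p - 1) * \<bar>a\<bar>"
        by (intro mult_left_mono) auto
      then show ?thesis using powr_pred_mult_abs[of p a] p by (simp add: add_increasing2)
    qed
    ultimately show ?thesis using AB by linarith
  qed
  have 2: "- (?X * (b' - b)) \<le> \<delta> * \<bar>a\<bar> powr p + \<delta> powr (1 - p) * \<bar>b' - b\<bar> powr p"
  proof -
    let ?d = "\<bar>b' - b\<bar>"
    have "- (?X * (b' - b)) \<le> \<bar>a\<bar> powr (p - 1) * ?d"
      using X by (metis abs_ge_minus_self abs_mult)
    also have "\<dots> \<le> \<delta> * \<bar>a\<bar> powr p + \<delta> powr (1 - p) * ?d powr p"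
    proof (cases "?d \<le> \<delta> * \<bar>a\<bar>")
      case True
      then have "\<bar>a\<bar> powr (p - 1) * ?d \<le> \<bar>a\<bar> powr (p - 1) * (\<delta> * \<bar>a\<bar>)"
        by (intro mult_left_mono) auto
      also have "\<dots> = \<delta> * \<bar>a\<bar> powr p" using powr_pred_mult_abs[of p a] p by (simp add: mult_ac)
      finally show ?thesis by (simp add: add_increasing2)
    next
      case False
      then have "\<bar>a\<bar> \<le> ?d / \<delta>" using \<delta> by (simp add: field_simps)
      then have "\<bar>a\<bar> powr (p - 1) * ?d \<le> (?d / \<delta>) powr (p - 1) * ?d"
        using p by (intro mult_right_mono powr_mono2) auto
      also have "\<dots> = \<delta> powr (1 - p) * ?d powr p"
        using powr_pred_mult_abs[of p "b' - b"] p \<delta> powr_minus_divide[of \<delta> "p - 1"]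
        by (simp add: powr_divide field_simps)
      finally show ?thesis using \<delta> by (simp add: add_increasing)
    qed
    finally show ?thesis .
  qed
  have "- (?X * (\<kappa> * b')) = \<kappa> * (- (?X * b) + - (?X * (b' - b)))" by (simp add: algebra_simps)
  also have "\<dots> \<le> \<kappa> * (\<bar>?A - ?B\<bar> + (\<delta> * \<bar>a\<bar> powr p + \<delta> powr (1 - p) * \<bar>b' - b\<bar> powr p))"
    using 1 2 \<kappa> by (intro mult_left_mono add_mono) auto
  also have "\<dots> \<le> 1 * (\<bar>?A - ?B\<bar> + (\<delta> * \<bar>a\<bar> powr p + \<delta> powr (1 - p) * \<bar>b' - b\<bar> powr p))"
    using \<kappa> \<delta> by (intro mult_right_mono) auto
  finally show ?thesis by simp
qed

lemma AE_lborel_fst: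
  fixes P :: "real \<Rightarrow> bool"
  assumes "AE x in lborel. P x"
  shows "AE z in (lborel :: (real \<times> real) measure). P (fst z)"
proof -
  obtain N where N: "{x \<in> space lborel. \<not> P x} \<subseteq> N" "emeasure lborel N = 0" "N \<in> sets (lborel :: real measure)"
    using AE_E[OF assms] by blast
  have "AE x in lborel. x \<notin> N"
    using N(2,3) by (intro AE_not_in) (simp add: null_sets_def)
  then have "AE x in lborel. AE t in (lborel :: real measure). fst (x, t) \<notin> N"
    by (rule eventually_mono) simp
  moreover have "{z \<in> space (lborel \<Otimes>\<^sub>M (lborel :: real measure)). fst z \<notin> N} \<in> sets (lborel \<Otimes>\<^sub>M lborel)"
    using N(3) by measurable
  ultimately have "AE z in lborel \<Otimes>\<^sub>M (lborel :: real measure). fst z \<notin> N"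
    by (intro lborel_pair.AE_pair_measure)
  then have "AE z in (lborel :: (real \<times> real) measure). fst z \<notin> N" by (simp only: lborel_prod)
  then show ?thesis
  proof (rule eventually_mono)
    fix z :: "real \<times> real" assume "fst z \<notin> N"
    then show "P (fst z)" using N(1) by auto
  qed
qed

lemma lborel_product:
  fixes h k :: "real \<Rightarrow> real"
  assumes h: "integrable lborel h" and k: "integrable lborel k"
  shows lborel_product_integrable: "integrable lborel (\<lambda>z. k (snd z) * h (fst z))"
    and lborel_product_integral: "(\<integral>z. k (snd z) * h (fst z) \<partial>lborel) = (\<integral>t. k t \<partial>lborel) * (\<integral>x. h x \<partial>lborel)"
proof -
  have [measurable]: "h \<in> borel_measurable borel" "k \<in> borel_measurable borel" using h k by auto
  have "integrable (lborel \<Otimes>\<^sub>M lborel) (\<lambda>z. k (snd z) * h (fst z))"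
  proof (rule lborel_pair.Fubini_integrable)
    show "integrable lborel (\<lambda>x. \<integral>y. norm (k (snd (x, y)) * h (fst (x, y))) \<partial>lborel)"
      using h k by (simp add: abs_mult)
    show "AE x in lborel. integrable lborel (\<lambda>y. k (snd (x, y)) * h (fst (x, y)))"
      using k by simp
  qed measurable
  then show i: "integrable lborel (\<lambda>z. k (snd z) * h (fst z))" by (simp only: lborel_prod)
  show "(\<integral>z. k (snd z) * h (fst z) \<partial>lborel) = (\<integral>t. k t \<partial>lborel) * (\<integral>x. h x \<partial>lborel)"
    using lborel_pair.integral_fst'[of "\<lambda>z. k (snd z) * h (fst z)"] i by (simp add: lborel_prod)
qed

lemma integral_indicator_Ioo:
  "a \<le> b \<Longrightarrow> (\<integral>t. indicator {a<..<b} t \<partial>lborel) = b - (a::real)"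
  "integrable lborel (indicator {a<..<b::real} :: real \<Rightarrow> real)"
  by (simp, cases "a \<le> b", auto simp: integrable_indicator_iff)

lemma slab_deviation_integrable:
  fixes f :: "real \<times> real \<Rightarrow> real"
  assumes [measurable]: "f \<in> borel_measurable borel"
    and slab: "integrable lborel (\<lambda>z. indicator {s..\<tau>} (snd z) * f z)"
    and slice: "integrable lborel (\<lambda>x. f (x, \<tau>))"
  shows "integrable lborel (\<lambda>z. indicator {s<..<\<tau>} (snd z) * \<bar>f z - f (fst z, \<tau>)\<bar>)"
proof -
  let ?ind = "\<lambda>z::real \<times> real. indicator {s<..<\<tau>} (snd z) :: real"
  have "integrable lborel (\<lambda>z. ?ind z * f z)"
  proof (rule Bochner_Integration.integrable_bound[OF slab])
    show "AE z in lborel. norm (?ind z * f z) \<le> norm (indicator {s..\<tau>} (snd z) * f z)"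
      by (intro AE_I2) (auto simp: indicator_def)
    have "(\<lambda>z. ?ind z * f z) \<in> borel_measurable borel" by measurable
    then show "(\<lambda>z. ?ind z * f z) \<in> borel_measurable lborel" by simp
  qed
  moreover have "integrable lborel (\<lambda>z. ?ind z * f (fst z, \<tau>))"
    by (rule lborel_product_integrable[OF slice integral_indicator_Ioo(2)])
  ultimately have "integrable lborel (\<lambda>z. \<bar>?ind z * f z - ?ind z * f (fst z, \<tau>)\<bar>)"
    by (intro integrable_abs Bochner_Integration.integrable_diff)
  moreover have "\<bar>?ind z * f z - ?ind z * f (fst z, \<tau>)\<bar> = ?ind z * \<bar>f z - f (fst z, \<tau>)\<bar>" for z
    by (auto simp: indicator_def)
  ultimately show ?thesis by (simp only:)
qed

context energy_solution
begin

text \<open>The signed \<open>p\<close>-th power of \<open>U\<close>: unlike \<open>\<bar>U\<bar> powr p\<close> it detects a change of sign, and it is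
  equally integrable.\<close>
abbreviation signed_energy :: "real \<times> real \<Rightarrow> real" where
  "signed_energy z \<equiv> \<bar>U z\<bar> powr (p - 1) * U z"

lemma abs_signed_energy: "\<bar>signed_energy z\<bar> = \<bar>U z\<bar> powr p"
  using powr_pred_mult_abs[of p "U z"] p_gt by (simp add: abs_mult)

lemma abs_mult_signed_energy: "\<bar>k * signed_energy z\<bar> = \<bar>k * \<bar>U z\<bar> powr p\<bar>"
  unfolding abs_mult[of k] abs_signed_energy by simp

lemma signed_energy_integrable:
  assumes a: "0 < a"
  shows "integrable lborel (\<lambda>z. indicator {a..b} (snd z) * signed_energy z)"
  by (rule Bochner_Integration.integrable_bound[OF U_integrable[OF a, of b]], measurable, intro AE_I2)
    (simp only: real_norm_def abs_mult_signed_energy order_refl)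

text \<open>The equation between \<open>s\<close> and \<open>\<tau>\<close>, tested with \<open>flat (v \<tau> - y)\<close>. That function is the limit of
  the test functions \<open>flat (\<phi> n - y)\<close>, where \<open>\<phi> n\<close> approximates \<open>v \<tau>\<close> in the Sobolev norm. The
  first two terms converge by domination because \<open>flat\<close> is bounded. The flux term is not passed to
  the limit but estimated by \<open>flux_inequality\<close> for each \<open>n\<close>; its error terms disappear as \<open>n\<close>
  tends to infinity and then \<open>\<delta>\<close> to zero.\<close>
lemma energy_inequality:
  "AE \<tau> in lborel. \<forall>s y. 0 < s \<longrightarrow> s < \<tau> \<longrightarrow> 0 \<le> y \<longrightarrow>
    (\<integral>x. (v \<tau> x - v s x) * flat (v \<tau> x - y) \<partial>lebesgue_on {-l<..<l})
      + (\<integral>z. indicator {s<..<\<tau>} (snd z) * (G z * flat (V (fst z, \<tau>) - y)) \<partial>lborel)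
    \<le> (\<integral>z. indicator {s<..<\<tau>} (snd z) * \<bar>signed_energy z - signed_energy (fst z, \<tau>)\<bar> \<partial>lborel)"
  using slice approx
proof eventually_elim
  case (elim \<tau>)
  let ?I = "{-l<..<l}"
  show ?case
  proof (intro allI impI)
    fix s y :: real assume s: "0 < s" "s < \<tau>" and y: "0 \<le> y"
    have \<tau>: "0 < \<tau>" using s by simp
    have sl: "AE x in lborel. x \<in> ?I \<longrightarrow> v \<tau> x = V (x, \<tau>)"
      and iV: "integrable lborel (\<lambda>x. \<bar>V (x, \<tau>)\<bar> powr p)" and iU: "integrable lborel (\<lambda>x. \<bar>U (x, \<tau>)\<bar> powr p)"
      using elim \<tau> by simp_all
    have "\<exists>\<phi>. (\<forall>n. \<phi> n \<in> Cc_infty ?I) \<and>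
        (\<lambda>n. \<integral>x. \<bar>V (x, \<tau>) - \<phi> n x\<bar> powr p \<partial>lborel) \<longlonglongrightarrow> 0 \<and>
        (\<lambda>n. \<integral>x. \<bar>U (x, \<tau>) - deriv (\<phi> n) x\<bar> powr p \<partial>lborel) \<longlonglongrightarrow> 0"
      using elim \<tau> by simp
    then obtain \<phi>0 where \<phi>0: "\<forall>n. \<phi>0 n \<in> Cc_infty ?I"
      and lim0: "(\<lambda>n. \<integral>x. \<bar>V (x, \<tau>) - \<phi>0 n x\<bar> powr p \<partial>lborel) \<longlonglongrightarrow> 0"
      and limU0: "(\<lambda>n. \<integral>x. \<bar>U (x, \<tau>) - deriv (\<phi>0 n) x\<bar> powr p \<partial>lborel) \<longlonglongrightarrow> 0"
      by (elim exE conjE)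
    have p0: "0 < p" "0 \<le> p" using p_gt by auto
    have V\<tau> [measurable]: "(\<lambda>x. V (x, \<tau>)) \<in> borel_measurable borel" "(\<lambda>x. U (x, \<tau>)) \<in> borel_measurable borel"
      by measurable
    have "integrable lborel (\<lambda>x. \<bar>V (x, \<tau>) - \<phi>0 n x\<bar> powr p)" for n
      using Cc_infty_integrable_powr(1)[OF \<phi>0[rule_format, of n] p0(1)] iV Cc_infty_borel[OF \<phi>0[rule_format, of n]]
      by (intro integrable_diff_powr) (use p0 in auto)
    then have "\<exists>r. strict_mono (r :: nat \<Rightarrow> nat) \<and> (AE x in lborel. (\<lambda>n. \<bar>V (x, \<tau>) - \<phi>0 (r n) x\<bar> powr p) \<longlonglongrightarrow> 0)"
      using lim0 by (intro tendsto_L1_AE_subseq) simp_all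
    then obtain r :: "nat \<Rightarrow> nat" where r: "strict_mono r"
      and rae: "AE x in lborel. (\<lambda>n. \<bar>V (x, \<tau>) - \<phi>0 (r n) x\<bar> powr p) \<longlonglongrightarrow> 0"
      by (elim exE conjE)
    define \<phi> where "\<phi> n = \<phi>0 (r n)" for n
    have \<phi>: "\<phi> n \<in> Cc_infty ?I" for n using \<phi>0 by (simp add: \<phi>_def)
    note [measurable] = Cc_infty_borel[OF \<phi>] Cc_infty_deriv_borel[OF \<phi>]
    have conv: "AE x in lborel. (\<lambda>n. \<phi> n x) \<longlonglongrightarrow> V (x, \<tau>)"
      using rae
    proof eventually_elim
      case (elim x)
      have "(\<lambda>n. (\<bar>V (x, \<tau>) - \<phi>0 (r n) x\<bar> powr p) powr (1 / p)) \<longlonglongrightarrow> 0 powr (1 / p)"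
        using elim p0 by (intro tendsto_powr') auto
      then have "(\<lambda>n. \<bar>V (x, \<tau>) - \<phi> n x\<bar>) \<longlonglongrightarrow> 0" using p0 by (simp add: powr_powr \<phi>_def)
      then have "(\<lambda>n. \<phi> n x - V (x, \<tau>)) \<longlonglongrightarrow> 0"
        by (subst tendsto_rabs_zero_iff[symmetric]) (simp add: abs_minus_commute)
      then show ?case by (rule LIM_zero_cancel)
    qed
    have limU: "(\<lambda>n. \<integral>x. \<bar>U (x, \<tau>) - deriv (\<phi> n) x\<bar> powr p \<partial>lborel) \<longlonglongrightarrow> 0"
      using LIMSEQ_subseq_LIMSEQ[OF limU0 r] by (simp add: o_def \<phi>_def)
    have iD: "integrable lborel (\<lambda>x. \<bar>U (x, \<tau>) - deriv (\<phi> n) x\<bar> powr p)" for n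
      using Cc_infty_integrable_powr(2)[OF \<phi> p0(1)] iU
      by (intro integrable_diff_powr) (use p0 in auto)
    define \<psi> where "\<psi> n x = flat (\<phi> n x - y)" for n x
    have \<psi>: "\<psi> n \<in> Cc_infty ?I" for n
      using flat_Cc_infty[OF \<phi> y] by (simp add: \<psi>_def[abs_def])
    have d\<psi>: "deriv (\<psi> n) x = flat' (\<phi> n x - y) * deriv (\<phi> n) x" for n x
      using deriv_flat_compose[OF \<phi>] by (simp add: \<psi>_def[abs_def])
    note [measurable] = Cc_infty_borel[OF \<psi>] Cc_infty_deriv_borel[OF \<psi>]
    have \<psi>1: "\<bar>\<psi> n x\<bar> \<le> 1" for n x by (simp add: \<psi>_def flat_nonneg flat_le_1)
    have \<psi>conv: "AE x in lborel. (\<lambda>n. \<psi> n x) \<longlonglongrightarrow> flat (V (x, \<tau>) - y)"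
      using conv
    proof eventually_elim
      case (elim x)
      then have "(\<lambda>n. \<phi> n x - y) \<longlonglongrightarrow> V (x, \<tau>) - y" by (intro tendsto_intros)
      from continuous_on_tendsto_compose[OF continuous_flat[of UNIV] this] show ?case
        by (simp add: \<psi>_def)
    qed
    let ?ind = "\<lambda>z::real \<times> real. indicator {s<..<\<tau>} (snd z) :: real"
    let ?T1 = "\<lambda>n. \<integral>x. (v \<tau> x - v s x) * \<psi> n x \<partial>lebesgue_on ?I"
    let ?T2 = "\<lambda>n. \<integral>z. ?ind z * (G z * \<psi> n (fst z)) \<partial>lborel"
    let ?E = "\<lambda>n. \<integral>x. \<bar>U (x, \<tau>) - deriv (\<phi> n) x\<bar> powr p \<partial>lborel"
    let ?R = "\<integral>z. ?ind z * \<bar>signed_energy z - signed_energy (fst z, \<tau>)\<bar> \<partial>lborel"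
    let ?M = "\<integral>z. ?ind z * \<bar>U z\<bar> powr p \<partial>lborel"
    have vint: "integrable (lebesgue_on ?I) (v \<tau>)" "integrable (lebesgue_on ?I) (v s)"
      using v_integrable s by auto
    have \<psi>l: "\<psi> n \<in> borel_measurable (lebesgue_on ?I)" for n
      by (intro measurable_restrict_space1 measurable_completion) simp
    have T1: "?T1 \<longlonglongrightarrow> (\<integral>x. (v \<tau> x - v s x) * flat (v \<tau> x - y) \<partial>lebesgue_on ?I)"
    proof (rule integral_dominated_convergence[where w="\<lambda>x. \<bar>v \<tau> x - v s x\<bar>"])
      have "AE x in lborel. x \<in> ?I \<longrightarrow> (\<lambda>n. (v \<tau> x - v s x) * \<psi> n x) \<longlonglongrightarrow> (v \<tau> x - v s x) * flat (v \<tau> x - y)"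
        using \<psi>conv sl
      proof eventually_elim
        case (elim x)
        then show ?case by (auto intro!: tendsto_intros)
      qed
      then show "AE x in lebesgue_on ?I. (\<lambda>n. (v \<tau> x - v s x) * \<psi> n x) \<longlonglongrightarrow> (v \<tau> x - v s x) * flat (v \<tau> x - y)"
        by (subst AE_lebesgue_on_iff) simp_all
      show "AE x in lebesgue_on ?I. norm ((v \<tau> x - v s x) * \<psi> n x) \<le> \<bar>v \<tau> x - v s x\<bar>" for n
        using \<psi>1 by (intro AE_I2) (simp add: abs_mult mult_left_le)
      show "(\<lambda>x. (v \<tau> x - v s x) * \<psi> n x) \<in> borel_measurable (lebesgue_on ?I)" for n
        using vint \<psi>l by (intro borel_measurable_times borel_measurable_diff) auto
      show "(\<lambda>x. (v \<tau> x - v s x) * flat (v \<tau> x - y)) \<in> borel_measurable (lebesgue_on ?I)"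
        using vint by (intro borel_measurable_times borel_measurable_diff measurable_compose[OF _ flat_borel]) auto
    qed (use vint in auto)
    have T2: "?T2 \<longlonglongrightarrow> (\<integral>z. ?ind z * (G z * flat (V (fst z, \<tau>) - y)) \<partial>lborel)"
    proof (rule integral_dominated_convergence[where w="\<lambda>z. \<bar>G z\<bar>"])
      show "AE z in lborel. (\<lambda>n. ?ind z * (G z * \<psi> n (fst z))) \<longlonglongrightarrow> ?ind z * (G z * flat (V (fst z, \<tau>) - y))"
        using AE_lborel_fst[OF \<psi>conv] by eventually_elim (intro tendsto_intros)
      show "AE z in lborel. norm (?ind z * (G z * \<psi> n (fst z))) \<le> \<bar>G z\<bar>" for n
        using \<psi>1 by (intro AE_I2) (auto simp: abs_mult mult_left_le indicator_def)
    qed (use G_integrable in auto)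
    have iM: "integrable lborel (\<lambda>z. ?ind z * \<bar>U z\<bar> powr p)"
    proof (rule Bochner_Integration.integrable_bound[OF U_integrable[OF s(1), of \<tau>]])
      show "AE z in lborel. norm (?ind z * \<bar>U z\<bar> powr p) \<le> norm (indicator {s..\<tau>} (snd z) * \<bar>U z\<bar> powr p)"
        by (intro AE_I2) (auto simp: indicator_def)
    qed measurable
    have iW: "integrable lborel (\<lambda>z. ?ind z * \<bar>signed_energy z - signed_energy (fst z, \<tau>)\<bar>)"
    proof (rule slab_deviation_integrable)
      show "integrable lborel (\<lambda>x. signed_energy (x, \<tau>))"
        by (rule Bochner_Integration.integrable_bound[OF iU], measurable, intro AE_I2)
          (simp only: real_norm_def abs_signed_energy abs_ge_self)
    qed (measurable, rule signed_energy_integrable[OF s(1)])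
    have iE: "integrable lborel (\<lambda>z. ?ind z * \<bar>U (fst z, \<tau>) - deriv (\<phi> n) (fst z)\<bar> powr p)"
      "(\<integral>z. ?ind z * \<bar>U (fst z, \<tau>) - deriv (\<phi> n) (fst z)\<bar> powr p \<partial>lborel) = (\<tau> - s) * ?E n" for n
      using lborel_product[OF iD[of n] integral_indicator_Ioo(2)[of s \<tau>]] s integral_indicator_Ioo(1)[of s \<tau>] by simp_all
    have step: "?T1 n + ?T2 n \<le> ?R + \<delta> * ?M + \<delta> powr (1 - p) * ((\<tau> - s) * ?E n)" if \<delta>: "0 < \<delta>" for \<delta> n
    proof -
      obtain B where B: "\<And>x. \<bar>deriv (\<psi> n) x\<bar> \<le> B" using Cc_infty_bound[OF \<psi>[of n]] by metis
      have iF: "integrable lborel (\<lambda>z. ?ind z * flux z * deriv (\<psi> n) (fst z))"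
        by (rule integrable_bounded_mult[OF flux_integrable[OF s(1)], where B=B]) (use B in auto)
      have iG: "integrable lborel (\<lambda>z. G z * (?ind z * \<psi> n (fst z)))"
        by (rule integrable_bounded_mult[OF G_integrable, where B=1]) (use \<psi>1 in \<open>auto simp: abs_mult indicator_def\<close>)
      have eG: "G z * (?ind z * \<psi> n (fst z)) = ?ind z * (G z * \<psi> n (fst z))" for z by simp
      have iv: "integrable (lebesgue_on ?I) (\<lambda>x. v t x * \<psi> n x)" if "integrable (lebesgue_on ?I) (v t)" for t
        by (rule integrable_bounded_mult[OF that \<psi>l, where B=1]) (use \<psi>1 in auto)
      have "?T1 n = (\<integral>x. v \<tau> x * \<psi> n x \<partial>lebesgue_on ?I) - (\<integral>x. v s x * \<psi> n x \<partial>lebesgue_on ?I)"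
        using iv vint by (simp add: left_diff_distrib)
      also have "\<dots> = - (\<integral>z. ?ind z * (flux z * deriv (\<psi> n) (fst z) + G z * \<psi> n (fst z)) \<partial>lborel)"
        using weak_form_between_times[OF \<psi> s, of n] by linarith
      also have "(\<integral>z. ?ind z * (flux z * deriv (\<psi> n) (fst z) + G z * \<psi> n (fst z)) \<partial>lborel) =
          (\<integral>z. ?ind z * flux z * deriv (\<psi> n) (fst z) + ?ind z * (G z * \<psi> n (fst z)) \<partial>lborel)"
        by (simp add: distrib_left mult.assoc)
      also have "\<dots> = (\<integral>z. ?ind z * flux z * deriv (\<psi> n) (fst z) \<partial>lborel) + ?T2 n"
        using iF iG unfolding eG by (rule Bochner_Integration.integral_add)
      finally have "?T1 n + ?T2 n = (\<integral>z. - (?ind z * flux z * deriv (\<psi> n) (fst z)) \<partial>lborel)" by simp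
      also have "\<dots> \<le> (\<integral>z. ?ind z * \<bar>signed_energy z - signed_energy (fst z, \<tau>)\<bar> + \<delta> * (?ind z * \<bar>U z\<bar> powr p)
          + \<delta> powr (1 - p) * (?ind z * \<bar>U (fst z, \<tau>) - deriv (\<phi> n) (fst z)\<bar> powr p) \<partial>lborel)"
      proof (rule Bochner_Integration.integral_mono)
        show "integrable lborel (\<lambda>z. - (?ind z * flux z * deriv (\<psi> n) (fst z)))" using iF by simp
        show "integrable lborel (\<lambda>z. ?ind z * \<bar>signed_energy z - signed_energy (fst z, \<tau>)\<bar> + \<delta> * (?ind z * \<bar>U z\<bar> powr p)
          + \<delta> powr (1 - p) * (?ind z * \<bar>U (fst z, \<tau>) - deriv (\<phi> n) (fst z)\<bar> powr p))"
          by (intro Bochner_Integration.integrable_add integrable_mult_right iW iM iE(1))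
        fix z :: "real \<times> real"
        have "- (flux z * (flat' (\<phi> n (fst z) - y) * deriv (\<phi> n) (fst z))) \<le>
            \<bar>signed_energy z - signed_energy (fst z, \<tau>)\<bar> + \<delta> * \<bar>U z\<bar> powr p
              + \<delta> powr (1 - p) * \<bar>deriv (\<phi> n) (fst z) - U (fst z, \<tau>)\<bar> powr p"
          by (rule flux_inequality[OF p_gt flat'_nonneg flat'_le_1 \<delta>])
        then show "- (?ind z * flux z * deriv (\<psi> n) (fst z)) \<le> ?ind z * \<bar>signed_energy z - signed_energy (fst z, \<tau>)\<bar> + \<delta> * (?ind z * \<bar>U z\<bar> powr p)
          + \<delta> powr (1 - p) * (?ind z * \<bar>U (fst z, \<tau>) - deriv (\<phi> n) (fst z)\<bar> powr p)"
          by (cases "snd z \<in> {s<..<\<tau>}") (simp_all add: d\<psi> abs_minus_commute)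
      qed
      also have "\<dots> = ?R + \<delta> * ?M + \<delta> powr (1 - p) * ((\<tau> - s) * ?E n)"
        unfolding iE(2)[symmetric] using iW iM iE(1)[of n] by simp
      finally show ?thesis .
    qed
    let ?L = "(\<integral>x. (v \<tau> x - v s x) * flat (v \<tau> x - y) \<partial>lebesgue_on ?I)
      + (\<integral>z. ?ind z * (G z * flat (V (fst z, \<tau>) - y)) \<partial>lborel)"
    \<comment> \<open>\<open>n\<close> tends to infinity for fixed \<open>\<delta>\<close>, as the factor \<open>\<delta> powr (1 - p)\<close> blows up\<close>
    have \<delta>bound: "?L \<le> ?R + \<delta> * ?M" if "0 < \<delta>" for \<delta>
    proof (rule LIMSEQ_le[OF tendsto_add[OF T1 T2]])
      have "(\<lambda>n. ?R + \<delta> * ?M + \<delta> powr (1 - p) * ((\<tau> - s) * ?E n)) \<longlonglongrightarrow> ?R + \<delta> * ?M + \<delta> powr (1 - p) * ((\<tau> - s) * 0)"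
        by (intro tendsto_intros limU)
      then show "(\<lambda>n. ?R + \<delta> * ?M + \<delta> powr (1 - p) * ((\<tau> - s) * ?E n)) \<longlonglongrightarrow> ?R + \<delta> * ?M" by simp
      show "\<exists>N. \<forall>n\<ge>N. ?T1 n + ?T2 n \<le> ?R + \<delta> * ?M + \<delta> powr (1 - p) * ((\<tau> - s) * ?E n)"
        using step[OF that] by blast
    qed
    have "((\<lambda>\<delta>. ?R + \<delta> * ?M) \<longlongrightarrow> ?R + 0 * ?M) (at_right 0)" by (intro tendsto_intros)
    then have "?L \<le> ?R + 0 * ?M"
      by (rule tendsto_lowerbound) (use \<delta>bound in \<open>auto simp: eventually_at_filter\<close>)
    then show "?L \<le> ?R" by simp
  qed
qed

end

section \<open>Comparison with barriers that are linear in time\<close>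

lemma ennreal_integral_le_nn_integral: "ennreal (integral\<^sup>L M g) \<le> (\<integral>\<^sup>+x. ennreal (g x) \<partial>M)"
proof (cases "integrable M g")
  case True
  have "integral\<^sup>L M g \<le> (\<integral>x. max 0 (g x) \<partial>M)"
    using True by (intro integral_mono integrable_max) auto
  then have "ennreal (integral\<^sup>L M g) \<le> ennreal (\<integral>x. max 0 (g x) \<partial>M)" by (rule ennreal_leI)
  also have "\<dots> = (\<integral>\<^sup>+x. ennreal (max 0 (g x)) \<partial>M)"
    using True by (intro nn_integral_eq_integral[symmetric] integrable_max) auto
  also have "\<dots> = (\<integral>\<^sup>+x. ennreal (g x) \<partial>M)" by (simp add: ennreal_max_0)
  finally show ?thesis .
qed (simp add: not_integrable_integral_eq)

text \<open>With a primitive \<open>P\<close> of \<open>K\<close>, the averaged increment is a difference of two difference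
  quotients of \<open>P\<close>, at \<open>b\<close> and at \<open>a\<close>. They tend to \<open>K b\<close> and \<open>K a\<close>.\<close>
lemma nonincreasing_if_averaged_increments_small:
  fixes K :: "real \<Rightarrow> real"
  assumes ab: "a < b" and K: "continuous_on {a..b} K"
    and small: "\<And>\<epsilon>. 0 < \<epsilon> \<Longrightarrow> \<exists>\<delta>>0. \<forall>h. 0 < h \<longrightarrow> h < \<delta> \<longrightarrow>
      (\<integral>\<tau>. indicator {a + h..b} \<tau> * (K \<tau> - K (\<tau> - h)) \<partial>lborel) \<le> h * \<epsilon>"
  shows "K b \<le> K a"
proof -
  \<comment> \<open>extended to the line by constants, so that the primitive is differentiable at the endpoints too\<close>
  define K' where "K' x = K (max a (min b x))" for x
  have K': "continuous_on S K'" for S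
    unfolding K'_def using ab by (intro continuous_on_compose2[OF K] continuous_intros) auto
  have K'_eq: "K' x = K x" if "x \<in> {a..b}" for x using that by (simp add: K'_def)
  define P where "P x = integral {a - 1..x} K'" for x
  have P: "(P has_real_derivative K' x) (at x)" if "a - 1 < x" for x
  proof -
    have "(P has_real_derivative K' x) (at x within {a - 1..x + 1})"
      unfolding P_def by (rule integral_has_real_derivative[OF K']) (use that in auto)
    then show ?thesis using that at_within_interior[of x "{a - 1..x + 1}"] by simp
  qed
  have FTC: "(\<integral>\<tau>. indicator {a + h..b} \<tau> * (K \<tau> - K (\<tau> - h)) \<partial>lborel) = (P b - P (b - h)) - (P (a + h) - P a)"
    if h: "0 < h" "h < b - a" for h
  proof -
    have "(\<integral>\<tau>. indicator {a + h..b} \<tau> *\<^sub>R (K' \<tau> - K' (\<tau> - h)) \<partial>lborel) = (P b - P (b - h)) - (P (a + h) - P (a + h - h))"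
    proof (rule integral_FTC_atLeastAtMost)
      fix x assume x: "a + h \<le> x" "x \<le> b"
      have "((\<lambda>x. P (x - h)) has_real_derivative K' (x - h)) (at x)"
        using DERIV_shift[of P "K' (x - h)" x "- h"] P[of "x - h"] x by simp
      then have "((\<lambda>x. P x - P (x - h)) has_real_derivative K' x - K' (x - h)) (at x)"
        using P[of x] x h by (intro DERIV_diff) auto
      then show "((\<lambda>x. P x - P (x - h)) has_vector_derivative K' x - K' (x - h)) (at x within {a + h..b})"
        by (simp add: has_real_derivative_iff_has_vector_derivative has_vector_derivative_at_within)
    next
      show "continuous_on {a + h..b} (\<lambda>x. K' x - K' (x - h))"
        by (intro continuous_intros K' continuous_on_compose2[OF K'[of UNIV]]) auto
    qed (use h in auto)
    moreover have "indicator {a + h..b} \<tau> *\<^sub>R (K' \<tau> - K' (\<tau> - h)) = indicator {a + h..b} \<tau> * (K \<tau> - K (\<tau> - h))" for \<tau>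
      using h by (cases "\<tau> \<in> {a + h..b}") (auto simp: K'_eq)
    ultimately show ?thesis by (simp only: add_diff_cancel_right')
  qed
  have Pb: "((\<lambda>h. (P b - P (b - h)) / h) \<longlongrightarrow> K b) (at_right 0)"
  proof -
    have "((\<lambda>h. (P (b + h) - P b) / h) \<longlongrightarrow> K b) (at 0)"
      using P[of b] ab K'_eq[of b] by (simp add: DERIV_def)
    then have "((\<lambda>h. (P (b + h) - P b) / h) \<longlongrightarrow> K b) (at_left 0)"
      by (rule filterlim_mono) (auto simp: at_le)
    then have "((\<lambda>h. (P (b + - h) - P b) / - h) \<longlongrightarrow> K b) (at_right 0)"
      unfolding filterlim_at_left_to_right by simp
    moreover have "(P (b + - h) - P b) / - h = (P b - P (b - h)) / h" for h by (simp add: minus_divide_left)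
    ultimately show ?thesis by simp
  qed
  have Pa: "((\<lambda>h. (P (a + h) - P a) / h) \<longlongrightarrow> K a) (at_right 0)"
  proof -
    have "((\<lambda>h. (P (a + h) - P a) / h) \<longlongrightarrow> K a) (at 0)"
      using P[of a] ab K'_eq[of a] by (simp add: DERIV_def)
    then show ?thesis by (rule filterlim_mono) (auto simp: at_le)
  qed
  have bound: "K b - K a \<le> \<epsilon>" if \<epsilon>: "0 < \<epsilon>" for \<epsilon>
  proof (rule tendsto_upperbound[OF tendsto_diff[OF Pb Pa]])
    obtain \<delta> where \<delta>: "\<delta> > 0" "\<forall>h. 0 < h \<longrightarrow> h < \<delta> \<longrightarrow>
      (\<integral>\<tau>. indicator {a + h..b} \<tau> * (K \<tau> - K (\<tau> - h)) \<partial>lborel) \<le> h * \<epsilon>"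
      using small[OF \<epsilon>] by (elim exE conjE)
    show "\<forall>\<^sub>F h in at_right 0. (P b - P (b - h)) / h - (P (a + h) - P a) / h \<le> \<epsilon>"
      unfolding eventually_at_right_field
    proof (intro exI[of _ "min \<delta> (b - a)"] conjI allI impI)
      show "0 < min \<delta> (b - a)" using \<delta> ab by simp
      fix h assume h: "0 < h" "h < min \<delta> (b - a)"
      then have "(P b - P (b - h)) - (P (a + h) - P a) \<le> h * \<epsilon>"
        using FTC[of h] \<delta>(2) by (metis min_less_iff_conj)
      then show "(P b - P (b - h)) / h - (P (a + h) - P a) / h \<le> \<epsilon>"
        using h by (simp add: diff_divide_distrib[symmetric] divide_le_eq mult.commute)
    qed
  qed simp
  show ?thesis
  proof (rule field_le_epsilon)
    fix e :: real assume "0 < e"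
    from bound[OF this] show "K b \<le> K a + e" by linarith
  qed
qed

text \<open>Exchanging the integrals over \<open>\<tau>\<close> and \<open>r\<close> leaves, for each shift \<open>r < h\<close>, the \<open>L\<^sup>1\<close> distance
  between \<open>f\<close> and its translate in time, which is at most \<open>\<epsilon>\<close>.\<close>
lemma time_translation_modulus:
  fixes f :: "real \<times> real \<Rightarrow> real"
  assumes f: "integrable lborel f" and \<epsilon>: "0 < \<epsilon>"
  shows "\<exists>\<delta>>0. \<forall>h. 0 < h \<longrightarrow> h < \<delta> \<longrightarrow>
    (\<integral>\<^sup>+\<tau>. \<integral>\<^sup>+r. \<integral>\<^sup>+x. indicator {0<..<h} r * ennreal \<bar>f (x, \<tau> - r) - f (x, \<tau>)\<bar> \<partial>lborel \<partial>lborel \<partial>lborel) \<le> ennreal (h * \<epsilon>)"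
proof -
  have [measurable]: "f \<in> borel_measurable borel" using f by auto
  obtain \<delta> where \<delta>: "\<delta> > 0" "\<forall>w. norm w < \<delta> \<longrightarrow> (\<integral>z. \<bar>f (z + w) - f z\<bar> \<partial>lborel) < \<epsilon>"
    using L1_continuity_of_translation[OF f \<epsilon>] by (elim exE conjE)
  show ?thesis
  proof (intro exI[of _ \<delta>] conjI allI impI)
    fix h :: real assume h: "0 < h" "h < \<delta>"
    let ?g = "\<lambda>\<tau> r. \<integral>\<^sup>+x. indicator {0<..<h} r * ennreal \<bar>f (x, \<tau> - r) - f (x, \<tau>)\<bar> \<partial>lborel"
    have inner: "(\<integral>\<^sup>+\<tau>. ?g \<tau> r \<partial>lborel) \<le> indicator {0<..<h} r * ennreal \<epsilon>" for r
    proof (cases "r \<in> {0<..<h}")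
      case True
      define w :: "real \<times> real" where "w = (0, - r)"
      have nw: "norm w < \<delta>" using True h by (simp add: w_def norm_Pair)
      have "integrable lborel (\<lambda>z. \<bar>f (z + w) - f z\<bar>)"
        using f by (intro integrable_abs Bochner_Integration.integrable_diff) (simp_all add: lborel_integrable_shift)
      then have "(\<integral>\<^sup>+z. ennreal \<bar>f (z + w) - f z\<bar> \<partial>lborel) = ennreal (\<integral>z. \<bar>f (z + w) - f z\<bar> \<partial>lborel)"
        by (intro nn_integral_eq_integral) auto
      also have "\<dots> \<le> ennreal \<epsilon>" by (intro ennreal_leI less_imp_le \<delta>(2)[rule_format] nw)
      finally have le: "(\<integral>\<^sup>+z. ennreal \<bar>f (z + w) - f z\<bar> \<partial>lborel) \<le> ennreal \<epsilon>" .
      have "(\<lambda>z. ennreal \<bar>f (z + w) - f z\<bar>) \<in> borel_measurable borel" by measurable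
      then have "(\<integral>\<^sup>+\<tau>. \<integral>\<^sup>+x. ennreal \<bar>f ((x, \<tau>) + w) - f (x, \<tau>)\<bar> \<partial>lborel \<partial>lborel) = (\<integral>\<^sup>+z. ennreal \<bar>f (z + w) - f z\<bar> \<partial>lborel)"
        using lborel_pair.nn_integral_snd[of "\<lambda>z. ennreal \<bar>f (z + w) - f z\<bar>"] by (simp add: lborel_prod)
      then show ?thesis using le True by (simp add: w_def)
    qed simp
    have "(\<integral>\<^sup>+\<tau>. \<integral>\<^sup>+r. ?g \<tau> r \<partial>lborel \<partial>lborel) = (\<integral>\<^sup>+r. \<integral>\<^sup>+\<tau>. ?g \<tau> r \<partial>lborel \<partial>lborel)"
    proof (rule lborel_pair.Fubini'[symmetric])
      show "(\<lambda>(\<tau>, r). ?g \<tau> r) \<in> borel_measurable (lborel \<Otimes>\<^sub>M lborel)"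
        unfolding case_prod_unfold by measurable
    qed
    also have "\<dots> \<le> (\<integral>\<^sup>+r. indicator {0<..<h} r * ennreal \<epsilon> \<partial>lborel)"
      by (intro nn_integral_mono inner)
    also have "\<dots> = ennreal h * ennreal \<epsilon>"
      using h by (simp add: nn_integral_multc)
    also have "\<dots> = ennreal (h * \<epsilon>)" using h \<epsilon> by (simp add: ennreal_mult)
    finally show "(\<integral>\<^sup>+\<tau>. \<integral>\<^sup>+r. ?g \<tau> r \<partial>lborel \<partial>lborel) \<le> ennreal (h * \<epsilon>)" .
  qed (rule \<delta>(1))
qed

text \<open>The substitution \<open>\<sigma> = \<tau> - r\<close>. Functions of the equation are integrable only on slabs away from
  \<open>t = 0\<close>, so \<open>f\<close> is cut off to a time interval that contains all times involved.\<close>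
lemma slab_deviation_le:
  fixes f :: "real \<times> real \<Rightarrow> real"
  assumes [measurable]: "f \<in> borel_measurable borel" and h: "\<alpha> \<le> \<tau> - h" "\<tau> \<le> \<beta>" "0 < h"
  defines "ft \<equiv> \<lambda>z. indicator {\<alpha>..\<beta>} (snd z) * f z"
  shows "ennreal (\<integral>z. indicator {\<tau> - h<..<\<tau>} (snd z) * \<bar>f z - f (fst z, \<tau>)\<bar> \<partial>lborel)
    \<le> (\<integral>\<^sup>+r. \<integral>\<^sup>+x. indicator {0<..<h} r * ennreal \<bar>ft (x, \<tau> - r) - ft (x, \<tau>)\<bar> \<partial>lborel \<partial>lborel)"
proof -
  let ?k = "\<lambda>z. indicator {\<tau> - h<..<\<tau>} (snd z) * \<bar>f z - f (fst z, \<tau>)\<bar> :: real"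
  have "ennreal (integral\<^sup>L lborel ?k) \<le> (\<integral>\<^sup>+z. ennreal (?k z) \<partial>lborel)"
    by (rule ennreal_integral_le_nn_integral)
  also have "\<dots> = (\<integral>\<^sup>+\<sigma>. \<integral>\<^sup>+x. ennreal (?k (x, \<sigma>)) \<partial>lborel \<partial>lborel)"
  proof -
    have "(\<lambda>z. ennreal (?k z)) \<in> borel_measurable borel" by measurable
    then show ?thesis using lborel_pair.nn_integral_snd[of "\<lambda>z. ennreal (?k z)"] by (simp add: lborel_prod)
  qed
  also have "\<dots> = (\<integral>\<^sup>+r. \<integral>\<^sup>+x. ennreal (?k (x, \<tau> + (-1) * r)) \<partial>lborel \<partial>lborel)"
    by (subst nn_integral_real_affine[where c="-1" and t=\<tau>]) simp_all
  also have "\<dots> = (\<integral>\<^sup>+r. \<integral>\<^sup>+x. indicator {0<..<h} r * ennreal \<bar>ft (x, \<tau> - r) - ft (x, \<tau>)\<bar> \<partial>lborel \<partial>lborel)"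
  proof (intro nn_integral_cong)
    fix r x :: real
    show "ennreal (?k (x, \<tau> + (-1) * r)) = indicator {0<..<h} r * ennreal \<bar>ft (x, \<tau> - r) - ft (x, \<tau>)\<bar>"
      using h by (cases "r \<in> {0<..<h}") (auto simp: ft_def)
  qed
  finally show ?thesis .
qed

context energy_solution
begin

text \<open>The convex functional that the comparison follows. At a time \<open>t \<ge> 0\<close> it
  vanishes exactly if the profile lies below the barrier almost everywhere.\<close>
definition excess :: "(real \<Rightarrow> real) \<Rightarrow> real \<Rightarrow> real" where
  "excess y t = (\<integral>x. flat_int (v t x - y t) \<partial>lebesgue_on {-l<..<l})"

lemma flat_int_integrable:
  assumes "0 \<le> t"
  shows "integrable (lebesgue_on {-l<..<l}) (\<lambda>x. flat_int (v t x - c))"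
proof (rule Bochner_Integration.integrable_bound)
  show i: "integrable (lebesgue_on {-l<..<l}) (\<lambda>x. v t x - c)"
    using v_integrable[OF assms] by (intro Bochner_Integration.integrable_diff integrable_const_interval)
  show "(\<lambda>x. flat_int (v t x - c)) \<in> borel_measurable (lebesgue_on {-l<..<l})"
    using i by (intro measurable_compose[OF _ flat_int_borel]) auto
  show "AE x in lebesgue_on {-l<..<l}. norm (flat_int (v t x - c)) \<le> norm (v t x - c)"
    using flat_int_diff_le[of "v t x - c" 0 for x] by (intro AE_I2) (simp add: flat_int_nonpos)
qed

lemma excess_continuous:
  assumes y: "continuous_on {0..} y"
  shows "continuous_on {0..} (excess y)"
  unfolding excess_def[abs_def]
proof (rule integral_continuous_in_time[where B=1, OF _ _ y])
  show "\<bar>flat_int (v s x - y s) - flat_int (v t x - y t)\<bar> \<le> 1 * \<bar>v s x - v t x\<bar> + \<bar>y s - y t\<bar>" for s t x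
    using flat_int_diff_le[of "v s x - y s" "v t x - y t"] by simp
qed (rule flat_int_integrable)

text \<open>Convexity bounds the increment of \<open>flat_int (v - y)\<close> by \<open>flat (v \<tau> - y \<tau>)\<close> times the increment
  of \<open>v - y\<close>, and the energy inequality bounds the part that stems from \<open>v\<close>. The slope \<open>c\<close> of the
  barrier is paid for by the absorption, which is at least \<open>c\<close> wherever \<open>V > 0\<close>. Where
  \<open>V z = 0\<close> only \<open>0 \<le> G z\<close> is known, but there \<open>flat (V (x, \<tau>) - y \<tau>)\<close> is at most the change of
  \<open>V\<close> between the two times, since \<open>flat\<close> is Lipschitz and the barrier is nonnegative.\<close>
lemma excess_increment_le:
  assumes c: "0 \<le> c" and lower: "AE z in lborel. 0 \<le> V z \<and> 0 \<le> G z \<and> (0 < V z \<longrightarrow> c \<le> G z)"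
  shows "AE \<tau> in lborel. \<forall>s. 0 < s \<longrightarrow> s < \<tau> \<longrightarrow> 0 \<le> M - c * (\<tau> - a) \<longrightarrow>
    excess (\<lambda>t. M - c * (t - a)) \<tau> - excess (\<lambda>t. M - c * (t - a)) s \<le>
      (\<integral>z. indicator {s<..<\<tau>} (snd z) * \<bar>signed_energy z - signed_energy (fst z, \<tau>)\<bar> \<partial>lborel)
      + c * (\<integral>z. indicator {s<..<\<tau>} (snd z) * \<bar>V z - V (fst z, \<tau>)\<bar> \<partial>lborel)"
  using slice energy_inequality
proof eventually_elim
  case (elim \<tau>)
  let ?I = "{-l<..<l}"
  show ?case
  proof (intro allI impI)
    fix s assume s: "0 < s" "s < \<tau>" and y0: "0 \<le> M - c * (\<tau> - a)"
    define y where "y t = M - c * (t - a)" for t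
    have y: "0 \<le> y \<tau>" using y0 by (simp add: y_def)
    have sl: "AE x in lborel. x \<in> ?I \<longrightarrow> v \<tau> x = V (x, \<tau>)" using elim(1) s by auto
    let ?ind = "\<lambda>z::real \<times> real. indicator {s<..<\<tau>} (snd z) :: real"
    let ?Rw = "\<integral>z. ?ind z * \<bar>signed_energy z - signed_energy (fst z, \<tau>)\<bar> \<partial>lborel"
    let ?Rv = "\<integral>z. ?ind z * \<bar>V z - V (fst z, \<tau>)\<bar> \<partial>lborel"
    let ?T2 = "\<integral>z. ?ind z * (G z * flat (V (fst z, \<tau>) - y \<tau>)) \<partial>lborel"
    let ?q = "\<lambda>x. flat (V (x, \<tau>) - y \<tau>)"
    have I: "(\<integral>x. (v \<tau> x - v s x) * flat (v \<tau> x - y \<tau>) \<partial>lebesgue_on ?I) + ?T2 \<le> ?Rw"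
      using elim(2) s y by blast
    have V0: "V (x, \<tau>) = 0" if "x \<notin> ?I" for x using outside(1)[of "(x, \<tau>)"] that by auto
    have q0: "?q x = 0" if "x \<notin> ?I" for x using V0[OF that] y by (simp add: flat_eq_0_iff)
    have qb [measurable]: "?q \<in> borel_measurable borel" by measurable
    have qi: "integrable lborel ?q"
      by (rule integrable_bounded_on_compact[where K="{-l..l}" and B=1]) (use q0 in \<open>auto simp: flat_nonneg flat_le_1\<close>)
    have Vi: "integrable lborel (\<lambda>x. V (x, \<tau>))"
    proof -
      have "integrable lborel (\<lambda>x. indicator ?I x * V (x, \<tau>))"
        using v_integrable[of \<tau>] s integrable_lebesgue_on_borel[OF _ _ sl] by auto
      moreover have "indicator ?I x * V (x, \<tau>) = V (x, \<tau>)" for x using V0[of x] by (cases "x \<in> ?I") auto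
      ultimately show ?thesis by (simp only:)
    qed
    have qI: "(\<integral>x. flat (v \<tau> x - y \<tau>) \<partial>lebesgue_on ?I) = (\<integral>x. ?q x \<partial>lborel)"
    proof -
      have "AE x in lborel. x \<in> ?I \<longrightarrow> flat (v \<tau> x - y \<tau>) = ?q x" using sl by (rule eventually_mono) auto
      then have "(\<integral>x. flat (v \<tau> x - y \<tau>) \<partial>lebesgue_on ?I) = (\<integral>x. indicator ?I x * ?q x \<partial>lborel)"
        by (intro integral_lebesgue_on_borel) auto
      moreover have "indicator ?I x * ?q x = ?q x" for x using q0[of x] by (cases "x \<in> ?I") auto
      ultimately show ?thesis by (simp only:)
    qed
    have iq: "integrable lborel (\<lambda>z. ?ind z * ?q (fst z))" "(\<integral>z. ?ind z * ?q (fst z) \<partial>lborel) = (\<tau> - s) * (\<integral>x. ?q x \<partial>lborel)"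
      using lborel_product[OF qi integral_indicator_Ioo(2)[of s \<tau>]] integral_indicator_Ioo(1)[of s \<tau>] s by simp_all
    have iG: "integrable lborel (\<lambda>z. ?ind z * (G z * ?q (fst z)))"
    proof -
      have "integrable lborel (\<lambda>z. G z * (?ind z * ?q (fst z)))"
        by (rule integrable_bounded_mult[OF G_integrable, where B=1]) (auto simp: flat_nonneg flat_le_1 indicator_def)
      then show ?thesis by (simp only: mult.left_commute)
    qed
    have iV: "integrable lborel (\<lambda>z. ?ind z * \<bar>V z - V (fst z, \<tau>)\<bar>)"
      by (rule slab_deviation_integrable[OF V_borel V_integrable[OF s(1)] Vi])
    have II: "c * ((\<tau> - s) * (\<integral>x. ?q x \<partial>lborel)) - ?T2 \<le> c * ?Rv"
    proof -
      have "c * ((\<tau> - s) * (\<integral>x. ?q x \<partial>lborel)) - ?T2 = (\<integral>z. c * (?ind z * ?q (fst z)) - ?ind z * (G z * ?q (fst z)) \<partial>lborel)"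
        unfolding iq(2)[symmetric] using iq(1) iG by simp
      also have "\<dots> \<le> (\<integral>z. c * (?ind z * \<bar>V z - V (fst z, \<tau>)\<bar>) \<partial>lborel)"
      proof (rule integral_mono_AE)
        show "AE z in lborel. c * (?ind z * ?q (fst z)) - ?ind z * (G z * ?q (fst z)) \<le> c * (?ind z * \<bar>V z - V (fst z, \<tau>)\<bar>)"
          using lower
        proof eventually_elim
          case (elim z)
          have "c * ?q (fst z) - G z * ?q (fst z) \<le> c * \<bar>V z - V (fst z, \<tau>)\<bar>"
          proof (cases "0 < V z")
            case True
            then have "c * ?q (fst z) \<le> G z * ?q (fst z)" using elim by (intro mult_right_mono) (auto simp: flat_nonneg)
            then show ?thesis using c by (smt (verit) mult_nonneg_nonneg abs_ge_zero)
          next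
            case False
            then have Vz: "V z = 0" using elim by simp
            have "?q (fst z) \<le> \<bar>V (fst z, \<tau>)\<bar>"
              using flat_diff_le[of "V (fst z, \<tau>) - y \<tau>" "0 - y \<tau>"] y by (simp add: flat_def split: if_splits)
            then have "c * ?q (fst z) \<le> c * \<bar>V z - V (fst z, \<tau>)\<bar>" using c Vz by (simp add: mult_left_mono)
            moreover have "0 \<le> G z * ?q (fst z)" using elim by (simp add: flat_nonneg)
            ultimately show ?thesis by linarith
          qed
          then show ?case by (cases "snd z \<in> {s<..<\<tau>}") simp_all
        qed
      qed (use iq(1) iG iV in auto)
      also have "\<dots> = c * ?Rv" by simp
      finally show ?thesis .
    qed
    have iv: "integrable (lebesgue_on ?I) (v \<tau>)" "integrable (lebesgue_on ?I) (v s)" using v_integrable s by auto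
    have fm: "(\<lambda>x. flat (v \<tau> x - y \<tau>)) \<in> borel_measurable (lebesgue_on ?I)"
      using iv by (intro measurable_compose[OF _ flat_borel]) auto
    have ig: "integrable (lebesgue_on ?I) (\<lambda>x. (v \<tau> x - v s x) * flat (v \<tau> x - y \<tau>))"
      by (rule integrable_bounded_mult[OF _ fm, where B=1]) (use iv in \<open>auto simp: flat_nonneg flat_le_1\<close>)
    have ih: "integrable (lebesgue_on ?I) (\<lambda>x. c * (\<tau> - s) * flat (v \<tau> x - y \<tau>))"
      by (rule integrable_bounded_mult[OF _ fm, where B=1]) (auto simp: flat_nonneg flat_le_1)
    have iJ: "integrable (lebesgue_on ?I) (\<lambda>x. flat_int (v \<tau> x - y \<tau>))" "integrable (lebesgue_on ?I) (\<lambda>x. flat_int (v s x - y s))"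
      using s by (auto intro!: flat_int_integrable)
    have "excess y \<tau> - excess y s = (\<integral>x. flat_int (v \<tau> x - y \<tau>) - flat_int (v s x - y s) \<partial>lebesgue_on ?I)"
      unfolding excess_def using iJ by simp
    also have "\<dots> \<le> (\<integral>x. (v \<tau> x - v s x) * flat (v \<tau> x - y \<tau>) + c * (\<tau> - s) * flat (v \<tau> x - y \<tau>) \<partial>lebesgue_on ?I)"
    proof (rule integral_mono)
      fix x
      have "(v \<tau> x - y \<tau>) - (v s x - y s) = (v \<tau> x - v s x) + c * (\<tau> - s)" by (simp add: y_def algebra_simps)
      then have "flat_int (v \<tau> x - y \<tau>) - flat_int (v s x - y s) \<le>
          flat (v \<tau> x - y \<tau>) * ((v \<tau> x - v s x) + c * (\<tau> - s))"
        using flat_int_convex[of "v \<tau> x - y \<tau>" "v s x - y s"] by (simp only:)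
      also have "\<dots> = (v \<tau> x - v s x) * flat (v \<tau> x - y \<tau>) + c * (\<tau> - s) * flat (v \<tau> x - y \<tau>)"
        by (simp add: distrib_left mult.commute)
      finally show "flat_int (v \<tau> x - y \<tau>) - flat_int (v s x - y s) \<le>
          (v \<tau> x - v s x) * flat (v \<tau> x - y \<tau>) + c * (\<tau> - s) * flat (v \<tau> x - y \<tau>)" .
    qed (use iJ ig ih in auto)
    also have "\<dots> = (\<integral>x. (v \<tau> x - v s x) * flat (v \<tau> x - y \<tau>) \<partial>lebesgue_on ?I) + c * ((\<tau> - s) * (\<integral>x. ?q x \<partial>lborel))"
      using ig ih qI by simp
    also have "\<dots> \<le> ?Rw + c * ?Rv" using I II by linarith
    finally show "excess (\<lambda>t. M - c * (t - a)) \<tau> - excess (\<lambda>t. M - c * (t - a)) s \<le> ?Rw + c * ?Rv"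
      unfolding y_def .
  qed
qed

lemma excess_nonincreasing:
  assumes c: "0 \<le> c" and lower: "AE z in lborel. 0 \<le> V z \<and> 0 \<le> G z \<and> (0 < V z \<longrightarrow> c \<le> G z)"
    and \<alpha>: "0 < \<alpha>" "\<alpha> < \<beta>" and y0: "0 \<le> M - c * (\<beta> - a)"
  shows "excess (\<lambda>t. M - c * (t - a)) \<beta> \<le> excess (\<lambda>t. M - c * (t - a)) \<alpha>"
proof (rule nonincreasing_if_averaged_increments_small[OF \<alpha>(2)])
  let ?K = "excess (\<lambda>t. M - c * (t - a))"
  have Kc0: "continuous_on {0..} ?K" by (intro excess_continuous continuous_intros)
  then show Kc: "continuous_on {\<alpha>..\<beta>} ?K" by (rule continuous_on_subset) (use \<alpha> in auto)
  fix \<epsilon> :: real assume \<epsilon>: "0 < \<epsilon>"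
  \<comment> \<open>the moduli of the gradient and of \<open>V\<close> enter with weights \<open>1\<close> and \<open>c\<close>\<close>
  define \<epsilon>' where "\<epsilon>' = \<epsilon> / (1 + c)"
  have \<epsilon>': "0 < \<epsilon>'" "\<epsilon>' * (1 + c) = \<epsilon>" using \<epsilon> c by (auto simp: \<epsilon>'_def)
  define Wt where "Wt z = indicator {\<alpha>..\<beta>} (snd z) * signed_energy z" for z
  define Vt where "Vt z = indicator {\<alpha>..\<beta>} (snd z) * V z" for z
  have Wtb [measurable]: "Wt \<in> borel_measurable borel" and Vtb [measurable]: "Vt \<in> borel_measurable borel"
    unfolding Wt_def[abs_def] Vt_def[abs_def] by measurable
  have iW: "integrable lborel Wt" unfolding Wt_def[abs_def] by (rule signed_energy_integrable[OF \<alpha>(1)])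
  have iV: "integrable lborel Vt" unfolding Vt_def[abs_def] by (rule V_integrable[OF \<alpha>(1)])
  let ?N = "\<lambda>f h \<tau>. \<integral>\<^sup>+r. \<integral>\<^sup>+x. indicator {0<..<h} r * ennreal \<bar>f (x, \<tau> - r) - f (x, \<tau>)\<bar> \<partial>lborel \<partial>lborel"
  obtain \<delta>w where \<delta>w: "\<delta>w > 0" "\<forall>h. 0 < h \<longrightarrow> h < \<delta>w \<longrightarrow> (\<integral>\<^sup>+\<tau>. ?N Wt h \<tau> \<partial>lborel) \<le> ennreal (h * \<epsilon>')"
    using time_translation_modulus[OF iW \<epsilon>'(1)] by (elim exE conjE)
  obtain \<delta>v where \<delta>v: "\<delta>v > 0" "\<forall>h. 0 < h \<longrightarrow> h < \<delta>v \<longrightarrow> (\<integral>\<^sup>+\<tau>. ?N Vt h \<tau> \<partial>lborel) \<le> ennreal (h * \<epsilon>')"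
    using time_translation_modulus[OF iV \<epsilon>'(1)] by (elim exE conjE)
  show "\<exists>\<delta>>0. \<forall>h. 0 < h \<longrightarrow> h < \<delta> \<longrightarrow>
      (\<integral>\<tau>. indicator {\<alpha> + h..\<beta>} \<tau> * (?K \<tau> - ?K (\<tau> - h)) \<partial>lborel) \<le> h * \<epsilon>"
  proof (intro exI[of _ "min \<delta>w \<delta>v"] conjI allI impI)
    show "0 < min \<delta>w \<delta>v" using \<delta>w \<delta>v by simp
    fix h assume h: "0 < h" "h < min \<delta>w \<delta>v"
    have bound: "AE \<tau> in lborel. ennreal (indicator {\<alpha> + h..\<beta>} \<tau> * (?K \<tau> - ?K (\<tau> - h))) \<le> ?N Wt h \<tau> + ennreal c * ?N Vt h \<tau>"
      using excess_increment_le[OF c lower, of M a]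
    proof eventually_elim
      case (elim \<tau>)
      show ?case
      proof (cases "\<tau> \<in> {\<alpha> + h..\<beta>}")
        case True
        let ?Rw = "\<integral>z. indicator {\<tau> - h<..<\<tau>} (snd z) * \<bar>signed_energy z - signed_energy (fst z, \<tau>)\<bar> \<partial>lborel"
        let ?Rv = "\<integral>z. indicator {\<tau> - h<..<\<tau>} (snd z) * \<bar>V z - V (fst z, \<tau>)\<bar> \<partial>lborel"
        have \<tau>: "\<alpha> \<le> \<tau> - h" "\<tau> \<le> \<beta>" using True by auto
        have "c * (\<tau> - a) \<le> c * (\<beta> - a)" using c \<tau> by (intro mult_left_mono) auto
        then have "0 \<le> M - c * (\<tau> - a)" using y0 by linarith
        then have "?K \<tau> - ?K (\<tau> - h) \<le> ?Rw + c * ?Rv"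
          using elim[rule_format, of "\<tau> - h"] \<tau> \<alpha> h by simp
        then have "ennreal (?K \<tau> - ?K (\<tau> - h)) \<le> ennreal (?Rw + c * ?Rv)" by (rule ennreal_leI)
        also have "\<dots> = ennreal ?Rw + ennreal c * ennreal ?Rv"
        proof -
          have "0 \<le> ?Rw" "0 \<le> ?Rv" by (intro Bochner_Integration.integral_nonneg; simp)+
          then show ?thesis using c by (simp add: ennreal_mult)
        qed
        also have "\<dots> \<le> ?N Wt h \<tau> + ennreal c * ?N Vt h \<tau>"
        proof (intro add_mono mult_left_mono)
          have "signed_energy \<in> borel_measurable borel" by measurable
          from slab_deviation_le[OF this \<tau> h(1)] show "ennreal ?Rw \<le> ?N Wt h \<tau>"
            unfolding Wt_def .
          from slab_deviation_le[OF V_borel \<tau> h(1)] show "ennreal ?Rv \<le> ?N Vt h \<tau>"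
            unfolding Vt_def .
        qed simp
        finally show ?thesis using True by simp
      qed simp
    qed
    have Nm: "(\<lambda>\<tau>. ?N f h \<tau>) \<in> borel_measurable lborel" if [measurable]: "f \<in> borel_measurable borel" for f :: "real \<times> real \<Rightarrow> real"
      by measurable
    have "ennreal (\<integral>\<tau>. indicator {\<alpha> + h..\<beta>} \<tau> * (?K \<tau> - ?K (\<tau> - h)) \<partial>lborel)
        \<le> (\<integral>\<^sup>+\<tau>. ennreal (indicator {\<alpha> + h..\<beta>} \<tau> * (?K \<tau> - ?K (\<tau> - h))) \<partial>lborel)"
      by (rule ennreal_integral_le_nn_integral)
    also have "\<dots> \<le> (\<integral>\<^sup>+\<tau>. ?N Wt h \<tau> + ennreal c * ?N Vt h \<tau> \<partial>lborel)"
      using bound by (rule nn_integral_mono_AE)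
    also have "\<dots> = (\<integral>\<^sup>+\<tau>. ?N Wt h \<tau> \<partial>lborel) + ennreal c * (\<integral>\<^sup>+\<tau>. ?N Vt h \<tau> \<partial>lborel)"
      using Nm[OF Wtb] Nm[OF Vtb] by (simp add: nn_integral_add nn_integral_cmult)
    also have "\<dots> \<le> ennreal (h * \<epsilon>') + ennreal c * ennreal (h * \<epsilon>')"
      using \<delta>w(2) \<delta>v(2) h by (intro add_mono mult_left_mono) auto
    also have "\<dots> = ennreal (h * \<epsilon>)"
    proof -
      have "h * \<epsilon>' + c * (h * \<epsilon>') = h * \<epsilon>" unfolding \<epsilon>'(2)[symmetric] by (simp add: algebra_simps)
      then show ?thesis using c h \<epsilon>' by (simp flip: ennreal_mult ennreal_plus)
    qed
    finally show "(\<integral>\<tau>. indicator {\<alpha> + h..\<beta>} \<tau> * (?K \<tau> - ?K (\<tau> - h)) \<partial>lborel) \<le> h * \<epsilon>"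
      using h \<epsilon> by (subst (asm) ennreal_le_iff) auto
  qed
qed

text \<open>The excess vanishes at time \<open>a\<close> and is nonincreasing on intervals of positive times. Continuity
  at \<open>a\<close> includes the case \<open>a = 0\<close>, where the equation itself gives no information.\<close>
theorem comparison_with_linear_barrier:
  assumes c: "0 \<le> c" and lower: "AE z in lborel. 0 \<le> V z \<and> 0 \<le> G z \<and> (0 < V z \<longrightarrow> c \<le> G z)"
    and a: "0 \<le> a" "a \<le> t" and y0: "0 \<le> M - c * (t - a)"
    and init: "AE x in lebesgue_on {-l<..<l}. v a x \<le> M"
  shows "AE x in lebesgue_on {-l<..<l}. v t x \<le> M - c * (t - a)"
proof -
  let ?y = "\<lambda>t. M - c * (t - a)"
  have K: "continuous_on {0..} (excess ?y)" by (intro excess_continuous continuous_intros)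
  have "excess ?y a = (\<integral>x. 0 \<partial>lebesgue_on {-l<..<l})"
    unfolding excess_def
  proof (rule integral_cong_AE)
    show "(\<lambda>x. flat_int (v a x - ?y a)) \<in> borel_measurable (lebesgue_on {-l<..<l})"
      using flat_int_integrable[OF a(1)] by blast
    show "AE x in lebesgue_on {-l<..<l}. flat_int (v a x - ?y a) = 0"
      using init by (rule eventually_mono) (simp add: flat_int_nonpos)
  qed simp
  then have Ka: "excess ?y a = 0" by simp
  have "excess ?y t \<le> excess ?y a"
  proof (cases "a < t")
    case True
    have lim: "(excess ?y \<longlongrightarrow> excess ?y a) (at_right a)"
    proof -
      have "(excess ?y \<longlongrightarrow> excess ?y a) (at a within {0..})" using K a by (simp add: continuous_on_def)
      then show ?thesis by (rule tendsto_within_subset) (use a in auto)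
    qed
    show ?thesis
    proof (rule tendsto_lowerbound[OF lim])
      show "\<forall>\<^sub>F \<alpha> in at_right a. excess ?y t \<le> excess ?y \<alpha>"
        unfolding eventually_at_right_field
      proof (intro exI[of _ t] conjI allI impI)
        fix \<alpha> assume "a < \<alpha>" "\<alpha> < t"
        then show "excess ?y t \<le> excess ?y \<alpha>" using a by (intro excess_nonincreasing[OF c lower _ _ y0]) auto
      qed (use True in auto)
    qed simp
  next
    case False
    then show ?thesis using a by simp
  qed
  moreover have i: "integrable (lebesgue_on {-l<..<l}) (\<lambda>x. flat_int (v t x - ?y t))"
    using a by (intro flat_int_integrable) simp
  moreover have "0 \<le> excess ?y t" unfolding excess_def by (rule Bochner_Integration.integral_nonneg) (rule flat_int_nonneg)
  ultimately have "(\<integral>x. flat_int (v t x - ?y t) \<partial>lebesgue_on {-l<..<l}) = 0"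
    using Ka unfolding excess_def by linarith
  then have "AE x in lebesgue_on {-l<..<l}. flat_int (v t x - ?y t) = 0"
    using integral_nonneg_eq_0_iff_AE[OF i] flat_int_nonneg by simp
  then show ?thesis by (rule eventually_mono) (simp add: flat_int_eq_0_iff)
qed

text \<open>A bound on the plane speaks of almost every time only; it passes to every time because the
  integral of the negative part is continuous in time.\<close>
lemma nonneg_at_all_times:
  assumes V: "AE z in lborel. 0 \<le> V z" and t: "0 \<le> t"
  shows "AE x in lebesgue_on {-l<..<l}. 0 \<le> v t x"
proof -
  let ?L = "lebesgue_on {-l<..<l}"
  define N where "N s = (\<integral>x. max 0 (- v s x) \<partial>?L)" for s
  have iN: "integrable ?L (\<lambda>x. max 0 (- v s x))" if "0 \<le> s" for s
    using v_integrable[OF that] by (intro integrable_max) auto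
  have Nz: "AE s in lborel. 0 < s \<longrightarrow> N s = 0"
    using AE_lborel_swap[OF V] slice
  proof eventually_elim
    case (elim s)
    show ?case
    proof
      assume s: "0 < s"
      have "AE x in lborel. x \<in> {-l<..<l} \<longrightarrow> max 0 (- v s x) = 0"
        using elim(1) elim(2)[rule_format, OF s] by eventually_elim auto
      then have "AE x in ?L. max 0 (- v s x) = 0" by (subst AE_lebesgue_on_iff) auto
      then show "N s = 0" unfolding N_def by (rule integral_eq_zero_AE)
    qed
  qed
  have "continuous_on {0..} N"
    unfolding N_def by (rule integral_continuous_in_time[where B=1 and y="\<lambda>_. 0"]) (use iN in auto)
  then have "(N \<longlongrightarrow> N t) (at t within {0..})" using t by (simp add: continuous_on_def)
  then have lim: "(N \<longlongrightarrow> N t) (at_right t)" by (rule tendsto_within_subset) (use t in auto)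
  have "N t = 0"
  proof (rule ccontr)
    assume "N t \<noteq> 0"
    then have "\<forall>\<^sub>F s in at_right t. N s \<noteq> 0" by (rule tendsto_imp_eventually_ne[OF lim])
    then obtain b where b: "t < b" "\<forall>s>t. s < b \<longrightarrow> N s \<noteq> 0"
      unfolding eventually_at_right_field by (elim exE conjE)
    have "AE s in lborel. s \<notin> {t<..<b}"
      using Nz by (rule eventually_mono) (use b(2) t in auto)
    then have "{t<..<b} \<in> null_sets lborel" by (subst AE_iff_null_sets) auto
    then show False using b(1) by (simp add: null_sets_def)
  qed
  then have "AE x in ?L. max 0 (- v t x) = 0"
    using integral_nonneg_eq_0_iff_AE[OF iN[OF t]] unfolding N_def by simp
  then show ?thesis by (rule eventually_mono) (simp add: max_def split: if_splits)
qed

end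

section \<open>Extinction in finite time\<close>

lemma AE_abs_le_Linf_norm:
  assumes l: "0 < l" and u: "u \<in> Linf (lebesgue_on {-l<..<l::real})"
  shows "0 \<le> Linf_norm (lebesgue_on {-l<..<l}) u"
    and "AE x in lebesgue_on {-l<..<l}. \<bar>u x\<bar> \<le> Linf_norm (lebesgue_on {-l<..<l}) u"
proof -
  let ?L = "lebesgue_on {-l<..<l}"
  let ?e = "esssup ?L (\<lambda>z. ereal \<bar>u z\<bar>)"
  have m: "u \<in> borel_measurable ?L" and fin: "?e < \<infinity>" using u by (auto simp: Linf_def)
  have "emeasure ?L (space ?L) \<noteq> 0" using l by (simp add: emeasure_restrict_space)
  then have "esssup ?L (\<lambda>z. 0 :: ereal) = 0" by (rule esssup_const)
  moreover have "esssup ?L (\<lambda>z. 0) \<le> ?e" by (rule esssup_mono) auto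
  ultimately have ge: "0 \<le> ?e" by simp
  then obtain M where M: "?e = ereal M" using fin by (cases ?e) auto
  then have N: "Linf_norm ?L u = M" by (simp add: Linf_norm_def)
  show "0 \<le> Linf_norm ?L u" using ge M N by simp
  show "AE x in ?L. \<bar>u x\<bar> \<le> Linf_norm ?L u"
    using esssup_AE[of "\<lambda>z. ereal \<bar>u z\<bar>" ?L] by (rule eventually_mono) (simp add: M N)
qed

theorem theorem8:
  shows "\<exists>T0 :: real \<Rightarrow> real \<Rightarrow> real \<Rightarrow> real.
    \<forall>(\<beta>::real) (p::real) (l::real) (f :: real \<Rightarrow> real) (u0 :: real \<Rightarrow> real) (v :: real \<Rightarrow> real \<Rightarrow> real).
      0 < \<beta> \<longrightarrow> \<beta> < 1 \<longrightarrow> p > 2 \<longrightarrow> l > 0 \<longrightarrow>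
      f C1_differentiable_on UNIV \<longrightarrow> (\<forall>r. f r \<ge> 0) \<longrightarrow> f 0 = 0 \<longrightarrow>
      u0 \<in> Linf (lebesgue_on {-l<..<l}) \<longrightarrow> (AE x in lebesgue_on {-l<..<l}. u0 x \<ge> 0) \<longrightarrow>
      weak_solution l \<beta> p f u0 v \<longrightarrow>
      (let T = T0 \<beta> p (Linf_norm (lebesgue_on {-l<..<l}) u0) in
        T \<ge> 0 \<and> (\<forall>t\<ge>T. AE x in lebesgue_on {-l<..<l}. v t x = 0))"
proof (rule exI[of _ "\<lambda>\<beta> p M. M powr (1 + \<beta>)"], intro allI impI, unfold Let_def, intro conjI allI impI)
  fix \<beta> p l :: real and f u0 :: "real \<Rightarrow> real" and v :: "real \<Rightarrow> real \<Rightarrow> real"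
  assume \<beta>: "0 < \<beta>" "\<beta> < 1" and p: "2 < p" and l: "0 < l" and f: "f C1_differentiable_on UNIV"
    and f_nonneg: "\<forall>r. 0 \<le> f r" and f0: "f 0 = 0" and u0: "u0 \<in> Linf (lebesgue_on {-l<..<l})"
    and sol: "weak_solution l \<beta> p f u0 v"
  let ?L = "lebesgue_on {-l<..<l}"
  define M where "M = Linf_norm ?L u0"
  define T where "T = M powr (1 + \<beta>)"
  show "0 \<le> Linf_norm ?L u0 powr (1 + \<beta>)" by simp
  fix t assume "Linf_norm ?L u0 powr (1 + \<beta>) \<le> t"
  then have t: "T \<le> t" by (simp add: T_def M_def)
  have T0: "0 \<le> T" by (simp add: T_def)
  have M0: "0 \<le> M" and u0M: "AE x in ?L. \<bar>u0 x\<bar> \<le> M"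
    using AE_abs_le_Linf_norm[OF l u0] by (simp_all add: M_def)
  have fc: "continuous_on UNIV f"
    using f by (meson C1_differentiable_imp_continuous_on)
  obtain V U where E: "energy_solution l p v V U (\<lambda>z. sing_absorption \<beta> (V z) + f (V z))"
    and V_nonneg: "AE z in lborel. 0 \<le> V z"
    by (rule weak_solution_imp_energy_solution[OF l p fc f0 sol]) (rule that)
  interpret energy_solution l p v V U "\<lambda>z. sing_absorption \<beta> (V z) + f (V z)" by (rule E)
  have G_nonneg: "0 \<le> sing_absorption \<beta> r + f r" for r
    using f_nonneg by (simp add: sing_absorption_def)
  have lower0: "AE z in lborel. 0 \<le> V z \<and> 0 \<le> sing_absorption \<beta> (V z) + f (V z) \<and>
      (0 < V z \<longrightarrow> 0 \<le> sing_absorption \<beta> (V z) + f (V z))"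
    using V_nonneg by (rule eventually_mono) (simp add: G_nonneg)
  have init: "AE x in ?L. v 0 x \<le> M"
  proof -
    have "AE x in ?L. v 0 x = u0 x" using sol by (simp add: weak_solution_def Let_def)
    with u0M show ?thesis by eventually_elim simp
  qed
  have le_M: "AE x in ?L. v s x \<le> M" if "0 \<le> s" for s
    using comparison_with_linear_barrier[OF _ lower0 order_refl that _ init] M0 by simp
  \<comment> \<open>for \<open>M = 0\<close> there is no admissible slope, but then \<open>T = 0\<close> and the constant barrier suffices\<close>
  have at_T: "AE x in ?L. v T x \<le> 0"
  proof (cases "M = 0")
    case True
    then show ?thesis using le_M[OF T0] by simp
  next
    case False
    then have M: "0 < M" using M0 by simp
    define c where "c = M powr (- \<beta>)"
    \<comment> \<open>the barrier \<open>M - c * t\<close> reaches zero exactly at \<open>T\<close>\<close>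
    have cT: "c * T = M" using M by (simp add: c_def T_def powr_add[symmetric])
    have VM: "AE z in lborel. V z \<le> M"
    proof -
      have "AE t in lborel. AE x in lborel. V (x, t) \<le> M"
        using slice
      proof eventually_elim
        case (elim t)
        show ?case
        proof (cases "0 < t")
          case True
          have "AE x in lborel. x \<in> {-l<..<l} \<longrightarrow> v t x \<le> M"
            using le_M[of t] True by (subst AE_lebesgue_on_iff[symmetric]) auto
          with elim[rule_format, OF True] show ?thesis
          proof eventually_elim
            case (elim x)
            then show ?case using outside(1)[of "(x, t)"] M by (cases "x \<in> {-l<..<l}") auto
          qed
        next
          case False
          then show ?thesis using outside(1) M by (intro AE_I2) simp
        qed
      qed
      moreover have m: "{z \<in> space (lborel \<Otimes>\<^sub>M lborel). V z \<le> M} \<in> sets (lborel \<Otimes>\<^sub>M lborel)"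
        unfolding lborel_prod by measurable
      ultimately have "AE x in lborel. AE t in lborel. V (x, t) \<le> M"
        using lborel_pair.AE_commute[of "\<lambda>x t. V (x, t) \<le> M"] by simp
      with m have "AE z in lborel \<Otimes>\<^sub>M lborel. V z \<le> M"
        by (intro lborel_pair.AE_pair_measure)
      then show ?thesis by (simp only: lborel_prod)
    qed
    have lower: "AE z in lborel. 0 \<le> V z \<and> 0 \<le> sing_absorption \<beta> (V z) + f (V z) \<and>
        (0 < V z \<longrightarrow> c \<le> sing_absorption \<beta> (V z) + f (V z))"
      using V_nonneg VM
    proof eventually_elim
      case (elim z)
      have "c \<le> sing_absorption \<beta> (V z) + f (V z)" if pos: "0 < V z"
      proof -
        have "c \<le> V z powr (- \<beta>)"
          unfolding c_def using \<beta> pos elim by (intro powr_mono2') auto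
        then show ?thesis using pos f_nonneg by (simp add: sing_absorption_def add_increasing2)
      qed
      then show ?case using elim G_nonneg by simp
    qed
    have "0 \<le> c" by (simp add: c_def)
    from comparison_with_linear_barrier[OF this lower order_refl T0 _ init] cT show ?thesis by simp
  qed
  have "AE x in ?L. v t x \<le> 0 - 0 * (t - T)"
    by (rule comparison_with_linear_barrier[OF order_refl lower0 T0 t _ at_T]) simp
  then show "AE x in ?L. v t x = 0"
    using nonneg_at_all_times[OF V_nonneg order_trans[OF T0 t]] by eventually_elim simp
qed

end
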